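(* Let $\mathcal{H}_1\to\mathcal{H}_2$ be a central morphism of affine Hecke algebras and let $\pi$ be an $\mathcal{H}_1$-module. For $g\in\mathcal{H}_2$ invertible let $\pi^g(h)=\pi(g^{-1}hg)$. Choose a set of representatives for $X_2/X_1$ in $X_2$ arbitrarily, and for $g\in X_2/X_1$ write $\pi^g$ for $\pi^{\theta_x}$, where $x\in X_2$ is the chosen representative of $g$. Then: 1. $\mathrm{Res}^{\mathcal{H}_2}_{\mathcal{H}_1}\mathrm{Ind}_{\mathcal{H}_1}^{\mathcal{H}_2}\pi=\bigoplus_{g\in X_2/X_1}\pi^g$, with $\mathrm{Res}^{\mathcal{H}_1}_{\mathcal{A}_1}\pi^g=\mathrm{Res}^{\mathcal{H}_1}_{\mathcal{A}_1}\pi$ for all $g$. Furthermore, if $\pi$ is irreducible then so is each summand $\pi^g$, and if $\pi$ is semisimple then so is $\mathrm{Res}^{\mathcal{H}_2}_{\mathcal{H}_1}\mathrm{Ind}_{\mathcal{H}_1}^{\mathcal{H}_2}\pi$. 2. If $\mathcal{H}_1\to\mathcal{H}_2$ is an isogeny and $\pi$ is semisimple, then so is $\mathrm{Ind}_{\mathcal{H}_1}^{\mathcal{H}_2}\pi$.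
   Context: Affine Hecke algebras. Let $\mathcal{R} = (X,R,Y,R^\vee,\Delta)$ be a reduced based root datum ($X,Y$ free abelian of finite rank in perfect duality $\langle\cdot,\cdot\rangle$, $\Delta\subset R$ a base of simple roots), with finite Weyl group $W$ and simple reflections $s_\alpha$, $\alpha\in\Delta$. Fix $q\in\mathbb{R}_{>1}$ and parameter functions $\lambda,\lambda^*: R\to\mathbb{R}\setminus\{0\}$, constant on orbits of $W\ltimes X$ (acting on $R$ through $W$), with $\lambda(\alpha)=\lambda^*(\alpha)$ if $\alpha^\vee\notin 2Y$ and $\lambda(\alpha)+\lambda^*(\alpha)\neq 0$ if $\alpha^\vee\in 2Y$. The affine Hecke algebra $\mathcal{H}=\mathcal{H}(\mathcal{R})$ is the $\mathbb{C}$-algebra with linear basis $\theta_xT_w$ ($x\in X$, $w\in W$) and relations: $T_wT_{w'}=T_{ww'}$ if $\ell(ww')=\ell(w)+\ell(w')$; $(T_{s_\alpha}+1)(T_{s_\alpha}-q^{\lambda(\alpha)})=0$ for $\alpha\in\Delta$; $\theta_x\theta_y=\theta_{x+y}$; and, for $s=s_\alpha$, $\alpha\in\Delta$, $T_s\theta_x=\theta_{s(x)}T_s+(q^{\lambda(\alpha)}-1)\frac{\theta_x-\theta_{s(x)}}{1-\theta_{-\alpha}}$ if $\alpha^\vee\notin 2Y$, and $T_s\theta_x=\theta_{s(x)}T_s+\big((q^{\lambda(\alpha)}-1)+\theta_{-\alpha}(q^{(\lambda(\alpha)+\lambda^*(\alpha))/2}-q^{(\lambda(\alpha)-\lambda^*(\alpha))/2})\big)\frac{\theta_x-\theta_{s(x)}}{1-\theta_{-2\alpha}}$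 if $\alpha^\vee\in 2Y$. $\mathcal{A}=\mathbb{C}[X]\subset\mathcal{H}$ is the commutative subalgebra spanned by the $\theta_x$; for $\mathcal{H}_i=\mathcal{H}(\mathcal{R}_i)$ it is written $\mathcal{A}_i$. Central morphisms. A central morphism of based root data $(X_1,R_1,Y_1,R_1^\vee,\Delta_1)\to(X_2,R_2,Y_2,R_2^\vee,\Delta_2)$ is a group homomorphism $f:X_1\to X_2$ (not required to be injective) whose restriction to $R_1$ defines an isomorphism of based root systems $(\mathbb{R}R_1,R_1,\mathbb{R}R_1^\vee,R_1^\vee,\Delta_1)\to(\mathbb{R}R_2,R_2,\mathbb{R}R_2^\vee,R_2^\vee,\Delta_2)$, where the transpose $f^\vee:Y_2\to Y_1$ sends $f(\alpha)^\vee$ to $\alpha^\vee$ for all $\alpha\in R_1$ (so the Weyl groups are identified and $f$ is $W$-equivariant). It is an isogeny if $f$ is injective with finite cokernel. If the parameters are compatible (same $q$, $\lambda_2\circ f=\lambda_1$ and $\lambda_2^*\circ f=\lambda_1^*$ on $R_1$), there is an algebra homomorphism $\mathcal{H}(\mathcal{R}_1)\to\mathcal{H}(\mathcal{R}_2)$, $\theta_xT_w\mapsto\theta_{f(x)}T_w$, called a central morphism (respectively isogeny) of affine Hecke algebras; if $f$ is injective this is an inclusion. Write $X_2/X_1$ for the cokernel $X_2/f(X_1)$. $\mathrm{Ind}_{\mathcal{H}_1}^{\mathcal{H}_2}\pi=\mathcal{H}_2\otimes_{\mathcal{H}_1}\pi$, and $\mathrm{Res}$ is restriction along the homomorphism (for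 $\mathcal{A}_1$, along the inclusion $\mathcal{A}_1\subset\mathcal{H}_1$).
   Formalization: The direct-sum formula is stated when θ_k acts as 1 on π for all k in ker f (automatic for injective f; it fails otherwise, e.g. R empty, X_1=Z, X_2=0). For non-injective f, π^g uses the lift of conjugation by θ_x to H_1 preserving the X_1/ZR_1-grading. *)

theory Defs
  imports Complex_Main "HOL-Algebra.Algebra" "HOL-Algebra.Algebraic_Closure_Type"
begin

section \<open>Based root data\<close>

definition zsmult :: "int \<Rightarrow> 'a::ab_group_add \<Rightarrow> 'a" where
  "zsmult n x = (if 0 \<le> n then (\<Sum>i<nat n. x) else - (\<Sum>i<nat (- n). x))"

lemma zsmult_of_nat_diff: "zsmult (int m - int k) x = (\<Sum>i<m. x) - (\<Sum>i<k. x)"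
proof (cases "k \<le> m")
  case True
  then obtain d where d: "m = k + d" using le_Suc_ex by blast
  have "(\<Sum>i<k+d. x) = (\<Sum>i<k. x) + (\<Sum>i<d. x)" by (induction d) (auto simp: algebra_simps)
  then show ?thesis using d by (simp add: zsmult_def)
next
  case False
  then obtain d where d: "k = m + d" "d > 0"
    by (metis less_imp_add_positive not_le)
  have "(\<Sum>i<m+d. x) = (\<Sum>i<m. x) + (\<Sum>i<d. x)" by (induction d) (auto simp: algebra_simps)
  then show ?thesis using d by (simp add: zsmult_def)
qed

lemma module_zsmult: "Modules.module (zsmult :: int \<Rightarrow> 'a::ab_group_add \<Rightarrow> 'a)"
proof
  fix a b :: int and x y :: 'a
  obtain m k where a: "a = int m - int k" using int_diff_cases by blast
  obtain p r where b: "b = int p - int r" using int_diff_cases by blast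
  have add: "(\<Sum>i<u+v. z) = (\<Sum>i<u. z) + (\<Sum>i<v. z)" for u v :: nat and z :: 'a
    by (induction v) (auto simp: algebra_simps)
  have mult: "(\<Sum>i<u*v. z) = (\<Sum>i<u. (\<Sum>i<v. z))" for u v :: nat and z :: 'a
    by (induction u) (auto simp: add add.commute)
  show "zsmult a (x + y) = zsmult a x + zsmult a y"
    unfolding a zsmult_of_nat_diff by (simp add: sum.distrib)
  have ab: "a + b = int (m + p) - int (k + r)" using a b by simp
  show "zsmult (a + b) x = zsmult a x + zsmult b x"
    unfolding ab zsmult_of_nat_diff unfolding a b zsmult_of_nat_diff by (simp add: add)
  have amb: "a * b = int (m * p + k * r) - int (m * r + k * p)"
    unfolding a b by (simp add: algebra_simps)
  show "zsmult a (zsmult b x) = zsmult (a * b) x"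
    unfolding amb zsmult_of_nat_diff unfolding a b zsmult_of_nat_diff
    by (simp add: add mult sum_subtractf)
  show "zsmult 1 x = x" by (simp add: zsmult_def)
qed

global_interpretation zmod: Modules.module zsmult
  by (rule module_zsmult)

definition free_finite_rank :: "'a::ab_group_add itself \<Rightarrow> bool" where
  "free_finite_rank TYPE('a) \<longleftrightarrow>
    (\<exists>B::'a set. finite B \<and> \<not> zmod.dependent B \<and> zmod.span B = UNIV)"

text \<open>The lattices X and Y are the whole types \<open>'x\<close> and \<open>'y\<close>. The set of coroots is
  \<open>coroot D ` roots D\<close>; the values of \<open>coroot D\<close> outside \<open>roots D\<close> play no role.\<close>

record ('x, 'y) root_datum =
  roots :: "'x set"
  coroot :: "'x \<Rightarrow> 'y"
  pairing :: "'x \<Rightarrow> 'y \<Rightarrow> int"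
  simple_roots :: "'x set"

definition reflection :: "('x::ab_group_add, 'y) root_datum \<Rightarrow> 'x \<Rightarrow> 'x \<Rightarrow> 'x" where
  "reflection D \<alpha> x = x - zsmult (pairing D x (coroot D \<alpha>)) \<alpha>"

definition coreflection :: "('x, 'y::ab_group_add) root_datum \<Rightarrow> 'x \<Rightarrow> 'y \<Rightarrow> 'y" where
  "coreflection D \<alpha> y = y - zsmult (pairing D \<alpha> y) (coroot D \<alpha>)"

definition perfect_pairing :: "('x::ab_group_add \<Rightarrow> 'y::ab_group_add \<Rightarrow> int) \<Rightarrow> bool" where
  "perfect_pairing p \<longleftrightarrow>
    (\<forall>x. additive (\<lambda>y. p x y)) \<and> (\<forall>y. additive (\<lambda>x. p x y)) \<and>
    (\<forall>g::'y \<Rightarrow> int. additive g \<longrightarrow> (\<exists>!x. \<forall>y. p x y = g y)) \<and>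
    (\<forall>g::'x \<Rightarrow> int. additive g \<longrightarrow> (\<exists>!y. \<forall>x. p x y = g x))"

definition root_datum :: "('x::ab_group_add, 'y::ab_group_add) root_datum \<Rightarrow> bool" where
  "root_datum D \<longleftrightarrow>
    free_finite_rank TYPE('x) \<and> free_finite_rank TYPE('y) \<and> perfect_pairing (pairing D) \<and>
    finite (roots D) \<and> inj_on (coroot D) (roots D) \<and>
    (\<forall>\<alpha>\<in>roots D. pairing D \<alpha> (coroot D \<alpha>) = 2 \<and>
       reflection D \<alpha> ` roots D = roots D \<and>
       coreflection D \<alpha> ` (coroot D ` roots D) = coroot D ` roots D)"

definition reduced :: "('x::ab_group_add, 'y) root_datum \<Rightarrow> bool" where
  "reduced D \<longleftrightarrow>
    (\<forall>\<alpha>\<in>roots D. \<forall>\<beta>\<in>roots D. \<forall>m n. m \<noteq> 0 \<and> n \<noteq> 0 \<and> zsmult m \<alpha> = zsmult n \<beta> \<longrightarrow> \<beta> = \<alpha> \<or> \<beta> = - \<alpha>)"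

definition base :: "('x::ab_group_add, 'y) root_datum \<Rightarrow> bool" where
  "base D \<longleftrightarrow>
    simple_roots D \<subseteq> roots D \<and> \<not> zmod.dependent (simple_roots D) \<and>
    (\<forall>\<beta>\<in>roots D. \<exists>c::'x \<Rightarrow> nat.
       \<beta> = (\<Sum>\<alpha>\<in>simple_roots D. zsmult (int (c \<alpha>)) \<alpha>) \<or>
       \<beta> = - (\<Sum>\<alpha>\<in>simple_roots D. zsmult (int (c \<alpha>)) \<alpha>))"

definition reduced_based_root_datum ::
    "('x::ab_group_add, 'y::ab_group_add) root_datum \<Rightarrow> bool" where
  "reduced_based_root_datum D \<longleftrightarrow> root_datum D \<and> reduced D \<and> base D"

definition reflection_word :: "('x::ab_group_add, 'y) root_datum \<Rightarrow> 'x list \<Rightarrow> 'x \<Rightarrow> 'x" where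
  "reflection_word D \<alpha>s = foldr (\<lambda>\<alpha> w. reflection D \<alpha> \<circ> w) \<alpha>s id"

text \<open>Reflections are involutions, so the monoid generated by them is the group generated by them.\<close>

definition weyl_group :: "('x::ab_group_add, 'y) root_datum \<Rightarrow> ('x \<Rightarrow> 'x) set" where
  "weyl_group D = {reflection_word D \<alpha>s | \<alpha>s. set \<alpha>s \<subseteq> roots D}"

definition weyl_length :: "('x::ab_group_add, 'y) root_datum \<Rightarrow> ('x \<Rightarrow> 'x) \<Rightarrow> nat" where
  "weyl_length D w =
    (LEAST n. \<exists>\<alpha>s. set \<alpha>s \<subseteq> simple_roots D \<and> length \<alpha>s = n \<and> reflection_word D \<alpha>s = w)"


section \<open>Modules over noncommutative rings\<close>

text \<open>HOL-Algebra's locale \<open>module\<close> requires a commutative ring. As there, a module is a record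
  whose fields \<open>mult\<close> and \<open>one\<close> play no role.\<close>

locale left_module = R?: ring R + M?: abelian_group M
  for R :: "('r, 'm) ring_scheme" (structure) and M :: "('r, 'v, 'n) module_scheme" (structure) +
  assumes smult_closed: "\<lbrakk>a \<in> carrier R; v \<in> carrier M\<rbrakk> \<Longrightarrow> a \<odot>\<^bsub>M\<^esub> v \<in> carrier M"
    and smult_l_distr: "\<lbrakk>a \<in> carrier R; b \<in> carrier R; v \<in> carrier M\<rbrakk> \<Longrightarrow>
      (a \<oplus> b) \<odot>\<^bsub>M\<^esub> v = a \<odot>\<^bsub>M\<^esub> v \<oplus>\<^bsub>M\<^esub> b \<odot>\<^bsub>M\<^esub> v"
    and smult_r_distr: "\<lbrakk>a \<in> carrier R; v \<in> carrier M; w \<in> carrier M\<rbrakk> \<Longrightarrow>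
      a \<odot>\<^bsub>M\<^esub> (v \<oplus>\<^bsub>M\<^esub> w) = a \<odot>\<^bsub>M\<^esub> v \<oplus>\<^bsub>M\<^esub> a \<odot>\<^bsub>M\<^esub> w"
    and smult_assoc: "\<lbrakk>a \<in> carrier R; b \<in> carrier R; v \<in> carrier M\<rbrakk> \<Longrightarrow>
      (a \<otimes> b) \<odot>\<^bsub>M\<^esub> v = a \<odot>\<^bsub>M\<^esub> (b \<odot>\<^bsub>M\<^esub> v)"
    and smult_one: "v \<in> carrier M \<Longrightarrow> \<one> \<odot>\<^bsub>M\<^esub> v = v"

definition module_homs ::
    "('r, 'm) ring_scheme \<Rightarrow> ('r, 'v) module \<Rightarrow> ('r, 'w) module \<Rightarrow> ('v \<Rightarrow> 'w) set" where
  "module_homs R M N =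
    {u \<in> carrier M \<rightarrow> carrier N.
       (\<forall>v\<in>carrier M. \<forall>w\<in>carrier M. u (v \<oplus>\<^bsub>M\<^esub> w) = u v \<oplus>\<^bsub>N\<^esub> u w) \<and>
       (\<forall>a\<in>carrier R. \<forall>v\<in>carrier M. u (a \<odot>\<^bsub>M\<^esub> v) = a \<odot>\<^bsub>N\<^esub> u v)}"

definition module_isomorphic ::
    "('r, 'm) ring_scheme \<Rightarrow> ('r, 'v) module \<Rightarrow> ('r, 'w) module \<Rightarrow> bool" where
  "module_isomorphic R M N \<longleftrightarrow> (\<exists>u\<in>module_homs R M N. bij_betw u (carrier M) (carrier N))"

definition irreducible_module :: "('r, 'm) ring_scheme \<Rightarrow> ('r, 'v) module \<Rightarrow> bool" where
  "irreducible_module R M \<longleftrightarrow>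
    left_module R M \<and> carrier M \<noteq> {\<zero>\<^bsub>M\<^esub>} \<and>
    (\<forall>N. submodule N R M \<longrightarrow> N = {\<zero>\<^bsub>M\<^esub>} \<or> N = carrier M)"

text \<open>Semisimple: the internal direct sum of a set of irreducible submodules.\<close>

definition semisimple_module :: "('r, 'm) ring_scheme \<Rightarrow> ('r, 'v) module \<Rightarrow> bool" where
  "semisimple_module R M \<longleftrightarrow>
    left_module R M \<and>
    (\<exists>\<S>. (\<forall>N\<in>\<S>. submodule N R M \<and> irreducible_module R (M\<lparr>carrier := N\<rparr>)) \<and>
      (\<forall>v\<in>carrier M. \<exists>!c. c \<in> (\<Pi>\<^sub>E N\<in>\<S>. N) \<and> finite {N \<in> \<S>. c N \<noteq> \<zero>\<^bsub>M\<^esub>} \<and>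
         v = finsum M c {N \<in> \<S>. c N \<noteq> \<zero>\<^bsub>M\<^esub>}))"

definition direct_sum :: "'i set \<Rightarrow> ('i \<Rightarrow> ('r, 'v) module) \<Rightarrow> ('r, 'i \<Rightarrow> 'v) module" where
  "direct_sum I M =
    \<lparr>carrier = carrier (sum_group I (\<lambda>i. add_monoid (M i))),
     monoid.mult = undefined, one = undefined,
     ring.zero = one (sum_group I (\<lambda>i. add_monoid (M i))),
     add = monoid.mult (sum_group I (\<lambda>i. add_monoid (M i))),
     module.smult = (\<lambda>a F. \<lambda>i\<in>I. a \<odot>\<^bsub>M i\<^esub> F i)\<rparr>"

text \<open>Restriction of scalars to \<open>A\<close> along \<open>\<phi>\<close>. The action is made extensional, so that an equation
  between restrictions to a subring only speaks about the action of that subring.\<close>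

definition Res :: "('a, 'm) ring_scheme \<Rightarrow> ('a \<Rightarrow> 'r) \<Rightarrow> ('r, 'v) module \<Rightarrow> ('a, 'v) module" where
  "Res A \<phi> M =
    \<lparr>carrier = carrier M, monoid.mult = monoid.mult M, one = one M, ring.zero = ring.zero M, add = add M,
     module.smult = (\<lambda>a\<in>carrier A. \<lambda>v\<in>carrier M. \<phi> a \<odot>\<^bsub>M\<^esub> v)\<rparr>"

text \<open>The tensor product of \<open>B\<close> (a right \<open>A\<close>-module through \<open>\<phi>\<close>) and \<open>M\<close> over \<open>A\<close>: the free abelian
  group on the pairs \<open>(b, v)\<close> modulo the subgroup generated by the balanced biadditive relations.\<close>

definition tensor_free ::
    "('b, 'm) ring_scheme \<Rightarrow> ('a, 'v) module \<Rightarrow> ('b \<times> 'v \<Rightarrow>\<^sub>0 int) monoid" where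
  "tensor_free B M = free_Abelian_group (carrier B \<times> carrier M)"

definition tensor_relations ::
    "('a, 'm) ring_scheme \<Rightarrow> ('b, 'n) ring_scheme \<Rightarrow> ('a \<Rightarrow> 'b) \<Rightarrow> ('a, 'v) module \<Rightarrow>
     ('b \<times> 'v \<Rightarrow>\<^sub>0 int) set" where
  "tensor_relations A B \<phi> M = generate (tensor_free B M)
    ({frag_of (b \<oplus>\<^bsub>B\<^esub> b', v) - frag_of (b, v) - frag_of (b', v) | b b' v.
        b \<in> carrier B \<and> b' \<in> carrier B \<and> v \<in> carrier M} \<union>
     {frag_of (b, v \<oplus>\<^bsub>M\<^esub> v') - frag_of (b, v) - frag_of (b, v') | b v v'.
        b \<in> carrier B \<and> v \<in> carrier M \<and> v' \<in> carrier M} \<union>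
     {frag_of (b \<otimes>\<^bsub>B\<^esub> \<phi> a, v) - frag_of (b, a \<odot>\<^bsub>M\<^esub> v) | a b v.
        a \<in> carrier A \<and> b \<in> carrier B \<and> v \<in> carrier M})"

text \<open>\<open>b\<close> acts on a coset by left multiplication of the first tensor factor of its elements.\<close>

definition Ind ::
    "('a, 'm) ring_scheme \<Rightarrow> ('b, 'n) ring_scheme \<Rightarrow> ('a \<Rightarrow> 'b) \<Rightarrow> ('a, 'v) module \<Rightarrow>
     ('b, ('b \<times> 'v \<Rightarrow>\<^sub>0 int) set) module" where
  "Ind A B \<phi> M =
    (let F = tensor_free B M; N = tensor_relations A B \<phi> M in
     \<lparr>carrier = carrier (F Mod N), monoid.mult = undefined, one = undefined,
      ring.zero = one (F Mod N), add = monoid.mult (F Mod N),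
      module.smult = (\<lambda>b C. N <#>\<^bsub>F\<^esub> (frag_extend (\<lambda>(b', v). frag_of (b \<otimes>\<^bsub>B\<^esub> b', v)) ` C))\<rparr>)"


section \<open>Affine Hecke algebras\<close>

abbreviation complex_ring :: "complex ring" where
  "complex_ring \<equiv> ring_of_type_algebra"

text \<open>HOL-Algebra's locale \<open>algebra\<close> is restricted to commutative algebras.\<close>

definition complex_algebra :: "(complex, 'h) module \<Rightarrow> bool" where
  "complex_algebra H \<longleftrightarrow>
    ring H \<and> Module.module complex_ring H \<and>
    (\<forall>c. \<forall>a\<in>carrier H. \<forall>b\<in>carrier H.
       (c \<odot>\<^bsub>H\<^esub> a) \<otimes>\<^bsub>H\<^esub> b = c \<odot>\<^bsub>H\<^esub> (a \<otimes>\<^bsub>H\<^esub> b) \<and>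
       a \<otimes>\<^bsub>H\<^esub> (c \<odot>\<^bsub>H\<^esub> b) = c \<odot>\<^bsub>H\<^esub> (a \<otimes>\<^bsub>H\<^esub> b))"

definition algebra_homs :: "(complex, 'h) module \<Rightarrow> (complex, 'k) module \<Rightarrow> ('h \<Rightarrow> 'k) set" where
  "algebra_homs H K = ring_hom H K \<inter> module_homs complex_ring H K"

definition linear_span :: "(complex, 'h) module \<Rightarrow> 'h set \<Rightarrow> 'h set" where
  "linear_span H E = {finsum H (\<lambda>e. c e \<odot>\<^bsub>H\<^esub> e) F | c F. finite F \<and> F \<subseteq> E}"

record ('x, 'y, 'h) hecke =
  datum :: "('x, 'y) root_datum"
  qpar :: real
  lam :: "'x \<Rightarrow> real"
  lamstar :: "'x \<Rightarrow> real"
  alg :: "(complex, 'h) module"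
  theta :: "'x \<Rightarrow> 'h"
  Tw :: "('x \<Rightarrow> 'x) \<Rightarrow> 'h"

definition even_coroot :: "('x, 'y::ab_group_add) root_datum \<Rightarrow> 'x \<Rightarrow> bool" where
  "even_coroot D \<alpha> \<longleftrightarrow> (\<exists>y. coroot D \<alpha> = y + y)"

definition hecke_parameters ::
    "('x::ab_group_add, 'y::ab_group_add) root_datum \<Rightarrow> real \<Rightarrow> ('x \<Rightarrow> real) \<Rightarrow> ('x \<Rightarrow> real) \<Rightarrow> bool"
  where
  "hecke_parameters D q l ls \<longleftrightarrow>
    q > 1 \<and>
    (\<forall>\<alpha>\<in>roots D. l \<alpha> \<noteq> 0 \<and> ls \<alpha> \<noteq> 0 \<and>
       (\<forall>w\<in>weyl_group D. l (w \<alpha>) = l \<alpha> \<and> ls (w \<alpha>) = ls \<alpha>) \<and>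
       (if even_coroot D \<alpha> then l \<alpha> + ls \<alpha> \<noteq> 0 else l \<alpha> = ls \<alpha>))"

definition lattice_algebra :: "('x, 'y, 'h) hecke \<Rightarrow> 'h set" where
  "lattice_algebra \<H> = linear_span (alg \<H>) (range (theta \<H>))"

text \<open>The quotient \<open>a / b\<close> computed in the integral domain \<open>lattice_algebra \<H>\<close>.\<close>

definition lattice_quotient :: "('x, 'y, 'h) hecke \<Rightarrow> 'h \<Rightarrow> 'h \<Rightarrow> 'h" where
  "lattice_quotient \<H> a b = (THE d. d \<in> lattice_algebra \<H> \<and> d \<otimes>\<^bsub>alg \<H>\<^esub> b = a)"

definition bernstein_relation ::
    "('x::ab_group_add, 'y::ab_group_add, 'h) hecke \<Rightarrow> 'x \<Rightarrow> 'x \<Rightarrow> bool" where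
  "bernstein_relation \<H> \<alpha> x \<longleftrightarrow>
    (let H = alg \<H>; \<theta> = theta \<H>; s = reflection (datum \<H>) \<alpha>; T = Tw \<H> s;
         l = lam \<H> \<alpha>; ls = lamstar \<H> \<alpha>; Q = (\<lambda>r. complex_of_real (qpar \<H> powr r)) in
     T \<otimes>\<^bsub>H\<^esub> \<theta> x = \<theta> (s x) \<otimes>\<^bsub>H\<^esub> T \<oplus>\<^bsub>H\<^esub>
      (if even_coroot (datum \<H>) \<alpha>
       then ((Q l - 1) \<odot>\<^bsub>H\<^esub> \<one>\<^bsub>H\<^esub> \<oplus>\<^bsub>H\<^esub> (Q ((l + ls) / 2) - Q ((l - ls) / 2)) \<odot>\<^bsub>H\<^esub> \<theta> (- \<alpha>))
              \<otimes>\<^bsub>H\<^esub> lattice_quotient \<H> (\<theta> x \<ominus>\<^bsub>H\<^esub> \<theta> (s x)) (\<one>\<^bsub>H\<^esub> \<ominus>\<^bsub>H\<^esub> \<theta> (- (\<alpha> + \<alpha>)))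
       else (Q l - 1) \<odot>\<^bsub>H\<^esub>
              lattice_quotient \<H> (\<theta> x \<ominus>\<^bsub>H\<^esub> \<theta> (s x)) (\<one>\<^bsub>H\<^esub> \<ominus>\<^bsub>H\<^esub> \<theta> (- \<alpha>))))"

text \<open>The algebra is determined up to isomorphism by its basis and relations; \<open>\<H>\<close> is any
  realisation of it. The normalisations \<open>theta 0 = 1 = Tw id\<close> express that the basis element
  for \<open>(x, id)\<close> is \<open>theta x\<close> and the one for \<open>(0, w)\<close> is \<open>Tw w\<close>.\<close>

definition affine_hecke_algebra :: "('x::ab_group_add, 'y::ab_group_add, 'h) hecke \<Rightarrow> bool" where
  "affine_hecke_algebra \<H> \<longleftrightarrow>
    (let D = datum \<H>; H = alg \<H>; \<theta> = theta \<H>; T = Tw \<H>; W = weyl_group D in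
     reduced_based_root_datum D \<and>
     hecke_parameters D (qpar \<H>) (lam \<H>) (lamstar \<H>) \<and>
     complex_algebra H \<and>
     range \<theta> \<subseteq> carrier H \<and> T ` W \<subseteq> carrier H \<and>
     (\<forall>h\<in>carrier H. \<exists>!c. finite {p. c p \<noteq> 0} \<and> {p. c p \<noteq> 0} \<subseteq> UNIV \<times> W \<and>
        h = finsum H (\<lambda>(x, w). c (x, w) \<odot>\<^bsub>H\<^esub> (\<theta> x \<otimes>\<^bsub>H\<^esub> T w)) {p. c p \<noteq> 0}) \<and>
     \<theta> 0 = \<one>\<^bsub>H\<^esub> \<and> T id = \<one>\<^bsub>H\<^esub> \<and>
     (\<forall>w\<in>W. \<forall>w'\<in>W. weyl_length D (w \<circ> w') = weyl_length D w + weyl_length D w' \<longrightarrow>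
        T w \<otimes>\<^bsub>H\<^esub> T w' = T (w \<circ> w')) \<and>
     (\<forall>\<alpha>\<in>simple_roots D.
        (T (reflection D \<alpha>) \<oplus>\<^bsub>H\<^esub> \<one>\<^bsub>H\<^esub>) \<otimes>\<^bsub>H\<^esub>
        (T (reflection D \<alpha>) \<ominus>\<^bsub>H\<^esub> complex_of_real (qpar \<H> powr lam \<H> \<alpha>) \<odot>\<^bsub>H\<^esub> \<one>\<^bsub>H\<^esub>) = \<zero>\<^bsub>H\<^esub>) \<and>
     (\<forall>x y. \<theta> x \<otimes>\<^bsub>H\<^esub> \<theta> y = \<theta> (x + y)) \<and>
     (\<forall>\<alpha>\<in>simple_roots D. \<forall>x. bernstein_relation \<H> \<alpha> x))"


section \<open>Central morphisms\<close>

text \<open>An isomorphism of the spans over the reals that matches the (co)roots is the same as an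
  isomorphism of the spans over the integers that matches them; \<open>ft\<close> is the transpose of \<open>f\<close>.\<close>

definition central_morphism_data ::
    "('x1::ab_group_add, 'y1::ab_group_add) root_datum \<Rightarrow>
     ('x2::ab_group_add, 'y2::ab_group_add) root_datum \<Rightarrow> ('x1 \<Rightarrow> 'x2) \<Rightarrow> bool" where
  "central_morphism_data D1 D2 f \<longleftrightarrow>
    additive f \<and>
    bij_betw f (zmod.span (roots D1)) (zmod.span (roots D2)) \<and>
    bij_betw f (roots D1) (roots D2) \<and> f ` simple_roots D1 = simple_roots D2 \<and>
    (\<exists>ft. additive ft \<and> (\<forall>x y. pairing D2 (f x) y = pairing D1 x (ft y)) \<and>
       bij_betw ft (zmod.span (coroot D2 ` roots D2)) (zmod.span (coroot D1 ` roots D1)) \<and>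
       (\<forall>\<alpha>\<in>roots D1. ft (coroot D2 (f \<alpha>)) = coroot D1 \<alpha>))"

text \<open>The identification of the Weyl groups pairs \<open>w\<close> with the unique \<open>w'\<close> such that
  \<open>w' \<circ> f = f \<circ> w\<close>.\<close>

definition central_morphism ::
    "('x1::ab_group_add, 'y1::ab_group_add, 'h1) hecke \<Rightarrow>
     ('x2::ab_group_add, 'y2::ab_group_add, 'h2) hecke \<Rightarrow>
     ('x1 \<Rightarrow> 'x2) \<Rightarrow> ('h1 \<Rightarrow> 'h2) \<Rightarrow> bool" where
  "central_morphism \<H>1 \<H>2 f \<phi> \<longleftrightarrow>
    affine_hecke_algebra \<H>1 \<and> affine_hecke_algebra \<H>2 \<and>
    central_morphism_data (datum \<H>1) (datum \<H>2) f \<and>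
    qpar \<H>1 = qpar \<H>2 \<and>
    (\<forall>\<alpha>\<in>roots (datum \<H>1). lam \<H>2 (f \<alpha>) = lam \<H>1 \<alpha> \<and> lamstar \<H>2 (f \<alpha>) = lamstar \<H>1 \<alpha>) \<and>
    \<phi> \<in> algebra_homs (alg \<H>1) (alg \<H>2) \<and>
    (\<forall>x. \<forall>w\<in>weyl_group (datum \<H>1). \<forall>w'\<in>weyl_group (datum \<H>2). w' \<circ> f = f \<circ> w \<longrightarrow>
       \<phi> (theta \<H>1 x \<otimes>\<^bsub>alg \<H>1\<^esub> Tw \<H>1 w) = theta \<H>2 (f x) \<otimes>\<^bsub>alg \<H>2\<^esub> Tw \<H>2 w')"

definition isogeny ::
    "('x1::ab_group_add, 'y1::ab_group_add, 'h1) hecke \<Rightarrow>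
     ('x2::ab_group_add, 'y2::ab_group_add, 'h2) hecke \<Rightarrow>
     ('x1 \<Rightarrow> 'x2) \<Rightarrow> ('h1 \<Rightarrow> 'h2) \<Rightarrow> bool" where
  "isogeny \<H>1 \<H>2 f \<phi> \<longleftrightarrow>
    central_morphism \<H>1 \<H>2 f \<phi> \<and> inj f \<and> finite (UNIV // {(x, y). x - y \<in> range f})"

definition cokernel_reps :: "('x1 \<Rightarrow> 'x2::ab_group_add) \<Rightarrow> 'x2 set \<Rightarrow> bool" where
  "cokernel_reps f S \<longleftrightarrow> (\<forall>x. \<exists>!s. s \<in> S \<and> x - s \<in> range f)"

text \<open>The piece of degree \<open>y + \<int>R\<close> of the grading of the algebra by the quotient of X by the root
  lattice.\<close>

definition graded_piece :: "('x::ab_group_add, 'y, 'h) hecke \<Rightarrow> 'x \<Rightarrow> 'h set" where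
  "graded_piece \<H> y = linear_span (alg \<H>)
    {theta \<H> x \<otimes>\<^bsub>alg \<H>\<^esub> Tw \<H> w | x w.
       x - y \<in> zmod.span (roots (datum \<H>)) \<and> w \<in> weyl_group (datum \<H>)}"

text \<open>The map \<open>h \<mapsto> inverse g * h * g\<close> on the source algebra, for \<open>g\<close> in the target algebra. If \<open>\<phi>\<close> is
  injective, the third clause determines it. In general that clause determines \<open>\<psi> h\<close> only up to the
  kernel of \<open>\<phi>\<close>; the requirement that \<open>\<psi>\<close> is linear and homogeneous selects one lift, since \<open>\<phi>\<close> is
  injective on each graded piece.\<close>

definition is_conj_lift ::
    "('x1::ab_group_add, 'y1, 'h1) hecke \<Rightarrow> ('x2, 'y2, 'h2) hecke \<Rightarrow> ('h1 \<Rightarrow> 'h2) \<Rightarrow> 'h2 \<Rightarrow>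
     ('h1 \<Rightarrow> 'h1) \<Rightarrow> bool" where
  "is_conj_lift \<H>1 \<H>2 \<phi> g \<psi> \<longleftrightarrow>
    \<psi> \<in> extensional (carrier (alg \<H>1)) \<and>
    \<psi> \<in> module_homs complex_ring (alg \<H>1) (alg \<H>1) \<and>
    (\<forall>h\<in>carrier (alg \<H>1). \<phi> (\<psi> h) = inv\<^bsub>alg \<H>2\<^esub> g \<otimes>\<^bsub>alg \<H>2\<^esub> \<phi> h \<otimes>\<^bsub>alg \<H>2\<^esub> g) \<and>
    (\<forall>y. \<psi> ` graded_piece \<H>1 y \<subseteq> graded_piece \<H>1 y)"

definition conj_lift ::
    "('x1::ab_group_add, 'y1, 'h1) hecke \<Rightarrow> ('x2, 'y2, 'h2) hecke \<Rightarrow> ('h1 \<Rightarrow> 'h2) \<Rightarrow> 'h2 \<Rightarrow>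
     'h1 \<Rightarrow> 'h1" where
  "conj_lift \<H>1 \<H>2 \<phi> g = (THE \<psi>. is_conj_lift \<H>1 \<H>2 \<phi> g \<psi>)"

definition twist ::
    "('x1::ab_group_add, 'y1, 'h1) hecke \<Rightarrow> ('x2, 'y2, 'h2) hecke \<Rightarrow> ('h1 \<Rightarrow> 'h2) \<Rightarrow>
     ('h1, 'v) module \<Rightarrow> 'h2 \<Rightarrow> ('h1, 'v) module" where
  "twist \<H>1 \<H>2 \<phi> \<pi> g = Res (alg \<H>1) (conj_lift \<H>1 \<H>2 \<phi> g) \<pi>"

text \<open>Automatic if \<open>f\<close> is injective. On any module restricted from the target algebra, \<open>theta k\<close> with
  \<open>f k = 0\<close> acts as the identity, so this is necessary for \<open>\<pi>\<close> to embed in one.\<close>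

definition kernel_acts_trivially ::
    "('x1::ab_group_add, 'y1, 'h1) hecke \<Rightarrow> ('x1 \<Rightarrow> 'x2::ab_group_add) \<Rightarrow> ('h1, 'v) module \<Rightarrow> bool" where
  "kernel_acts_trivially \<H>1 f \<pi> \<longleftrightarrow>
    (\<forall>k. f k = 0 \<longrightarrow> (\<forall>v\<in>carrier \<pi>. theta \<H>1 k \<odot>\<^bsub>\<pi>\<^esub> v = v))"

end

(*
  Grade an affine Hecke algebra by X/ZR, a piece being spanned by the theta_x T_w with x in a
  fixed coset. The Bernstein relation shows that the pieces multiply like the cosets, so
  conjugation by theta_g, for g in X_2, preserves them. Since f is injective on each coset of ZR_1
  and identifies the Weyl groups, phi is injective on each piece; hence conjugation by theta_g lifts
  to a homogeneous automorphism of H_1, the identity on A_1. All this rests on the Weyl group being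
  generated by the simple reflections and on the parity of word lengths, which makes
  l(s w) = l(w) + 1 or l(w) = l(s w) + 1.

  H_2 is the direct sum of the theta_g phi(H_1) for g in S. So Ind pi is the sum of the subspaces
  theta_g (x) pi, each a quotient of the twist pi^g as an H_1-module, and isomorphic to it when the
  kernel of f acts trivially. A twist has the same submodules as pi, which settles irreducibility,
  and semisimplicity of the restriction, because a sum of simple submodules is semisimple.

  When X_2/X_1 is finite, an H_1-linear projection P onto an H_2-submodule becomes H_2-linear after
  averaging the theta_g P theta_(-g) over g in S, as in Maschke's theorem.
*)

theory Submission
  imports Defs
begin

section \<open>Semisimple modules\<close>

text \<open>When \<open>f\<close> has a kernel, \<phi> is not injective, and splitting the induced
  module needs maps out of a tensor product that invert \<phi> on the left. The substitute is the
  linear map \<open>sec UNIV\<close>, which picks preimages of basis elements arbitrarily. It fails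
  to be compatible with multiplication only by factors \<theta>_k with f k = 0, and these disappear
  once everything acts on a module on which they are the identity. This is where that condition on
  \<pi> enters.

  Semisimplicity of the restriction is not drawn from the splitting. It is recast as
  \<open>simply_generated\<close>, which passes to any module generated by homomorphic images of the
  twists, direct or not. Complements come back only for the averaging argument.

  The quotient in the Bernstein relation is a definite description. Locating it in a coset takes
  both its existence, by a telescoping sum, and its uniqueness, because 1 - \<theta>_(-\<beta>) is
  not a zero divisor in the lattice algebra when \<beta> has infinite order. For even coroots
  \<beta> is twice the simple root.\<close>

context abelian_group begin

lemma add_minus_cancel:
  assumes "x \<in> carrier G" "y \<in> carrier G"
  shows "x \<oplus> y \<ominus> y = x" "x \<oplus> y \<ominus> x = y" "x \<ominus> y \<oplus> y = x"
proof -
  have *: "x \<oplus> y \<ominus> y = x" if "x \<in> carrier G" "y \<in> carrier G" for x y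
    using that by (simp add: minus_eq a_assoc r_neg)
  show "x \<oplus> y \<ominus> y = x" using * assms by simp
  show "x \<oplus> y \<ominus> x = y" using *[OF assms(2,1)] a_comm[OF assms] by simp
  show "x \<ominus> y \<oplus> y = x" using assms by (simp add: minus_eq a_assoc l_neg)
qed

lemma eq_if_minus_eq_zero: "x \<in> carrier G \<Longrightarrow> y \<in> carrier G \<Longrightarrow> x \<ominus> y = \<zero> \<Longrightarrow> x = y"
  using add_minus_cancel(3)[of x y] by simp

text \<open>Two decompositions of a vector along two submodules differ by an element of both; this
  is the form in which uniqueness of decompositions is used.\<close>

lemma minus_eq_minus_if_add_eq_add:
  assumes "x \<in> carrier G" "y \<in> carrier G" "z \<in> carrier G" "w \<in> carrier G" "x \<oplus> y = z \<oplus> w"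
  shows "x \<ominus> z = w \<ominus> y"
proof -
  have "x = (w \<ominus> y) \<oplus> z"
    using add_minus_cancel(1)[OF assms(1,2)] assms by (simp add: minus_eq a_ac)
  then show ?thesis using add_minus_cancel(1)[of "w \<ominus> y" z] assms by simp
qed

end

section \<open>Submodules and their sums over a noncommutative ring\<close>

context left_module begin

lemma smult_r_null: "a \<in> carrier R \<Longrightarrow> a \<odot>\<^bsub>M\<^esub> \<zero>\<^bsub>M\<^esub> = \<zero>\<^bsub>M\<^esub>"
  using smult_r_distr[of a "\<zero>\<^bsub>M\<^esub>" "\<zero>\<^bsub>M\<^esub>"] smult_closed[of a "\<zero>\<^bsub>M\<^esub>"]
  by (metis M.add.r_cancel_one' M.l_zero M.zero_closed)

lemma smult_l_null: "v \<in> carrier M \<Longrightarrow> \<zero> \<odot>\<^bsub>M\<^esub> v = \<zero>\<^bsub>M\<^esub>"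
  using smult_l_distr[of \<zero> \<zero> v] smult_closed[of \<zero> v]
  by (metis M.add.r_cancel_one' R.l_zero R.zero_closed)

lemma smult_l_minus:
  assumes "a \<in> carrier R" "v \<in> carrier M"
  shows "(\<ominus> a) \<odot>\<^bsub>M\<^esub> v = \<ominus>\<^bsub>M\<^esub> (a \<odot>\<^bsub>M\<^esub> v)"
proof -
  have "(\<ominus> a) \<odot>\<^bsub>M\<^esub> v \<oplus>\<^bsub>M\<^esub> a \<odot>\<^bsub>M\<^esub> v = \<zero>\<^bsub>M\<^esub>"
    using smult_l_distr[of "\<ominus> a" a v] assms by (simp add: R.l_neg smult_l_null)
  then show ?thesis using assms by (simp add: M.minus_equality smult_closed)
qed

lemma finsum_smult:
  assumes "finite F" "a \<in> carrier R" "c \<in> F \<rightarrow> carrier M"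
  shows "a \<odot>\<^bsub>M\<^esub> finsum M c F = finsum M (\<lambda>i. a \<odot>\<^bsub>M\<^esub> c i) F"
  using assms by (induction F) (auto simp: smult_r_null smult_r_distr smult_closed Pi_def)

text \<open>Closure under negation follows by acting with \<open>\<ominus> \<one>\<close>.\<close>

lemma submoduleI:
  assumes "N \<subseteq> carrier M" "\<zero>\<^bsub>M\<^esub> \<in> N"
    and "\<And>v w. v \<in> N \<Longrightarrow> w \<in> N \<Longrightarrow> v \<oplus>\<^bsub>M\<^esub> w \<in> N"
    and "\<And>a v. a \<in> carrier R \<Longrightarrow> v \<in> N \<Longrightarrow> a \<odot>\<^bsub>M\<^esub> v \<in> N"
  shows "submodule N R M"
proof -
  have "\<ominus>\<^bsub>M\<^esub> v \<in> N" if "v \<in> N" for v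
  proof -
    have "\<ominus>\<^bsub>M\<^esub> v = (\<ominus> \<one>) \<odot>\<^bsub>M\<^esub> v"
      using that assms(1) smult_l_minus[of \<one> v] by (auto simp: smult_one)
    then show ?thesis using assms(4)[of "\<ominus> \<one>" v] that by simp
  qed
  then have "subgroup N (add_monoid M)"
    using assms by (auto intro!: subgroup.intro simp: a_inv_def)
  then show ?thesis
    using assms by (intro submodule.intro) (auto simp: submodule_axioms_def)
qed

lemma submoduleD:
  assumes "submodule N R M"
  shows "N \<subseteq> carrier M" "\<zero>\<^bsub>M\<^esub> \<in> N"
    and "\<And>v w. v \<in> N \<Longrightarrow> w \<in> N \<Longrightarrow> v \<oplus>\<^bsub>M\<^esub> w \<in> N"
    and "\<And>a v. a \<in> carrier R \<Longrightarrow> v \<in> N \<Longrightarrow> a \<odot>\<^bsub>M\<^esub> v \<in> N"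
    and "\<And>v. v \<in> N \<Longrightarrow> \<ominus>\<^bsub>M\<^esub> v \<in> N"
    and "\<And>v w. v \<in> N \<Longrightarrow> w \<in> N \<Longrightarrow> v \<ominus>\<^bsub>M\<^esub> w \<in> N"
proof -
  interpret subgroup N "add_monoid M" using assms by (rule submodule.axioms(1))
  show "N \<subseteq> carrier M" "\<zero>\<^bsub>M\<^esub> \<in> N" using subset one_closed by auto
  show add: "v \<oplus>\<^bsub>M\<^esub> w \<in> N" if "v \<in> N" "w \<in> N" for v w
    using m_closed[OF that] by simp
  show neg: "\<ominus>\<^bsub>M\<^esub> v \<in> N" if "v \<in> N" for v
    using m_inv_closed[OF that] by (simp add: a_inv_def)
  show "a \<odot>\<^bsub>M\<^esub> v \<in> N" if "a \<in> carrier R" "v \<in> N" for a v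
    using submodule.smult_closed[OF assms that] .
  show "v \<ominus>\<^bsub>M\<^esub> w \<in> N" if "v \<in> N" "w \<in> N" for v w
    using add neg that by (simp add: a_minus_def)
qed

lemma submodule_finsum:
  assumes "submodule N R M" "c \<in> F \<rightarrow> N"
  shows "finsum M c F \<in> N"
proof (cases "finite F")
  case True
  then show ?thesis using assms(2)
  proof (induction F)
    case empty
    then show ?case using submoduleD[OF assms(1)] by simp
  next
    case (insert x F)
    then have "c \<in> F \<rightarrow> carrier M" "c x \<in> carrier M"
      using submoduleD(1)[OF assms(1)] by auto
    then show ?case using insert submoduleD[OF assms(1)] by auto
  qed
\<comment> \<open>Over an infinite index set \<open>finsum\<close> is zero by convention, and zero
  lies in every submodule.\<close>
qed (use submoduleD[OF assms(1)] in \<open>simp add: M.finsum_infinite\<close>)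

lemma submodule_carrier: "submodule (carrier M) R M"
  by (rule submoduleI) (auto intro: smult_closed)

lemma submodule_zero: "submodule {\<zero>\<^bsub>M\<^esub>} R M"
  by (rule submoduleI) (auto simp: smult_r_null)

lemma submodule_Int:
  assumes "submodule N R M" "submodule P R M"
  shows "submodule (N \<inter> P) R M"
  using submoduleD[OF assms(1)] submoduleD[OF assms(2)] by (intro submoduleI) auto

text \<open>Provides the upper bound for Zorn's lemma: two vectors of the union already lie in one
  member of the chain.\<close>

lemma submodule_Union_chain:
  assumes "\<C> \<noteq> {}" "\<And>N. N \<in> \<C> \<Longrightarrow> submodule N R M"
    and chain: "\<And>N P. N \<in> \<C> \<Longrightarrow> P \<in> \<C> \<Longrightarrow> N \<subseteq> P \<or> P \<subseteq> N"
  shows "submodule (\<Union>\<C>) R M"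
proof (rule submoduleI)
  fix v w assume "v \<in> \<Union>\<C>" "w \<in> \<Union>\<C>"
  then obtain N P where "N \<in> \<C>" "v \<in> N" "P \<in> \<C>" "w \<in> P" by blast
  then obtain Q where "Q \<in> \<C>" "v \<in> Q" "w \<in> Q" using chain by blast
  then show "v \<oplus>\<^bsub>M\<^esub> w \<in> \<Union>\<C>" using submoduleD(3)[OF assms(2)] by blast
next
  show "\<Union>\<C> \<subseteq> carrier M" using submoduleD(1)[OF assms(2)] by blast
  show "\<zero>\<^bsub>M\<^esub> \<in> \<Union>\<C>" using submoduleD(2)[OF assms(2)] assms(1) by blast
  show "a \<odot>\<^bsub>M\<^esub> v \<in> \<Union>\<C>" if "a \<in> carrier R" "v \<in> \<Union>\<C>" for a v
    using submoduleD(4)[OF assms(2) that(1)] that(2) by blast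
qed

definition submodule_sum :: "'v set \<Rightarrow> 'v set \<Rightarrow> 'v set" where
  "submodule_sum N P = {v \<oplus>\<^bsub>M\<^esub> w | v w. v \<in> N \<and> w \<in> P}"

lemma submodule_submodule_sum:
  assumes N: "submodule N R M" and P: "submodule P R M"
  shows "submodule (submodule_sum N P) R M" "N \<subseteq> submodule_sum N P" "P \<subseteq> submodule_sum N P"
proof -
  note n = submoduleD[OF N] and p = submoduleD[OF P]
  show "submodule (submodule_sum N P) R M"
  proof (rule submoduleI)
    show "submodule_sum N P \<subseteq> carrier M" using n(1) p(1) by (auto simp: submodule_sum_def)
    show "\<zero>\<^bsub>M\<^esub> \<in> submodule_sum N P"
      unfolding submodule_sum_def using n(2) p(2) by (auto intro!: exI[of _ "\<zero>\<^bsub>M\<^esub>"])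
  next
    fix x y assume "x \<in> submodule_sum N P" "y \<in> submodule_sum N P"
    then obtain v w v' w' where *: "x = v \<oplus>\<^bsub>M\<^esub> w" "y = v' \<oplus>\<^bsub>M\<^esub> w'" "v \<in> N" "w \<in> P" "v' \<in> N" "w' \<in> P"
      unfolding submodule_sum_def by blast
    have "x \<oplus>\<^bsub>M\<^esub> y = (v \<oplus>\<^bsub>M\<^esub> v') \<oplus>\<^bsub>M\<^esub> (w \<oplus>\<^bsub>M\<^esub> w')"
      using * n(1) p(1) by (auto simp: M.add.m_ac subset_iff)
    then show "x \<oplus>\<^bsub>M\<^esub> y \<in> submodule_sum N P" unfolding submodule_sum_def using * n(3) p(3) by blast
  next
    fix a x assume a: "a \<in> carrier R" and "x \<in> submodule_sum N P"
    then obtain v w where *: "x = v \<oplus>\<^bsub>M\<^esub> w" "v \<in> N" "w \<in> P" unfolding submodule_sum_def by blast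
    then have "a \<odot>\<^bsub>M\<^esub> x = a \<odot>\<^bsub>M\<^esub> v \<oplus>\<^bsub>M\<^esub> a \<odot>\<^bsub>M\<^esub> w" using a n(1) p(1) by (simp add: smult_r_distr subset_iff)
    then show "a \<odot>\<^bsub>M\<^esub> x \<in> submodule_sum N P"
      unfolding submodule_sum_def using * n(4)[OF a] p(4)[OF a] by blast
  qed
  show "N \<subseteq> submodule_sum N P"
  proof
    fix v assume "v \<in> N"
    then show "v \<in> submodule_sum N P"
      unfolding submodule_sum_def using n(1) p(2)
      by (intro CollectI exI[of _ v] exI[of _ "\<zero>\<^bsub>M\<^esub>"]) auto
  qed
  show "P \<subseteq> submodule_sum N P"
  proof
    fix v assume "v \<in> P"
    then show "v \<in> submodule_sum N P"
      unfolding submodule_sum_def using p(1) n(2)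
      by (intro CollectI exI[of _ "\<zero>\<^bsub>M\<^esub>"] exI[of _ v]) auto
  qed
qed

lemma submodule_sum_zero:
  assumes "submodule N R M"
  shows "submodule_sum N {\<zero>\<^bsub>M\<^esub>} = N" "submodule_sum {\<zero>\<^bsub>M\<^esub>} N = N"
proof -
  have "v \<in> carrier M" if "v \<in> N" for v using submoduleD(1)[OF assms] that by blast
  then show "submodule_sum N {\<zero>\<^bsub>M\<^esub>} = N" "submodule_sum {\<zero>\<^bsub>M\<^esub>} N = N"
    unfolding submodule_sum_def by force+
qed

text \<open>The submodules serve as their own indices, as in the definition of
  semisimplicity.\<close>

definition family_sum :: "'v set set \<Rightarrow> 'v set" where
  "family_sum \<P> = {finsum M c F | c F. finite F \<and> F \<subseteq> \<P> \<and> (\<forall>P\<in>F. c P \<in> P)}"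

lemma finsum_extend:
  assumes "finite G" "F \<subseteq> G" "c \<in> F \<rightarrow> carrier M"
  shows "finsum M c F = finsum M (\<lambda>i. if i \<in> F then c i else \<zero>\<^bsub>M\<^esub>) G"
  using assms by (intro M.add.finprod_mono_neutral_cong_left) auto

lemma submodule_family_sum:
  assumes S: "\<And>P. P \<in> \<P> \<Longrightarrow> submodule P R M"
  shows "submodule (family_sum \<P>) R M"
proof (rule submoduleI)
  have car: "c \<in> F \<rightarrow> carrier M" if "F \<subseteq> \<P>" "(\<forall>P\<in>F. c P \<in> P)" for c F
    using submoduleD(1)[OF S] that by blast
  show "family_sum \<P> \<subseteq> carrier M"
    unfolding family_sum_def by (auto intro!: M.finsum_closed dest: car)
  show "\<zero>\<^bsub>M\<^esub> \<in> family_sum \<P>"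
    unfolding family_sum_def by (auto intro!: exI[of _ "{}"])
  fix x y assume "x \<in> family_sum \<P>" "y \<in> family_sum \<P>"
  then obtain c F d G where *: "x = finsum M c F" "finite F" "F \<subseteq> \<P>" "(\<forall>P\<in>F. c P \<in> P)"
    "y = finsum M d G" "finite G" "G \<subseteq> \<P>" "(\<forall>P\<in>G. d P \<in> P)"
    unfolding family_sum_def by blast
  \<comment> \<open>Both sums are extended by zero to the union of their index sets, where they can
    be added termwise.\<close>
  let ?c = "\<lambda>i. if i \<in> F then c i else \<zero>\<^bsub>M\<^esub>" and ?d = "\<lambda>i. if i \<in> G then d i else \<zero>\<^bsub>M\<^esub>"
  have mem: "(\<forall>P\<in>F\<union>G. ?c P \<in> P)" "(\<forall>P\<in>F\<union>G. ?d P \<in> P)"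
    using *(3,4,7,8) submoduleD(2)[OF S] by (auto simp: subset_iff)
  have "x \<oplus>\<^bsub>M\<^esub> y = finsum M ?c (F \<union> G) \<oplus>\<^bsub>M\<^esub> finsum M ?d (F \<union> G)"
    unfolding *(1,5) using * car[OF *(3,4)] car[OF *(7,8)]
    by (intro arg_cong2[where f="(\<oplus>\<^bsub>M\<^esub>)"] finsum_extend) auto
  also have "\<dots> = finsum M (\<lambda>i. ?c i \<oplus>\<^bsub>M\<^esub> ?d i) (F \<union> G)"
    using car[OF _ mem(1)] car[OF _ mem(2)] * by (intro M.finsum_addf[symmetric]) auto
  finally have "x \<oplus>\<^bsub>M\<^esub> y = finsum M (\<lambda>i. ?c i \<oplus>\<^bsub>M\<^esub> ?d i) (F \<union> G)" .
  moreover have "(\<forall>P\<in>F\<union>G. (\<lambda>i. ?c i \<oplus>\<^bsub>M\<^esub> ?d i) P \<in> P)"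
  proof
    fix P assume P: "P \<in> F \<union> G"
    then have "P \<in> \<P>" using * by blast
    then have "?c P \<oplus>\<^bsub>M\<^esub> ?d P \<in> P"
      using bspec[OF mem(1) P] bspec[OF mem(2) P] by (rule submoduleD(3)[OF S])
    then show "(\<lambda>i. ?c i \<oplus>\<^bsub>M\<^esub> ?d i) P \<in> P" .
  qed
  ultimately show "x \<oplus>\<^bsub>M\<^esub> y \<in> family_sum \<P>"
    unfolding family_sum_def using * by (intro CollectI exI[of _ "F \<union> G"] exI conjI) auto
next
  fix a x assume a: "a \<in> carrier R" and "x \<in> family_sum \<P>"
  then obtain c F where *: "x = finsum M c F" "finite F" "F \<subseteq> \<P>" "(\<forall>P\<in>F. c P \<in> P)"
    unfolding family_sum_def by blast
  have "c \<in> F \<rightarrow> carrier M" using submoduleD(1)[OF S] *(3,4) by blast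
  then have "a \<odot>\<^bsub>M\<^esub> x = finsum M (\<lambda>i. a \<odot>\<^bsub>M\<^esub> c i) F" using finsum_smult a * by simp
  moreover have "(\<forall>P\<in>F. (\<lambda>i. a \<odot>\<^bsub>M\<^esub> c i) P \<in> P)" using *(3,4) submoduleD(4)[OF S a] by blast
  ultimately show "a \<odot>\<^bsub>M\<^esub> x \<in> family_sum \<P>" unfolding family_sum_def using * by blast
qed

lemma family_sum_upper:
  assumes "P \<in> \<P>" "submodule P R M"
  shows "P \<subseteq> family_sum \<P>"
proof
  fix v assume "v \<in> P"
  then show "v \<in> family_sum \<P>"
    unfolding family_sum_def using assms submoduleD(1)[OF assms(2)]
    by (intro CollectI exI[of _ "\<lambda>_. v"] exI[of _ "{P}"]) (auto simp: subset_iff)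
qed

end

section \<open>Generation by simple submodules and existence of complements\<close>

definition simple_submodule ::
    "'v set \<Rightarrow> ('r, 'm) ring_scheme \<Rightarrow> ('r, 'v, 'n) module_scheme \<Rightarrow> bool" where
  "simple_submodule P R M \<longleftrightarrow> submodule P R M \<and> P \<noteq> {\<zero>\<^bsub>M\<^esub>} \<and>
     (\<forall>Q. submodule Q R M \<and> Q \<subseteq> P \<longrightarrow> Q = {\<zero>\<^bsub>M\<^esub>} \<or> Q = P)"

text \<open>The module is the sum of its simple submodules, phrased so that no sum has to be formed.
  This form of semisimplicity is easy to transport along homomorphisms.\<close>

definition simply_generated :: "('r, 'm) ring_scheme \<Rightarrow> ('r, 'v, 'n) module_scheme \<Rightarrow> bool" where
  "simply_generated R M \<longleftrightarrow>
     (\<forall>N. submodule N R M \<and> (\<forall>P. simple_submodule P R M \<longrightarrow> P \<subseteq> N) \<longrightarrow> N = carrier M)"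

context left_module begin

lemma left_module_submodule:
  assumes "submodule N R M"
  shows "left_module R (M\<lparr>carrier := N\<rparr>)"
proof -
  note n = submoduleD[OF assms]
  have grp: "subgroup N (add_monoid M)" using assms by (rule submodule.axioms(1))
  have "comm_monoid (add_monoid (M\<lparr>carrier := N\<rparr>))"
    using comm_monoid.submonoid_is_comm_monoid[OF M.a_comm_monoid subgroup.subgroup_is_submonoid[OF grp]]
    by simp
  moreover have "Group.group (add_monoid (M\<lparr>carrier := N\<rparr>))"
    using subgroup.subgroup_is_group[OF grp M.add.is_group] by simp
  ultimately have "abelian_group (M\<lparr>carrier := N\<rparr>)"
    by (simp add: abelian_group_def abelian_monoid_def abelian_group_axioms_def comm_group_def)
  then show ?thesis
    using n(1,4) smult_l_distr smult_r_distr smult_assoc smult_one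
    by (intro left_module.intro R.ring_axioms left_module_axioms.intro) (auto simp: subset_iff)
qed

lemma submodule_restrict_iff:
  assumes "submodule P R M"
  shows "submodule Q R (M\<lparr>carrier := P\<rparr>) \<longleftrightarrow> submodule Q R M \<and> Q \<subseteq> P"
proof -
  interpret P: left_module R "M\<lparr>carrier := P\<rparr>" using assms by (rule left_module_submodule)
  show ?thesis
  proof
    assume "submodule Q R (M\<lparr>carrier := P\<rparr>)"
    note q = P.submoduleD[OF this, simplified]
    show "submodule Q R M \<and> Q \<subseteq> P"
      using q submoduleD(1)[OF assms] by (auto intro!: submoduleI)
  next
    assume "submodule Q R M \<and> Q \<subseteq> P"
    then show "submodule Q R (M\<lparr>carrier := P\<rparr>)"
      using submoduleD[of Q] by (intro P.submoduleI) auto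
  qed
qed

text \<open>Zorn's lemma for sets of simple submodules that are independent modulo N. If a simple P
  is not contained in N plus the sum of a maximal such set, then by simplicity it meets that
  submodule in zero, and adding P keeps independence. So all simple submodules lie in the sum. The
  case N = 0 decomposes M, a general N yields a complement.\<close>

lemma exists_independent_family:
  assumes gen: "simply_generated R M" and N: "submodule N R M"
  obtains \<P> where "\<And>P. P \<in> \<P> \<Longrightarrow> simple_submodule P R M"
    and "submodule_sum N (family_sum \<P>) = carrier M"
    and "\<And>F c P. finite F \<Longrightarrow> F \<subseteq> \<P> \<Longrightarrow> \<forall>P\<in>F. c P \<in> P \<Longrightarrow> finsum M c F \<in> N \<Longrightarrow>
           P \<in> F \<Longrightarrow> c P = \<zero>\<^bsub>M\<^esub>"
proof -
  define ind where "ind \<P> \<longleftrightarrow> (\<forall>P\<in>\<P>. simple_submodule P R M) \<and>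
    (\<forall>F c. finite F \<longrightarrow> F \<subseteq> \<P> \<longrightarrow> (\<forall>P\<in>F. c P \<in> P) \<longrightarrow> finsum M c F \<in> N \<longrightarrow> (\<forall>P\<in>F. c P = \<zero>\<^bsub>M\<^esub>))"
    for \<P>
  have indD: "c P = \<zero>\<^bsub>M\<^esub>" if "ind \<P>" "F \<subseteq> \<P>" "finite F" "(\<forall>P\<in>F. c P \<in> P)"
    "finsum M c F \<in> N" "P \<in> F" for \<P> F c P
    using that unfolding ind_def by simp
  have "\<exists>\<P>\<in>Collect ind. \<forall>\<Q>\<in>Collect ind. \<P> \<subseteq> \<Q> \<longrightarrow> \<Q> = \<P>"
  proof (rule subset_Zorn')
    fix \<C> assume C: "subset.chain (Collect ind) \<C>"
    then have C': "\<And>\<P>. \<P> \<in> \<C> \<Longrightarrow> ind \<P>" by (auto simp: subset_chain_def)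
    show "\<Union>\<C> \<in> Collect ind"
    proof (cases "\<C> = {}")
      case True
      then show ?thesis by (simp add: ind_def)
    next
      case False
      \<comment> \<open>Independence only concerns finite subsets, and a finite subset of the union
        lies in one member of the chain.\<close>
      have "\<exists>\<P>\<in>\<C>. F \<subseteq> \<P>" if "finite F" "F \<subseteq> \<Union>\<C>" for F
        by (rule finite_subset_Union_chain[OF that False C]) blast
      then have *: "\<exists>\<P>. ind \<P> \<and> F \<subseteq> \<P>" if "finite F" "F \<subseteq> \<Union>\<C>" for F
        using that C' by meson
      have "ind (\<Union>\<C>)"
        unfolding ind_def
      proof (intro conjI ballI allI impI)
        fix P assume "P \<in> \<Union>\<C>"
        then show "simple_submodule P R M" using C' by (auto simp: ind_def)
      next
        fix F c P
        assume F: "finite F" "F \<subseteq> \<Union>\<C>" "(\<forall>P\<in>F. c P \<in> P)" "finsum M c F \<in> N" "P \<in> F"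
        obtain \<P> where "ind \<P>" "F \<subseteq> \<P>" using *[OF F(1,2)] by blast
        then show "c P = \<zero>\<^bsub>M\<^esub>" using indD F by simp
      qed
      then show ?thesis by simp
    qed
  qed
  then obtain \<P> where S: "ind \<P>" and max: "\<And>\<Q>. ind \<Q> \<Longrightarrow> \<P> \<subseteq> \<Q> \<Longrightarrow> \<Q> = \<P>" by blast
  have sub: "\<And>P. P \<in> \<P> \<Longrightarrow> submodule P R M" using S by (auto simp: ind_def simple_submodule_def)
  note fs = submodule_family_sum[of \<P>, OF sub]
  note T = submodule_submodule_sum[OF N fs, simplified]
  note Td = submoduleD[OF T(1)]
  have le: "P \<subseteq> submodule_sum N (family_sum \<P>)" if P: "simple_submodule P R M" for P
  proof (rule ccontr)
    assume not: "\<not> P \<subseteq> submodule_sum N (family_sum \<P>)"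
    have Ps: "submodule P R M" using P by (simp add: simple_submodule_def)
    have "submodule (P \<inter> submodule_sum N (family_sum \<P>)) R M" using Ps T(1) by (rule submodule_Int)
    then have zero: "P \<inter> submodule_sum N (family_sum \<P>) = {\<zero>\<^bsub>M\<^esub>}"
      using P not unfolding simple_submodule_def by blast
    have "P \<notin> \<P>" using not family_sum_upper[OF _ Ps] T(3) by blast
    moreover have "ind (insert P \<P>)"
      unfolding ind_def
    proof (intro conjI ballI allI impI)
      fix Q assume "Q \<in> insert P \<P>"
      then show "simple_submodule Q R M" using P S by (auto simp: ind_def)
    next
      fix F c Q
      assume F: "finite F" "F \<subseteq> insert P \<P>" "(\<forall>P\<in>F. c P \<in> P)" "finsum M c F \<in> N" and Q: "Q \<in> F"
      have car: "c \<in> F \<rightarrow> carrier M"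
        using F(2,3) submoduleD(1)[OF sub] submoduleD(1)[OF Ps] by blast
      show "c Q = \<zero>\<^bsub>M\<^esub>"
      proof (cases "P \<in> F")
        case False
        then have "F \<subseteq> \<P>" using F(2) by blast
        then show ?thesis by (rule indD[OF S _ F(1,3,4) Q])
      next
        case True
        define G where "G = F - {P}"
        have G: "finite G" "G \<subseteq> \<P>" "P \<notin> G" "F = insert P G" "(\<forall>P\<in>G. c P \<in> P)" "c \<in> G \<rightarrow> carrier M"
          using F True car by (auto simp: G_def)
        have cP: "c P \<in> P" "c P \<in> carrier M" using F(3) True car by auto
        have sum: "finsum M c F = c P \<oplus>\<^bsub>M\<^esub> finsum M c G" using G cP by simp
        have sG: "finsum M c G \<in> submodule_sum N (family_sum \<P>)"
          using G T(3) unfolding family_sum_def by blast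
        \<comment> \<open>The P-term is an element of N minus a combination from the old family, so
          it lies in the zero intersection of P with N plus the sum.\<close>
        have "c P = finsum M c F \<ominus>\<^bsub>M\<^esub> finsum M c G"
          unfolding sum using cP M.finsum_closed[OF G(6)] by (simp add: M.add_minus_cancel)
        then have "c P \<in> submodule_sum N (family_sum \<P>)" using Td(6) sG F(4) T(2) by auto
        then have c0: "c P = \<zero>\<^bsub>M\<^esub>" using cP zero by blast
        then have "finsum M c G \<in> N" using F(4) unfolding sum using M.finsum_closed[OF G(6)] by simp
        then have "\<forall>Q\<in>G. c Q = \<zero>\<^bsub>M\<^esub>" using indD[OF S G(2,1,5)] by simp
        then show ?thesis using Q G(4) c0 by blast
      qed
    qed
    ultimately show False using max[of "insert P \<P>"] by blast
  qed
  then have "submodule_sum N (family_sum \<P>) = carrier M"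
    using gen T(1) unfolding simply_generated_def by blast
  moreover have "\<And>P. P \<in> \<P> \<Longrightarrow> simple_submodule P R M" using S by (simp add: ind_def)
  ultimately show ?thesis using indD[OF S] by (intro that[of \<P>])
qed

text \<open>A nonzero element of N in the sum of the family would be a nontrivial combination lying
  in N, which independence modulo N excludes.\<close>

lemma exists_complement:
  assumes "simply_generated R M" and N: "submodule N R M"
  obtains C where "submodule C R M" "N \<inter> C = {\<zero>\<^bsub>M\<^esub>}" "submodule_sum N C = carrier M"
proof -
  obtain \<P> where S: "\<And>P. P \<in> \<P> \<Longrightarrow> simple_submodule P R M"
    "submodule_sum N (family_sum \<P>) = carrier M"
    "\<And>F c P. finite F \<Longrightarrow> F \<subseteq> \<P> \<Longrightarrow> \<forall>P\<in>F. c P \<in> P \<Longrightarrow> finsum M c F \<in> N \<Longrightarrow>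
           P \<in> F \<Longrightarrow> c P = \<zero>\<^bsub>M\<^esub>"
    using exists_independent_family[OF assms] by metis
  have fs: "submodule (family_sum \<P>) R M"
    using S(1) by (intro submodule_family_sum) (auto simp: simple_submodule_def)
  have "N \<inter> family_sum \<P> \<subseteq> {\<zero>\<^bsub>M\<^esub>}"
  proof
    fix v assume "v \<in> N \<inter> family_sum \<P>"
    then obtain c F where *: "v = finsum M c F" "finite F" "F \<subseteq> \<P>" "(\<forall>P\<in>F. c P \<in> P)" "v \<in> N"
      unfolding family_sum_def by blast
    then have "\<And>P. P \<in> F \<Longrightarrow> c P = \<zero>\<^bsub>M\<^esub>" using S(3)[of F c] by simp
    then show "v \<in> {\<zero>\<^bsub>M\<^esub>}" unfolding *(1) by (simp add: M.add.finprod_one_eqI)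
  qed
  then have "N \<inter> family_sum \<P> = {\<zero>\<^bsub>M\<^esub>}"
    using submoduleD(2)[OF fs] submoduleD(2)[OF N] by blast
  then show ?thesis by (rule that[OF fs _ S(2)])
qed

text \<open>Suppose N contains all simple submodules but misses v. Choose L above N, maximal among
  the submodules avoiding v, and a complement C of L. Two nonzero submodules of C with zero
  intersection would both bring v into their sum with L, and comparing the two expressions would put
  v into L. Hence C is simple, so it lies in N and in L, which is absurd.\<close>

lemma simply_generated_if_complements:
  assumes compl: "\<And>N. submodule N R M \<Longrightarrow>
    \<exists>C. submodule C R M \<and> N \<inter> C = {\<zero>\<^bsub>M\<^esub>} \<and> submodule_sum N C = carrier M"
  shows "simply_generated R M"
  unfolding simply_generated_def
proof (intro allI impI, rule ccontr)
  fix N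
  assume "submodule N R M \<and> (\<forall>P. simple_submodule P R M \<longrightarrow> P \<subseteq> N)" and ne: "N \<noteq> carrier M"
  then have N: "submodule N R M" and simp: "\<And>P. simple_submodule P R M \<Longrightarrow> P \<subseteq> N" by auto
  obtain v where v: "v \<in> carrier M" "v \<notin> N" using ne submoduleD(1)[OF N] by blast
  define A where "A = {L. submodule L R M \<and> N \<subseteq> L \<and> v \<notin> L}"
  have "\<exists>L\<in>A. \<forall>L'\<in>A. L \<subseteq> L' \<longrightarrow> L' = L"
  proof (rule subset_Zorn_nonempty)
    show "A \<noteq> {}" using N v unfolding A_def by blast
    fix \<C> assume C: "\<C> \<noteq> {}" "subset.chain A \<C>"
    have "submodule (\<Union>\<C>) R M"
      using C by (intro submodule_Union_chain) (auto simp: subset_chain_def A_def)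
    then show "\<Union>\<C> \<in> A" using C by (auto simp: A_def subset_chain_def)
  qed
  from this obtain L where L: "submodule L R M" "N \<subseteq> L" "v \<notin> L"
    and max: "\<And>L'. submodule L' R M \<Longrightarrow> L \<subseteq> L' \<Longrightarrow> v \<notin> L' \<Longrightarrow> L' = L"
  proof -
    assume "\<exists>L\<in>A. \<forall>L'\<in>A. L \<subseteq> L' \<longrightarrow> L' = L"
    then obtain L where L: "L \<in> A" "\<forall>L'\<in>A. L \<subseteq> L' \<longrightarrow> L' = L" by blast
    then show ?thesis using that[of L] unfolding A_def by blast
  qed
  obtain C where C: "submodule C R M" "L \<inter> C = {\<zero>\<^bsub>M\<^esub>}" "submodule_sum L C = carrier M"
    using compl[OF L(1)] by blast
  note l = submoduleD[OF L(1)] and c = submoduleD[OF C(1)]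
  \<comment> \<open>By maximality of L, enlarging it by any nonzero submodule of C brings in
    v.\<close>
  have key: "\<exists>l\<in>L. \<exists>d\<in>D. v = l \<oplus>\<^bsub>M\<^esub> d"
    if D: "submodule D R M" "D \<subseteq> C" "D \<noteq> {\<zero>\<^bsub>M\<^esub>}" for D
  proof -
    note s = submodule_submodule_sum[OF L(1) D(1)]
    have "submodule_sum L D \<noteq> L" using s(3) D C(2) submoduleD(2)[OF D(1)] by blast
    then have "v \<in> submodule_sum L D" using max[OF s(1) s(2)] by blast
    then show ?thesis unfolding submodule_sum_def by blast
  qed
  have "simple_submodule C R M"
    unfolding simple_submodule_def
  proof (intro conjI allI impI)
    show "submodule C R M" by (fact C)
    show "C \<noteq> {\<zero>\<^bsub>M\<^esub>}"
    proof
      assume "C = {\<zero>\<^bsub>M\<^esub>}"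
      then show False using v L(3) C(3) submodule_sum_zero(1)[OF L(1)] by simp
    qed
    fix D assume "submodule D R M \<and> D \<subseteq> C"
    then have D: "submodule D R M" "D \<subseteq> C" by auto
    show "D = {\<zero>\<^bsub>M\<^esub>} \<or> D = C"
    proof (rule disjCI, rule ccontr)
      assume DC: "D \<noteq> C" and D0: "D \<noteq> {\<zero>\<^bsub>M\<^esub>}"
      obtain E where E: "submodule E R M" "D \<inter> E = {\<zero>\<^bsub>M\<^esub>}" "submodule_sum D E = carrier M"
        using compl[OF D(1)] by blast
      note d = submoduleD[OF D(1)] and e = submoduleD[OF E(1)]
      \<comment> \<open>The modular law by hand: the E-component of an element of C outside D is a
        nonzero element of C \<inter> E.\<close>
      obtain x where x: "x \<in> C" "x \<notin> D" using DC D(2) by blast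
      then obtain y z where yz: "x = y \<oplus>\<^bsub>M\<^esub> z" "y \<in> D" "z \<in> E"
        using E(3) c(1) unfolding submodule_sum_def by blast
      then have "z = x \<ominus>\<^bsub>M\<^esub> y"
        using M.add_minus_cancel(2)[of y z] subsetD[OF d(1)] subsetD[OF e(1)] by simp
      then have "z \<in> C" using x yz D(2) c(6) by blast
      moreover have "z \<noteq> \<zero>\<^bsub>M\<^esub>" using x yz d(1) by auto
      ultimately have ne: "C \<inter> E \<noteq> {\<zero>\<^bsub>M\<^esub>}" using yz by blast
      obtain l1 d1 where 1: "l1 \<in> L" "d1 \<in> D" "v = l1 \<oplus>\<^bsub>M\<^esub> d1" using key[OF D D0] by blast
      obtain l2 d2 where 2: "l2 \<in> L" "d2 \<in> C \<inter> E" "v = l2 \<oplus>\<^bsub>M\<^esub> d2"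
        using key[OF submodule_Int[OF C(1) E(1)] _ ne] by blast
      have car: "l1 \<in> carrier M" "l2 \<in> carrier M" "d1 \<in> carrier M" "d2 \<in> carrier M"
        using 1 2 l(1) d(1) e(1) by auto
      have "l1 \<ominus>\<^bsub>M\<^esub> l2 = d2 \<ominus>\<^bsub>M\<^esub> d1"
        using car 1(3) 2(3) by (intro M.minus_eq_minus_if_add_eq_add) auto
      moreover have "l1 \<ominus>\<^bsub>M\<^esub> l2 \<in> L" "d2 \<ominus>\<^bsub>M\<^esub> d1 \<in> C" using 1 2 l(6) c(6) D(2) by auto
      ultimately have "d2 \<ominus>\<^bsub>M\<^esub> d1 = \<zero>\<^bsub>M\<^esub>" using C(2) by auto
      then have "d1 = d2" using M.eq_if_minus_eq_zero car by metis
      then have "d1 = \<zero>\<^bsub>M\<^esub>" using 1 2 E(2) by blast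
      then show False using 1 L(3) car by auto
    qed
  qed
  then have "C \<subseteq> L" using simp L(2) by blast
  with C(2) \<open>simple_submodule C R M\<close> show False unfolding simple_submodule_def by blast
qed

end

section \<open>Comparison with semisimplicity as an internal direct sum\<close>

lemma irreducible_module_iff:
  "irreducible_module R M \<longleftrightarrow> left_module R M \<and> simple_submodule (carrier M) R M"
  using left_module.submodule_carrier left_module.submoduleD(1)
  unfolding irreducible_module_def simple_submodule_def by metis

lemma irreducible_restrict_iff:
  assumes "left_module R M" "submodule P R M"
  shows "irreducible_module R (M\<lparr>carrier := P\<rparr>) \<longleftrightarrow> simple_submodule P R M"
proof -
  interpret left_module R M by fact
  show ?thesis
    using left_module_submodule[OF assms(2)] submodule_restrict_iff[OF assms(2)] assms(2)
    unfolding irreducible_module_def simple_submodule_def by auto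
qed

text \<open>From a direct decomposition, every vector is a finite sum of members of simple
  submodules. Conversely, the family independent modulo 0 is the required set of summands.\<close>

theorem semisimple_module_iff:
  "semisimple_module R M \<longleftrightarrow> left_module R M \<and> simply_generated R M"
proof (cases "left_module R M")
  case True
  then interpret left_module R M .
  show ?thesis
  proof
    assume "semisimple_module R M"
    then obtain \<P> where S: "\<forall>N\<in>\<P>. submodule N R M \<and> irreducible_module R (M\<lparr>carrier := N\<rparr>)"
      and dec: "\<forall>v\<in>carrier M. \<exists>!c. c \<in> (\<Pi>\<^sub>E N\<in>\<P>. N) \<and> finite {N \<in> \<P>. c N \<noteq> \<zero>\<^bsub>M\<^esub>} \<and>
         v = finsum M c {N \<in> \<P>. c N \<noteq> \<zero>\<^bsub>M\<^esub>}"
      unfolding semisimple_module_def by (elim conjE exE)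
    have "simply_generated R M"
      unfolding simply_generated_def
    proof (intro allI impI)
      fix N assume N: "submodule N R M \<and> (\<forall>P. simple_submodule P R M \<longrightarrow> P \<subseteq> N)"
      then have sub: "P \<subseteq> N" if "P \<in> \<P>" for P
        using bspec[OF S that] irreducible_restrict_iff[OF True] by blast
      have "carrier M \<subseteq> N"
      proof
        fix v assume v: "v \<in> carrier M"
        obtain c where c: "c \<in> (\<Pi>\<^sub>E N\<in>\<P>. N)" "v = finsum M c {N \<in> \<P>. c N \<noteq> \<zero>\<^bsub>M\<^esub>}"
          using ex1_implies_ex[OF bspec[OF dec v]] by (elim exE conjE) auto
        show "v \<in> N"
          unfolding c(2) using N PiE_mem[OF c(1)] sub by (intro submodule_finsum) blast+
      qed
      then show "N = carrier M" using N submoduleD(1) by blast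
    qed
    with True show "left_module R M \<and> simply_generated R M" by simp
  next
    assume "left_module R M \<and> simply_generated R M"
    then have gen: "simply_generated R M" by simp
    obtain \<P> where S: "\<And>P. P \<in> \<P> \<Longrightarrow> simple_submodule P R M"
      and total: "submodule_sum {\<zero>\<^bsub>M\<^esub>} (family_sum \<P>) = carrier M"
      and ind: "\<And>F c P. finite F \<Longrightarrow> F \<subseteq> \<P> \<Longrightarrow> (\<forall>P\<in>F. c P \<in> P) \<Longrightarrow> finsum M c F \<in> {\<zero>\<^bsub>M\<^esub>} \<Longrightarrow>
           P \<in> F \<Longrightarrow> c P = \<zero>\<^bsub>M\<^esub>"
      by (rule exists_independent_family[OF gen submodule_zero]) (rule that)
    have sub: "\<And>P. P \<in> \<P> \<Longrightarrow> submodule P R M" using S by (simp add: simple_submodule_def)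
    note fs = submodule_family_sum[of \<P>, OF sub]
    have fsM: "family_sum \<P> = carrier M"
      using total submodule_sum_zero(2)[OF fs] by simp
    have "\<exists>!c. c \<in> (\<Pi>\<^sub>E N\<in>\<P>. N) \<and> finite {N \<in> \<P>. c N \<noteq> \<zero>\<^bsub>M\<^esub>} \<and>
         v = finsum M c {N \<in> \<P>. c N \<noteq> \<zero>\<^bsub>M\<^esub>}" if v: "v \<in> carrier M" for v
    proof -
      have car: "c \<in> F \<rightarrow> carrier M" if "F \<subseteq> \<P>" "c \<in> (\<Pi>\<^sub>E N\<in>\<P>. N)" for c F
        using subsetD[OF submoduleD(1)[OF sub] PiE_mem[OF that(2)]] that(1) by blast
      obtain c F where F: "v = finsum M c F" "finite F" "F \<subseteq> \<P>" "(\<forall>P\<in>F. c P \<in> P)"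
        using v unfolding fsM[symmetric] family_sum_def by (elim CollectE exE conjE) auto
      \<comment> \<open>Coefficients are extended by zero over the whole family and by
        \<open>undefined\<close> outside it, because uniqueness is claimed among extensional
        functions.\<close>
      define c' where "c' = (\<lambda>P\<in>\<P>. if P \<in> F then c P else \<zero>\<^bsub>M\<^esub>)"
      have c': "c' \<in> (\<Pi>\<^sub>E N\<in>\<P>. N)" using F(4) submoduleD(2)[OF sub] unfolding c'_def by (intro PiE_I) auto
      have supp: "{N \<in> \<P>. c' N \<noteq> \<zero>\<^bsub>M\<^esub>} \<subseteq> F" by (auto simp: c'_def split: if_splits)
      have "finsum M c' {N \<in> \<P>. c' N \<noteq> \<zero>\<^bsub>M\<^esub>} = finsum M c F"
      proof (rule M.add.finprod_mono_neutral_cong_left)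
        show "c \<in> F \<rightarrow> carrier M" using F(3,4) submoduleD(1)[OF sub] by blast
        fix P
        show "c P = \<zero>\<^bsub>M\<^esub>" if "P \<in> F - {N \<in> \<P>. c' N \<noteq> \<zero>\<^bsub>M\<^esub>}"
          using that F(3) by (auto simp: c'_def)
        show "c' P = c P" if "P \<in> {N \<in> \<P>. c' N \<noteq> \<zero>\<^bsub>M\<^esub>}" using that supp by (auto simp: c'_def)
      qed (use F(2) supp in auto)
      then have ex: "c' \<in> (\<Pi>\<^sub>E N\<in>\<P>. N) \<and> finite {N \<in> \<P>. c' N \<noteq> \<zero>\<^bsub>M\<^esub>} \<and>
         v = finsum M c' {N \<in> \<P>. c' N \<noteq> \<zero>\<^bsub>M\<^esub>}"
        using c' F supp finite_subset by simp
      have "c1 = c2"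
        if 1: "c1 \<in> (\<Pi>\<^sub>E N\<in>\<P>. N)" "finite {N \<in> \<P>. c1 N \<noteq> \<zero>\<^bsub>M\<^esub>}"
          "v = finsum M c1 {N \<in> \<P>. c1 N \<noteq> \<zero>\<^bsub>M\<^esub>}"
        and 2: "c2 \<in> (\<Pi>\<^sub>E N\<in>\<P>. N)" "finite {N \<in> \<P>. c2 N \<noteq> \<zero>\<^bsub>M\<^esub>}"
          "v = finsum M c2 {N \<in> \<P>. c2 N \<noteq> \<zero>\<^bsub>M\<^esub>}" for c1 c2
      proof
        fix P
        \<comment> \<open>The two supports are merged so that the expansions can be subtracted
          termwise; independence then makes every difference vanish.\<close>
        define G where "G = {N \<in> \<P>. c1 N \<noteq> \<zero>\<^bsub>M\<^esub>} \<union> {N \<in> \<P>. c2 N \<noteq> \<zero>\<^bsub>M\<^esub>}"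
        have G: "finite G" "G \<subseteq> \<P>" using 1 2 by (auto simp: G_def)
        have v1: "v = finsum M c1 G" unfolding 1(3) using G car[OF G(2) 1(1)]
          by (intro M.add.finprod_mono_neutral_cong_left) (auto simp: G_def)
        have v2: "v = finsum M c2 G" unfolding 2(3) using G car[OF G(2) 2(1)]
          by (intro M.add.finprod_mono_neutral_cong_left) (auto simp: G_def)
        have eq: "c1 P = (c1 P \<ominus>\<^bsub>M\<^esub> c2 P) \<oplus>\<^bsub>M\<^esub> c2 P" if "P \<in> G" for P
        proof -
          have "c1 P \<in> carrier M" "c2 P \<in> carrier M" using car[OF G(2)] 1 2 that by auto
          then show ?thesis by (simp add: M.add_minus_cancel)
        qed
        have dcar: "(\<lambda>P. c1 P \<ominus>\<^bsub>M\<^esub> c2 P) \<in> G \<rightarrow> carrier M"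
          using car[OF G(2) 1(1)] car[OF G(2) 2(1)] by auto
        have "v = finsum M (\<lambda>P. (c1 P \<ominus>\<^bsub>M\<^esub> c2 P) \<oplus>\<^bsub>M\<^esub> c2 P) G"
          unfolding v1 using eq car[OF G(2) 1(1)] by (intro M.finsum_cong') (auto simp flip: eq)
        also have "\<dots> = finsum M (\<lambda>P. c1 P \<ominus>\<^bsub>M\<^esub> c2 P) G \<oplus>\<^bsub>M\<^esub> v"
          unfolding v2 using dcar car[OF G(2) 2(1)] by (intro M.finsum_addf)
        finally have "finsum M (\<lambda>P. c1 P \<ominus>\<^bsub>M\<^esub> c2 P) G = \<zero>\<^bsub>M\<^esub>"
          by (simp only: M.add.l_cancel_one'[OF v M.finsum_closed[OF dcar]] M.add.r_cancel_one'[OF v M.finsum_closed[OF dcar]])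
        moreover have "\<forall>P\<in>G. c1 P \<ominus>\<^bsub>M\<^esub> c2 P \<in> P"
          using submoduleD(6)[OF sub] G(2) PiE_mem[OF 1(1)] PiE_mem[OF 2(1)] by blast
        ultimately have z: "c1 P \<ominus>\<^bsub>M\<^esub> c2 P = \<zero>\<^bsub>M\<^esub>" if "P \<in> G" for P
          using ind[OF G, of "\<lambda>P. c1 P \<ominus>\<^bsub>M\<^esub> c2 P" P] that by simp
        show "c1 P = c2 P"
        proof (cases "P \<in> G")
          case True
          then have "c1 P \<in> carrier M" "c2 P \<in> carrier M"
            using car[OF G(2) 1(1)] car[OF G(2) 2(1)] by auto
          then show ?thesis using z[OF True] M.eq_if_minus_eq_zero by metis
        next
          case False
          then show ?thesis
            using PiE_arb[OF 1(1)] PiE_arb[OF 2(1)] by (cases "P \<in> \<P>") (simp_all add: G_def)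
        qed
      qed
      then show ?thesis using ex by (intro ex1I[of _ c']) auto
    qed
    then show "semisimple_module R M"
      unfolding semisimple_module_def
      using True sub S irreducible_restrict_iff[OF True] by (intro conjI exI[of _ \<P>] ballI) auto
  qed
qed (simp add: semisimple_module_def)

section \<open>Induced modules\<close>

lemma module_homsD:
  assumes "u \<in> module_homs R M N"
  shows "v \<in> carrier M \<Longrightarrow> u v \<in> carrier N"
    and "v \<in> carrier M \<Longrightarrow> w \<in> carrier M \<Longrightarrow> u (v \<oplus>\<^bsub>M\<^esub> w) = u v \<oplus>\<^bsub>N\<^esub> u w"
    and "a \<in> carrier R \<Longrightarrow> v \<in> carrier M \<Longrightarrow> u (a \<odot>\<^bsub>M\<^esub> v) = a \<odot>\<^bsub>N\<^esub> u v"
  using assms by (auto simp: module_homs_def)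

lemma additive_map_zero:
  assumes "abelian_group M" "abelian_group N" "u \<in> carrier M \<rightarrow> carrier N"
    and "\<And>v w. v \<in> carrier M \<Longrightarrow> w \<in> carrier M \<Longrightarrow> u (v \<oplus>\<^bsub>M\<^esub> w) = u v \<oplus>\<^bsub>N\<^esub> u w"
  shows "u \<zero>\<^bsub>M\<^esub> = \<zero>\<^bsub>N\<^esub>"
proof -
  interpret M: abelian_group M by fact
  interpret N: abelian_group N by fact
  have c: "u \<zero>\<^bsub>M\<^esub> \<in> carrier N" using assms(3) by auto
  have "u \<zero>\<^bsub>M\<^esub> \<oplus>\<^bsub>N\<^esub> u \<zero>\<^bsub>M\<^esub> = u \<zero>\<^bsub>M\<^esub>" using assms(4)[of "\<zero>\<^bsub>M\<^esub>" "\<zero>\<^bsub>M\<^esub>"] by simp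
  then show ?thesis using c by simp
qed

lemma additive_map_minus:
  assumes "abelian_group M" "abelian_group N" "u \<in> carrier M \<rightarrow> carrier N"
    and add: "\<And>v w. v \<in> carrier M \<Longrightarrow> w \<in> carrier M \<Longrightarrow> u (v \<oplus>\<^bsub>M\<^esub> w) = u v \<oplus>\<^bsub>N\<^esub> u w"
    and "v \<in> carrier M" "w \<in> carrier M"
  shows "u (v \<ominus>\<^bsub>M\<^esub> w) = u v \<ominus>\<^bsub>N\<^esub> u w"
proof -
  interpret M: abelian_group M by fact
  interpret N: abelian_group N by fact
  have "u (v \<ominus>\<^bsub>M\<^esub> w) \<oplus>\<^bsub>N\<^esub> u w = u v"
    using add[of "v \<ominus>\<^bsub>M\<^esub> w" w] assms(5,6) by (simp add: M.add_minus_cancel)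
  moreover have "u (v \<ominus>\<^bsub>M\<^esub> w) \<in> carrier N" "u w \<in> carrier N" using assms by auto
  ultimately show ?thesis using N.add_minus_cancel(1) by metis
qed

lemma additive_map_finsum:
  assumes "abelian_group M" "abelian_group N" "u \<in> carrier M \<rightarrow> carrier N"
    and add: "\<And>v w. v \<in> carrier M \<Longrightarrow> w \<in> carrier M \<Longrightarrow> u (v \<oplus>\<^bsub>M\<^esub> w) = u v \<oplus>\<^bsub>N\<^esub> u w"
    and "finite F" "c \<in> F \<rightarrow> carrier M"
  shows "u (finsum M c F) = finsum N (\<lambda>i. u (c i)) F"
  using assms(5,6)
proof (induction F)
  case empty
  interpret M: abelian_group M by fact
  interpret N: abelian_group N by fact
  show ?case using additive_map_zero[where u = u, OF assms(1-4)] by simp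
next
  case (insert x F)
  interpret M: abelian_group M by fact
  interpret N: abelian_group N by fact
  have c: "c \<in> F \<rightarrow> carrier M" "c x \<in> carrier M" using insert.prems by auto
  have uc: "(\<lambda>i. u (c i)) \<in> F \<rightarrow> carrier N" "u (c x) \<in> carrier N" using c assms(3) by auto
  show ?case
    using insert c uc add[OF c(2) M.finsum_closed[OF c(1)]]
    by (simp add: M.finsum_insert N.finsum_insert)
qed

lemma module_homs_zero:
  assumes "left_module R M" "left_module R N" and u: "u \<in> module_homs R M N"
  shows "u \<zero>\<^bsub>M\<^esub> = \<zero>\<^bsub>N\<^esub>"
proof -
  interpret M: left_module R M by fact
  interpret N: left_module R N by fact
  show ?thesis
    using module_homsD[OF u]
    by (intro additive_map_zero) (auto intro: M.M.abelian_group_axioms N.M.abelian_group_axioms)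
qed

lemma submodule_image:
  assumes M: "left_module R M" and N: "left_module R N" and u: "u \<in> module_homs R M N"
    and P: "submodule P R M"
  shows "submodule (u ` P) R N"
proof -
  interpret M: left_module R M by fact
  interpret N: left_module R N by fact
  note p = M.submoduleD[OF P] and h = module_homsD[OF u]
  note u0 = module_homs_zero[OF M N u]
  show ?thesis
  proof (rule N.submoduleI)
    show "u ` P \<subseteq> carrier N" using h(1) p(1) by auto
    show "\<zero>\<^bsub>N\<^esub> \<in> u ` P" using u0 p(2) by force
  next
    fix x y assume "x \<in> u ` P" "y \<in> u ` P"
    then obtain v w where "x = u v" "y = u w" "v \<in> P" "w \<in> P" by blast
    then show "x \<oplus>\<^bsub>N\<^esub> y \<in> u ` P" using h(2)[of v w] p(1,3) by (metis image_eqI subsetD)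
  next
    fix a x assume a: "a \<in> carrier R" and "x \<in> u ` P"
    then obtain v where "x = u v" "v \<in> P" by blast
    then show "a \<odot>\<^bsub>N\<^esub> x \<in> u ` P" using h(3)[OF a, of v] p(1) p(4)[OF a] by (metis image_eqI subsetD)
  qed
qed

lemma submodule_preimage:
  assumes M: "left_module R M" and N: "left_module R N" and u: "u \<in> module_homs R M N"
    and P: "submodule P R M" and Q: "submodule Q R N"
  shows "submodule {v \<in> P. u v \<in> Q} R M"
proof -
  interpret M: left_module R M by fact
  interpret N: left_module R N by fact
  note p = M.submoduleD[OF P] and q = N.submoduleD[OF Q] and h = module_homsD[OF u]
  note u0 = module_homs_zero[OF M N u]
  show ?thesis
  proof (rule M.submoduleI)
    show "{v \<in> P. u v \<in> Q} \<subseteq> carrier M" using p(1) by auto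
    show "\<zero>\<^bsub>M\<^esub> \<in> {v \<in> P. u v \<in> Q}" using u0 p(2) q(2) by simp
    fix v w assume vw: "v \<in> {v \<in> P. u v \<in> Q}" "w \<in> {v \<in> P. u v \<in> Q}"
    then have "v \<in> carrier M" "w \<in> carrier M" using p(1) by auto
    then show "v \<oplus>\<^bsub>M\<^esub> w \<in> {v \<in> P. u v \<in> Q}" using vw h(2)[of v w] p(3) q(3) by simp
  next
    fix a v assume a: "a \<in> carrier R" and v: "v \<in> {v \<in> P. u v \<in> Q}"
    then have "v \<in> carrier M" using p(1) by auto
    then show "a \<odot>\<^bsub>M\<^esub> v \<in> {v \<in> P. u v \<in> Q}" using v h(3)[OF a, of v] p(4)[OF a] q(4)[OF a] by simp
  qed
qed

text \<open>A submodule Q of the image is the image of its preimage in P, and that preimage is 0 or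
  P.\<close>

lemma simple_submodule_image:
  assumes M: "left_module R M" and N: "left_module R N" and u: "u \<in> module_homs R M N"
    and P: "simple_submodule P R M"
  shows "u ` P = {\<zero>\<^bsub>N\<^esub>} \<or> simple_submodule (u ` P) R N"
proof (rule disjCI)
  interpret M: left_module R M by fact
  interpret N: left_module R N by fact
  have Ps: "submodule P R M" using P by (simp add: simple_submodule_def)
  note h = module_homsD[OF u]
  note u0 = module_homs_zero[OF M N u]
  assume not: "\<not> simple_submodule (u ` P) R N"
  have sub: "submodule (u ` P) R N" using M N u Ps by (rule submodule_image)
  show "u ` P = {\<zero>\<^bsub>N\<^esub>}"
  proof (rule ccontr)
    assume ne: "u ` P \<noteq> {\<zero>\<^bsub>N\<^esub>}"
    obtain Q where Q: "submodule Q R N" "Q \<subseteq> u ` P" "Q \<noteq> {\<zero>\<^bsub>N\<^esub>}" "Q \<noteq> u ` P"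
      using not sub ne unfolding simple_submodule_def by metis
    have "submodule {v \<in> P. u v \<in> Q} R M" using M N u Ps Q(1) by (rule submodule_preimage)
    then have "{v \<in> P. u v \<in> Q} = {\<zero>\<^bsub>M\<^esub>} \<or> {v \<in> P. u v \<in> Q} = P"
      using P unfolding simple_submodule_def by (metis (no_types, lifting) mem_Collect_eq subsetI)
    then have "u ` {v \<in> P. u v \<in> Q} = u ` {\<zero>\<^bsub>M\<^esub>} \<or> u ` {v \<in> P. u v \<in> Q} = u ` P"
      by (elim disjE) simp_all
    moreover have "u ` {v \<in> P. u v \<in> Q} = Q" using Q(2) by blast
    ultimately have "Q = u ` {\<zero>\<^bsub>M\<^esub>} \<or> Q = u ` P" by simp
    then show False using Q(3,4) u0 by auto
  qed
qed

section \<open>The tensor product as a quotient of a free abelian group\<close>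

locale induced_module = A: ring A + B: ring B + M: left_module A M
  for A :: "('a, 'm) ring_scheme" and B :: "('b, 'n) ring_scheme" and M :: "('a, 'v) module" +
  fixes \<phi> :: "'a \<Rightarrow> 'b"
  assumes hom: "\<phi> \<in> ring_hom A B"
begin

abbreviation "F \<equiv> tensor_free B M"
abbreviation "N \<equiv> tensor_relations A B \<phi> M"
abbreviation "I \<equiv> Ind A B \<phi> M"

definition relators where "relators =
    {frag_of (b \<oplus>\<^bsub>B\<^esub> b', v) - frag_of (b, v) - frag_of (b', v) | b b' v.
        b \<in> carrier B \<and> b' \<in> carrier B \<and> v \<in> carrier M} \<union>
     {frag_of (b, v \<oplus>\<^bsub>M\<^esub> v') - frag_of (b, v) - frag_of (b, v') | b v v'.
        b \<in> carrier B \<and> v \<in> carrier M \<and> v' \<in> carrier M} \<union>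
     {frag_of (b \<otimes>\<^bsub>B\<^esub> \<phi> a, v) - frag_of (b, a \<odot>\<^bsub>M\<^esub> v) | a b v.
        a \<in> carrier A \<and> b \<in> carrier B \<and> v \<in> carrier M}"

text \<open>The pure tensor of b and v.\<close>

definition tens :: "'b \<Rightarrow> 'v \<Rightarrow> ('b \<times> 'v \<Rightarrow>\<^sub>0 int) set" where
  "tens b v = N #>\<^bsub>F\<^esub> frag_of (b, v)"

lemma hom_closed: "a \<in> carrier A \<Longrightarrow> \<phi> a \<in> carrier B"
  using hom by (rule ring_hom_closed)

lemma comm_group_F: "comm_group F"
  unfolding tensor_free_def by (rule abelian_free_Abelian_group)

lemma group_F: "Group.group F"
  using comm_group_F by (simp add: comm_group_def)

lemma F_simps: "x \<in> carrier F \<longleftrightarrow> Poly_Mapping.keys x \<subseteq> carrier B \<times> carrier M"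
  "\<one>\<^bsub>F\<^esub> = 0" "x \<otimes>\<^bsub>F\<^esub> y = x + y"
  by (simp_all add: tensor_free_def)

lemma F_closed:
  "x \<in> carrier F \<Longrightarrow> y \<in> carrier F \<Longrightarrow> x + y \<in> carrier F"
  "x \<in> carrier F \<Longrightarrow> y \<in> carrier F \<Longrightarrow> x - y \<in> carrier F"
  "b \<in> carrier B \<Longrightarrow> v \<in> carrier M \<Longrightarrow> frag_of (b, v) \<in> carrier F"
proof -
  show "x \<in> carrier F \<Longrightarrow> y \<in> carrier F \<Longrightarrow> x + y \<in> carrier F"
    unfolding F_simps using keys_add[of x y] by blast
  show "x \<in> carrier F \<Longrightarrow> y \<in> carrier F \<Longrightarrow> x - y \<in> carrier F"
    unfolding F_simps using keys_diff[of x y] by blast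
qed (simp add: F_simps)

lemma relators_cases:
  assumes "x \<in> relators"
  obtains b b' v where "x = frag_of (b \<oplus>\<^bsub>B\<^esub> b', v) - frag_of (b, v) - frag_of (b', v)"
      "b \<in> carrier B" "b' \<in> carrier B" "v \<in> carrier M"
  | b v v' where "x = frag_of (b, v \<oplus>\<^bsub>M\<^esub> v') - frag_of (b, v) - frag_of (b, v')"
      "b \<in> carrier B" "v \<in> carrier M" "v' \<in> carrier M"
  | a b v where "x = frag_of (b \<otimes>\<^bsub>B\<^esub> \<phi> a, v) - frag_of (b, a \<odot>\<^bsub>M\<^esub> v)"
      "a \<in> carrier A" "b \<in> carrier B" "v \<in> carrier M"
  using assms unfolding relators_def by blast

lemma relators_closed: "relators \<subseteq> carrier F"
proof
  fix x assume "x \<in> relators"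
  then show "x \<in> carrier F"
  proof (cases rule: relators_cases)
    case 1 then show ?thesis by (auto intro!: F_closed)
  next
    case 2 then show ?thesis by (auto intro!: F_closed)
  next
    case 3 then show ?thesis by (auto intro!: F_closed hom_closed M.smult_closed)
  qed
qed

lemma N_def: "N = generate F relators"
  by (simp add: tensor_relations_def relators_def)

lemma subgroup_N: "subgroup N F"
  unfolding N_def using relators_closed by (rule group.generate_is_subgroup[OF group_F])

lemma normal_N: "N \<lhd> F"
  using subgroup_N by (rule comm_group.subgroup_imp_normal[OF comm_group_F])

lemma relators_N: "relators \<subseteq> N"
  unfolding N_def by (auto intro: generate.incl)

lemma Ind_simps:
  "carrier I = (\<lambda>x. N #>\<^bsub>F\<^esub> x) ` carrier F"
  "\<zero>\<^bsub>I\<^esub> = N" "x \<oplus>\<^bsub>I\<^esub> y = x <#>\<^bsub>F\<^esub> y"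
  "b \<odot>\<^bsub>I\<^esub> C = N <#>\<^bsub>F\<^esub> (frag_extend (\<lambda>(b', v). frag_of (b \<otimes>\<^bsub>B\<^esub> b', v)) ` C)"
  by (simp_all add: Ind_def Let_def carrier_FactGroup)

lemma abelian_group_Ind: "abelian_group I"
proof -
  interpret G: comm_group "F Mod N"
    using comm_group.abelian_FactGroup[OF comm_group_F subgroup_N] .
  have eq: "carrier (add_monoid I) = carrier (F Mod N)"
    "monoid.mult (add_monoid I) = monoid.mult (F Mod N)" "one (add_monoid I) = one (F Mod N)"
    by (simp_all add: Ind_def Let_def)
  have "comm_group (add_monoid I)"
    by (rule comm_groupI, unfold eq)
      (rule G.m_closed G.one_closed G.m_assoc G.m_comm G.l_one G.l_inv_ex; assumption)+
  then show ?thesis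
    by (simp add: abelian_group_def abelian_monoid_def abelian_group_axioms_def comm_group_def)
qed

sublocale Ind: abelian_group I by (rule abelian_group_Ind)

lemma coset_add:
  "x \<in> carrier F \<Longrightarrow> y \<in> carrier F \<Longrightarrow> (N #>\<^bsub>F\<^esub> x) \<oplus>\<^bsub>I\<^esub> (N #>\<^bsub>F\<^esub> y) = N #>\<^bsub>F\<^esub> (x + y)"
  using normal.rcos_sum[OF normal_N, of x y] by (simp add: Ind_simps F_simps(3))

lemma coset_closed: "x \<in> carrier F \<Longrightarrow> N #>\<^bsub>F\<^esub> x \<in> carrier I"
  by (simp add: Ind_simps)

lemma coset_eq:
  assumes "x \<in> carrier F" "y \<in> carrier F" "x - y \<in> N"
  shows "N #>\<^bsub>F\<^esub> x = N #>\<^bsub>F\<^esub> y"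
proof -
  have "x = (x - y) \<otimes>\<^bsub>F\<^esub> y" by (simp add: F_simps)
  then have "x \<in> N #>\<^bsub>F\<^esub> y" using assms(3) unfolding r_coset_def by blast
  then show ?thesis using group.repr_independence[OF group_F _ assms(2) subgroup_N] by simp
qed

lemma coset_minus:
  assumes "x \<in> carrier F" "y \<in> carrier F"
  shows "(N #>\<^bsub>F\<^esub> x) \<ominus>\<^bsub>I\<^esub> (N #>\<^bsub>F\<^esub> y) = N #>\<^bsub>F\<^esub> (x - y)"
  using coset_add[OF F_closed(2)[OF assms] assms(2)] coset_closed[OF F_closed(2)[OF assms]]
    coset_closed[OF assms(2)]
  by (metis Ind.add_minus_cancel(1) diff_add_cancel)

lemma tens_closed: "b \<in> carrier B \<Longrightarrow> v \<in> carrier M \<Longrightarrow> tens b v \<in> carrier I"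
  unfolding tens_def by (intro coset_closed F_closed)

lemma tens_add_left:
  assumes "b \<in> carrier B" "b' \<in> carrier B" "v \<in> carrier M"
  shows "tens (b \<oplus>\<^bsub>B\<^esub> b') v = tens b v \<oplus>\<^bsub>I\<^esub> tens b' v"
proof -
  have "frag_of (b \<oplus>\<^bsub>B\<^esub> b', v) - (frag_of (b, v) + frag_of (b', v)) \<in> relators"
    unfolding relators_def using assms by (auto simp: diff_diff_eq)
  then have "tens (b \<oplus>\<^bsub>B\<^esub> b') v = N #>\<^bsub>F\<^esub> (frag_of (b, v) + frag_of (b', v))"
    unfolding tens_def using assms relators_N
    by (intro coset_eq F_closed B.a_closed M.M.a_closed) blast+
  then show ?thesis unfolding tens_def using assms by (simp add: coset_add F_closed)
qed

lemma tens_add_right: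
  assumes "b \<in> carrier B" "v \<in> carrier M" "v' \<in> carrier M"
  shows "tens b (v \<oplus>\<^bsub>M\<^esub> v') = tens b v \<oplus>\<^bsub>I\<^esub> tens b v'"
proof -
  have "frag_of (b, v \<oplus>\<^bsub>M\<^esub> v') - (frag_of (b, v) + frag_of (b, v')) \<in> relators"
    unfolding relators_def using assms by (auto simp: diff_diff_eq)
  then have "tens b (v \<oplus>\<^bsub>M\<^esub> v') = N #>\<^bsub>F\<^esub> (frag_of (b, v) + frag_of (b, v'))"
    unfolding tens_def using assms relators_N
    by (intro coset_eq F_closed B.a_closed M.M.a_closed) blast+
  then show ?thesis unfolding tens_def using assms by (simp add: coset_add F_closed)
qed

lemma tens_balanced:
  assumes "a \<in> carrier A" "b \<in> carrier B" "v \<in> carrier M"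
  shows "tens (b \<otimes>\<^bsub>B\<^esub> \<phi> a) v = tens b (a \<odot>\<^bsub>M\<^esub> v)"
proof -
  have "frag_of (b \<otimes>\<^bsub>B\<^esub> \<phi> a, v) - frag_of (b, a \<odot>\<^bsub>M\<^esub> v) \<in> relators"
    unfolding relators_def using assms by blast
  then show ?thesis
    unfolding tens_def using assms relators_N
    by (intro coset_eq F_closed B.m_closed hom_closed M.smult_closed) blast+
qed

text \<open>The case of differences mirrors the induction rule for free abelian groups, which builds
  elements from generators by subtraction.\<close>

lemma Ind_induct [consumes 1, case_names zero minus tens]:
  assumes "C \<in> carrier I" "P \<zero>\<^bsub>I\<^esub>"
    and minus: "\<And>C D. C \<in> carrier I \<Longrightarrow> D \<in> carrier I \<Longrightarrow> P C \<Longrightarrow> P D \<Longrightarrow> P (C \<ominus>\<^bsub>I\<^esub> D)"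
    and tens: "\<And>b v. b \<in> carrier B \<Longrightarrow> v \<in> carrier M \<Longrightarrow> P (tens b v)"
  shows "P C"
proof -
  obtain x where x: "x \<in> carrier F" "C = N #>\<^bsub>F\<^esub> x" using assms(1) by (auto simp: Ind_simps)
  have "Poly_Mapping.keys x \<subseteq> carrier B \<times> carrier M" using x by (simp add: F_simps)
  then have "P (N #>\<^bsub>F\<^esub> x)"
  proof (rule free_Abelian_group_induct[where P = "\<lambda>x. P (N #>\<^bsub>F\<^esub> x)"])
    have "0 \<in> N" using subgroup.one_closed[OF subgroup_N] by (simp add: F_simps)
    then have "N #>\<^bsub>F\<^esub> 0 = N" 
      using group.coset_join2[OF group_F _ subgroup_N, of 0] by (simp add: F_simps(1))
    then show "P (N #>\<^bsub>F\<^esub> 0)" using assms(2) by (simp add: Ind_simps)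
  next
    fix x y :: "'b \<times> 'v \<Rightarrow>\<^sub>0 int"
    assume "Poly_Mapping.keys x \<subseteq> carrier B \<times> carrier M" "Poly_Mapping.keys y \<subseteq> carrier B \<times> carrier M"
      and P: "P (N #>\<^bsub>F\<^esub> x)" "P (N #>\<^bsub>F\<^esub> y)"
    then have xy: "x \<in> carrier F" "y \<in> carrier F" by (simp_all add: F_simps)
    show "P (N #>\<^bsub>F\<^esub> (x - y))"
      using minus[OF coset_closed coset_closed, OF xy P] xy by (simp add: coset_minus)
  next
    fix p assume "p \<in> carrier B \<times> carrier M"
    then show "P (N #>\<^bsub>F\<^esub> frag_of p)" using tens[of "fst p" "snd p"] by (simp add: tens_def mem_Times_iff)
  qed
  then show ?thesis using x by simp
qed

text \<open>The additive extension of \<open>\<beta>\<close> to the free abelian group kills every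
  relator, by biadditivity and balancedness, and therefore factors through the quotient. The result
  is only additive; linearity is proved where it is used.\<close>

lemma Ind_universal:
  assumes K: "abelian_group K"
    and closed: "\<And>b v. b \<in> carrier B \<Longrightarrow> v \<in> carrier M \<Longrightarrow> \<beta> b v \<in> carrier K"
    and add_left: "\<And>b b' v. b \<in> carrier B \<Longrightarrow> b' \<in> carrier B \<Longrightarrow> v \<in> carrier M \<Longrightarrow>
      \<beta> (b \<oplus>\<^bsub>B\<^esub> b') v = \<beta> b v \<oplus>\<^bsub>K\<^esub> \<beta> b' v"
    and add_right: "\<And>b v v'. b \<in> carrier B \<Longrightarrow> v \<in> carrier M \<Longrightarrow> v' \<in> carrier M \<Longrightarrow>
      \<beta> b (v \<oplus>\<^bsub>M\<^esub> v') = \<beta> b v \<oplus>\<^bsub>K\<^esub> \<beta> b v'"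
    and balanced: "\<And>a b v. a \<in> carrier A \<Longrightarrow> b \<in> carrier B \<Longrightarrow> v \<in> carrier M \<Longrightarrow>
      \<beta> (b \<otimes>\<^bsub>B\<^esub> \<phi> a) v = \<beta> b (a \<odot>\<^bsub>M\<^esub> v)"
  obtains h where "h \<in> carrier I \<rightarrow> carrier K"
    and "\<And>C D. C \<in> carrier I \<Longrightarrow> D \<in> carrier I \<Longrightarrow> h (C \<oplus>\<^bsub>I\<^esub> D) = h C \<oplus>\<^bsub>K\<^esub> h D"
    and "\<And>b v. b \<in> carrier B \<Longrightarrow> v \<in> carrier M \<Longrightarrow> h (tens b v) = \<beta> b v"
proof -
  interpret K: abelian_group K by fact
  have "(\<lambda>(b, v). \<beta> b v) ` (carrier B \<times> carrier M) \<subseteq> carrier (add_monoid K)"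
    using closed by auto
  then obtain k where k: "k \<in> hom F (add_monoid K)"
    and k_of: "\<And>p. p \<in> carrier B \<times> carrier M \<Longrightarrow> k (frag_of p) = (\<lambda>(b, v). \<beta> b v) p"
    using comm_group.free_Abelian_group_universal[OF K.a_comm_group, of "\<lambda>(b, v). \<beta> b v"]
    unfolding tensor_free_def by metis
  have k_of': "k (frag_of (b, v)) = \<beta> b v" if "b \<in> carrier B" "v \<in> carrier M" for b v
    using k_of that by simp
  have kc: "k x \<in> carrier K" if "x \<in> carrier F" for x using k that by (auto simp: hom_def)
  have k_add: "k (x + y) = k x \<oplus>\<^bsub>K\<^esub> k y" if "x \<in> carrier F" "y \<in> carrier F" for x y
    using hom_mult[OF k that] by (simp add: F_simps)
  have k_minus: "k (x - y) = k x \<ominus>\<^bsub>K\<^esub> k y" if "x \<in> carrier F" "y \<in> carrier F" for x y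
    using k_add[OF F_closed(2)[OF that] that(2)] kc F_closed(2)[OF that] that
    by (metis K.add_minus_cancel(1) diff_add_cancel)
  have self: "x \<ominus>\<^bsub>K\<^esub> x = \<zero>\<^bsub>K\<^esub>" if "x \<in> carrier K" for x
    using that by (simp add: K.minus_eq K.r_neg)
  \<comment> \<open>The value under \<open>k\<close> of a relator expressing additivity in one
    factor.\<close>
  have zero: "x \<oplus>\<^bsub>K\<^esub> y \<ominus>\<^bsub>K\<^esub> x \<ominus>\<^bsub>K\<^esub> y = \<zero>\<^bsub>K\<^esub>"
    if "x \<in> carrier K" "y \<in> carrier K" for x y
    using that self K.add_minus_cancel(2)[OF that] by simp
  interpret gh: group_hom F "add_monoid K" k
    using group_F K.a_group k by (simp add: group_hom_def group_hom_axioms_def)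
  have "relators \<subseteq> kernel F (add_monoid K) k"
  proof
    fix x assume x: "x \<in> relators"
    then have "k x = \<zero>\<^bsub>K\<^esub>"
    proof (cases rule: relators_cases)
      case 1
      then show ?thesis by (simp add: k_minus k_of' F_closed zero add_left closed)
    next
      case 2
      then show ?thesis by (simp add: k_minus k_of' F_closed zero add_right closed)
    next
      case 3
      then show ?thesis
        by (simp add: k_minus k_of' F_closed self balanced closed hom_closed M.smult_closed)
    qed
    then show "x \<in> kernel F (add_monoid K) k" using x relators_closed by (auto simp: kernel_def)
  qed
  then have "N \<subseteq> kernel F (add_monoid K) k"
    unfolding N_def by (rule group.generate_subgroup_incl[OF group_F _ gh.subgroup_kernel])
  then obtain h where h: "h \<in> hom (F Mod N) (add_monoid K)"
    and h_coset: "\<And>x. x \<in> carrier F \<Longrightarrow> h (N #>\<^bsub>F\<^esub> x) = k x"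
    using gh.FactGroup_universal_kernel[OF normal_N] by metis
  show ?thesis
  proof (rule that[of h])
    show "h \<in> carrier I \<rightarrow> carrier K"
      using h_coset kc by (auto simp: Ind_simps)
    fix C D assume "C \<in> carrier I" "D \<in> carrier I"
    then show "h (C \<oplus>\<^bsub>I\<^esub> D) = h C \<oplus>\<^bsub>K\<^esub> h D"
      using hom_mult[OF h, of C D] by (simp add: Ind_simps carrier_FactGroup)
  next
    fix b v assume "b \<in> carrier B" "v \<in> carrier M"
    then show "h (tens b v) = \<beta> b v" using h_coset k_of' F_closed by (simp add: tens_def)
  qed
qed

text \<open>Pure tensors generate the quotient as a group. The module axioms and later linearity
  claims are checked on them through this lemma.\<close>

lemma Ind_ext:
  assumes K: "abelian_group K" and h: "h \<in> carrier I \<rightarrow> carrier K" and k: "k \<in> carrier I \<rightarrow> carrier K"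
    and "\<And>C D. C \<in> carrier I \<Longrightarrow> D \<in> carrier I \<Longrightarrow> h (C \<oplus>\<^bsub>I\<^esub> D) = h C \<oplus>\<^bsub>K\<^esub> h D"
    and "\<And>C D. C \<in> carrier I \<Longrightarrow> D \<in> carrier I \<Longrightarrow> k (C \<oplus>\<^bsub>I\<^esub> D) = k C \<oplus>\<^bsub>K\<^esub> k D"
    and "\<And>b v. b \<in> carrier B \<Longrightarrow> v \<in> carrier M \<Longrightarrow> h (tens b v) = k (tens b v)"
    and "C \<in> carrier I"
  shows "h C = k C"
  using assms(7)
proof (induction C rule: Ind_induct)
  case zero
  show ?case
    using additive_map_zero[where u = h, OF abelian_group_Ind K h assms(4)]
      additive_map_zero[where u = k, OF abelian_group_Ind K k assms(5)] by simp
next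
  case (minus C D)
  show ?case
    using additive_map_minus[where u = h, OF abelian_group_Ind K h assms(4) minus(1,2)]
      additive_map_minus[where u = k, OF abelian_group_Ind K k assms(5) minus(1,2)] minus(3,4) by simp
qed (rule assms(6))

abbreviation left_mult :: "'b \<Rightarrow> ('b \<times> 'v \<Rightarrow>\<^sub>0 int) \<Rightarrow> ('b \<times> 'v \<Rightarrow>\<^sub>0 int)" where
  "left_mult b \<equiv> frag_extend (\<lambda>(b', v). frag_of (b \<otimes>\<^bsub>B\<^esub> b', v))"

lemma left_mult_closed:
  assumes "b \<in> carrier B" "x \<in> carrier F"
  shows "left_mult b x \<in> carrier F"
proof -
  have "Poly_Mapping.keys x \<subseteq> carrier B \<times> carrier M" using assms(2) by (simp add: F_simps)
  then show ?thesis
  proof (rule free_Abelian_group_induct[where P = "\<lambda>x. left_mult b x \<in> carrier F"])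
    show "left_mult b 0 \<in> carrier F" by (simp add: F_simps)
    show "left_mult b (x - y) \<in> carrier F"
      if "left_mult b x \<in> carrier F" "left_mult b y \<in> carrier F" for x y
      using that by (simp add: frag_extend_diff F_closed)
    show "left_mult b (frag_of p) \<in> carrier F" if "p \<in> carrier B \<times> carrier M" for p
      using assms(1) that by (auto intro!: F_closed)
  qed
qed

text \<open>The elements that b carries into \<open>N\<close> form a subgroup, and b turns each
  relator into a relator of the same kind. Hence the action descends to cosets.\<close>

lemma left_mult_N:
  assumes b: "b \<in> carrier B" and "x \<in> N"
  shows "left_mult b x \<in> N"
proof -
  have "subgroup {x \<in> carrier F. left_mult b x \<in> N} F"
  proof (rule group.subgroupI[OF group_F])
    show "{x \<in> carrier F. left_mult b x \<in> N} \<noteq> {}"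
      using subgroup.one_closed[OF subgroup_N] by (auto simp: F_simps intro!: exI[of _ 0])
    fix x assume x: "x \<in> {x \<in> carrier F. left_mult b x \<in> N}"
    have inv: "inv\<^bsub>F\<^esub> y = - y" if "y \<in> carrier F" for y
      using that unfolding F_simps by (simp add: tensor_free_def)
    have "left_mult b (- x) = - left_mult b x" by (rule frag_extend_minus)
    then show "inv\<^bsub>F\<^esub> x \<in> {x \<in> carrier F. left_mult b x \<in> N}"
      using x inv[of x] inv[of "left_mult b x"] left_mult_closed[OF b, of x]
        subgroup.m_inv_closed[OF subgroup_N, of "left_mult b x"]
        group.inv_closed[OF group_F, of x] by simp
    fix y assume y: "y \<in> {x \<in> carrier F. left_mult b x \<in> N}"
    show "x \<otimes>\<^bsub>F\<^esub> y \<in> {x \<in> carrier F. left_mult b x \<in> N}"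
      using x y subgroup.m_closed[OF subgroup_N, of "left_mult b x" "left_mult b y"]
      by (simp add: F_simps(2,3) frag_extend_add F_closed)
  qed auto
  moreover have "relators \<subseteq> {x \<in> carrier F. left_mult b x \<in> N}"
  proof
    fix x assume x: "x \<in> relators"
    then have "left_mult b x \<in> relators"
    proof (cases rule: relators_cases)
      case (1 c c' v)
      then have "left_mult b x =
          frag_of (b \<otimes>\<^bsub>B\<^esub> c \<oplus>\<^bsub>B\<^esub> b \<otimes>\<^bsub>B\<^esub> c', v) - frag_of (b \<otimes>\<^bsub>B\<^esub> c, v) - frag_of (b \<otimes>\<^bsub>B\<^esub> c', v)"
        using b by (simp add: frag_extend_diff B.r_distr)
      moreover have "b \<otimes>\<^bsub>B\<^esub> c \<in> carrier B" "b \<otimes>\<^bsub>B\<^esub> c' \<in> carrier B" using 1 b by auto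
      ultimately show ?thesis using 1(4) unfolding relators_def by blast
    next
      case (2 c v v')
      then have "left_mult b x =
          frag_of (b \<otimes>\<^bsub>B\<^esub> c, v \<oplus>\<^bsub>M\<^esub> v') - frag_of (b \<otimes>\<^bsub>B\<^esub> c, v) - frag_of (b \<otimes>\<^bsub>B\<^esub> c, v')"
        by (simp add: frag_extend_diff)
      moreover have "b \<otimes>\<^bsub>B\<^esub> c \<in> carrier B" using 2 b by auto
      ultimately show ?thesis using 2(3,4) unfolding relators_def by blast
    next
      case (3 a c v)
      then have "left_mult b x =
          frag_of (b \<otimes>\<^bsub>B\<^esub> c \<otimes>\<^bsub>B\<^esub> \<phi> a, v) - frag_of (b \<otimes>\<^bsub>B\<^esub> c, a \<odot>\<^bsub>M\<^esub> v)"
        using b by (simp add: frag_extend_diff B.m_assoc hom_closed)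
      moreover have "b \<otimes>\<^bsub>B\<^esub> c \<in> carrier B" using 3 b by auto
      ultimately show ?thesis using 3(2,4) unfolding relators_def by blast
    qed
    then show "x \<in> {x \<in> carrier F. left_mult b x \<in> N}"
      using x relators_closed relators_N by blast
  qed
  ultimately have "N \<subseteq> {x \<in> carrier F. left_mult b x \<in> N}"
    unfolding N_def[of] by (intro group.generate_subgroup_incl[OF group_F]) (simp_all add: N_def)
  then show ?thesis using assms(2) by blast
qed

text \<open>Left multiplication may map a coset onto only a part of a coset. Adding
  \<open>N\<close>, as in the definition of the action, fills it up, and \<open>left_mult_N\<close>
  shows that it does not overshoot.\<close>

lemma smult_coset:
  assumes b: "b \<in> carrier B" and x: "x \<in> carrier F"
  shows "b \<odot>\<^bsub>I\<^esub> (N #>\<^bsub>F\<^esub> x) = N #>\<^bsub>F\<^esub> left_mult b x"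
proof -
  have NN: "n + m \<in> N" if "n \<in> N" "m \<in> N" for n m
    using subgroup.m_closed[OF subgroup_N that] by (simp add: F_simps)
  have N0: "0 \<in> N" using subgroup.one_closed[OF subgroup_N] by (simp add: F_simps)
  have "(N #>\<^bsub>F\<^esub> left_mult b x) = {n + left_mult b x | n. n \<in> N}"
    by (auto simp: r_coset_def F_simps(3))
  moreover have "b \<odot>\<^bsub>I\<^esub> (N #>\<^bsub>F\<^esub> x) = {n + left_mult b (m + x) | n m. n \<in> N \<and> m \<in> N}"
    by (auto simp: Ind_simps(4) set_mult_def r_coset_def F_simps(3))
  moreover have "\<dots> = {n + left_mult b x | n. n \<in> N}"
  proof (intro equalityI subsetI)
    fix y assume "y \<in> {n + left_mult b (m + x) | n m. n \<in> N \<and> m \<in> N}"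
    then obtain n m where *: "y = n + left_mult b (m + x)" "n \<in> N" "m \<in> N" by blast
    then have "y = (n + left_mult b m) + left_mult b x" by (simp add: frag_extend_add add.assoc)
    moreover have "n + left_mult b m \<in> N" using * NN left_mult_N[OF b] by blast
    ultimately show "y \<in> {n + left_mult b x | n. n \<in> N}" by blast
  next
    fix y assume "y \<in> {n + left_mult b x | n. n \<in> N}"
    then obtain n where "y = n + left_mult b (0 + x)" "n \<in> N" by auto
    then show "y \<in> {n + left_mult b (m + x) | n m. n \<in> N \<and> m \<in> N}" using N0 by blast
  qed
  ultimately show ?thesis by simp
qed

lemma smult_tens:
  "b \<in> carrier B \<Longrightarrow> b' \<in> carrier B \<Longrightarrow> v \<in> carrier M \<Longrightarrow> b \<odot>\<^bsub>I\<^esub> tens b' v = tens (b \<otimes>\<^bsub>B\<^esub> b') v"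
  unfolding tens_def by (simp add: smult_coset F_closed)

lemma Ind_smult_closed:
  assumes "b \<in> carrier B" "C \<in> carrier I"
  shows "b \<odot>\<^bsub>I\<^esub> C \<in> carrier I"
proof -
  obtain x where "x \<in> carrier F" "C = N #>\<^bsub>F\<^esub> x" using assms(2) by (auto simp: Ind_simps)
  then show ?thesis using assms(1) by (simp add: smult_coset coset_closed left_mult_closed)
qed

lemma Ind_smult_add:
  assumes b: "b \<in> carrier B" and "C \<in> carrier I" "D \<in> carrier I"
  shows "b \<odot>\<^bsub>I\<^esub> (C \<oplus>\<^bsub>I\<^esub> D) = b \<odot>\<^bsub>I\<^esub> C \<oplus>\<^bsub>I\<^esub> b \<odot>\<^bsub>I\<^esub> D"
proof -
  obtain x where x: "x \<in> carrier F" "C = N #>\<^bsub>F\<^esub> x" using assms(2) by (auto simp: Ind_simps)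
  obtain y where y: "y \<in> carrier F" "D = N #>\<^bsub>F\<^esub> y" using assms(3) by (auto simp: Ind_simps)
  show ?thesis
    unfolding x(2) y(2) using x(1) y(1) b
    by (simp add: coset_add smult_coset F_closed left_mult_closed frag_extend_add)
qed

lemma left_module_Ind: "left_module B I"
proof (intro left_module.intro left_module_axioms.intro B.ring_axioms abelian_group_Ind)
  fix a b C assume ab: "a \<in> carrier B" "b \<in> carrier B" and C: "C \<in> carrier I"
  show "a \<odot>\<^bsub>I\<^esub> C \<in> carrier I" using ab(1) C by (rule Ind_smult_closed)
  show "(a \<oplus>\<^bsub>B\<^esub> b) \<odot>\<^bsub>I\<^esub> C = a \<odot>\<^bsub>I\<^esub> C \<oplus>\<^bsub>I\<^esub> b \<odot>\<^bsub>I\<^esub> C"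
  proof (rule Ind_ext[OF abelian_group_Ind _ _ _ _ _ C])
    fix C D assume CD: "C \<in> carrier I" "D \<in> carrier I"
    show "a \<odot>\<^bsub>I\<^esub> (C \<oplus>\<^bsub>I\<^esub> D) \<oplus>\<^bsub>I\<^esub> b \<odot>\<^bsub>I\<^esub> (C \<oplus>\<^bsub>I\<^esub> D) =
      (a \<odot>\<^bsub>I\<^esub> C \<oplus>\<^bsub>I\<^esub> b \<odot>\<^bsub>I\<^esub> C) \<oplus>\<^bsub>I\<^esub> (a \<odot>\<^bsub>I\<^esub> D \<oplus>\<^bsub>I\<^esub> b \<odot>\<^bsub>I\<^esub> D)"
      using ab CD by (simp add: Ind_smult_add Ind.a_ac Ind_smult_closed)
    show "(a \<oplus>\<^bsub>B\<^esub> b) \<odot>\<^bsub>I\<^esub> (C \<oplus>\<^bsub>I\<^esub> D) = (a \<oplus>\<^bsub>B\<^esub> b) \<odot>\<^bsub>I\<^esub> C \<oplus>\<^bsub>I\<^esub> (a \<oplus>\<^bsub>B\<^esub> b) \<odot>\<^bsub>I\<^esub> D"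
      using ab CD by (simp add: Ind_smult_add)
  next
    fix c v assume "c \<in> carrier B" "v \<in> carrier M"
    then show "(a \<oplus>\<^bsub>B\<^esub> b) \<odot>\<^bsub>I\<^esub> tens c v = a \<odot>\<^bsub>I\<^esub> tens c v \<oplus>\<^bsub>I\<^esub> b \<odot>\<^bsub>I\<^esub> tens c v"
      using ab by (simp add: smult_tens B.l_distr tens_add_left)
  qed (use ab in \<open>auto intro!: Ind_smult_closed\<close>)
  show "(a \<otimes>\<^bsub>B\<^esub> b) \<odot>\<^bsub>I\<^esub> C = a \<odot>\<^bsub>I\<^esub> (b \<odot>\<^bsub>I\<^esub> C)"
    by (rule Ind_ext[OF abelian_group_Ind _ _ _ _ _ C])
      (use ab in \<open>auto simp: Ind_smult_add Ind_smult_closed smult_tens B.m_assoc\<close>)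
next
  fix C assume C: "C \<in> carrier I"
  show "\<one>\<^bsub>B\<^esub> \<odot>\<^bsub>I\<^esub> C = C"
    by (rule Ind_ext[OF abelian_group_Ind _ _ _ _ _ C])
      (auto simp: Ind_smult_add Ind_smult_closed smult_tens)
qed (rule Ind_smult_add)

end

section \<open>Restriction of scalars\<close>

lemma Res_simps:
  "carrier (Res A \<phi> M) = carrier M" "\<zero>\<^bsub>Res A \<phi> M\<^esub> = \<zero>\<^bsub>M\<^esub>"
  "v \<oplus>\<^bsub>Res A \<phi> M\<^esub> w = v \<oplus>\<^bsub>M\<^esub> w"
  "a \<in> carrier A \<Longrightarrow> v \<in> carrier M \<Longrightarrow> a \<odot>\<^bsub>Res A \<phi> M\<^esub> v = \<phi> a \<odot>\<^bsub>M\<^esub> v"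
  by (simp_all add: Res_def)

lemma left_module_Res:
  assumes "ring A" "left_module R M" and h: "\<phi> \<in> ring_hom A R"
  shows "left_module A (Res A \<phi> M)"
proof -
  interpret A: ring A by fact
  interpret M: left_module R M by fact
  have "comm_group (add_monoid (Res A \<phi> M))"
    by (rule comm_groupI) (auto simp: Res_simps M.M.a_ac intro: M.M.a_inv_closed M.M.l_neg)
  then have ab: "abelian_group (Res A \<phi> M)"
    by (simp add: abelian_group_def abelian_monoid_def abelian_group_axioms_def comm_group_def)
  note hs = ring_hom_closed[OF h] ring_hom_add[OF h] ring_hom_mult[OF h] ring_hom_one[OF h]
  show ?thesis
    by (intro left_module.intro left_module_axioms.intro A.ring_axioms ab)
      (simp_all add: Res_simps hs M.smult_closed M.smult_l_distr M.smult_r_distr M.smult_assoc M.smult_one)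
qed

section \<open>Root systems\<close>

lemma additive_zsmult: "additive f \<Longrightarrow> f (zsmult n x) = zsmult n (f x)"
  by (simp add: zsmult_def additive.sum additive.minus)

lemma zsmult_int: "zsmult n (m::int) = n * m"
  by (simp add: zsmult_def)

lemma zsmult_two: "zsmult 2 x = x + x"
proof -
  have "zsmult (1 + 1) x = zsmult 1 x + zsmult 1 x" by (rule zmod.scale_left_distrib)
  then show ?thesis by simp
qed

lemma reflection_word_simps [simp]:
  "reflection_word D [] = id"
  "reflection_word D (\<alpha> # \<alpha>s) = reflection D \<alpha> \<circ> reflection_word D \<alpha>s"
  by (simp_all add: reflection_word_def)

lemma reflection_word_append:
  "reflection_word D (\<alpha>s @ \<beta>s) = reflection_word D \<alpha>s \<circ> reflection_word D \<beta>s"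
  by (induction \<alpha>s) (simp_all add: comp_assoc)

locale based_root_datum =
  fixes D :: "('x::ab_group_add, 'y::ab_group_add) root_datum"
  assumes datum: "reduced_based_root_datum D"
begin

abbreviation "p \<equiv> pairing D"
abbreviation "s \<equiv> reflection D"
abbreviation "W \<equiv> weyl_group D"
abbreviation "root_span \<equiv> zmod.span (roots D)"

lemma rd: "root_datum D" "reduced D" "base D"
  using datum by (auto simp: reduced_based_root_datum_def)

lemma pairing_additive: "additive (p x)" "additive (\<lambda>x. p x y)"
  using rd(1) by (simp_all add: root_datum_def perfect_pairing_def)

lemmas pairing_right = additive.add[OF pairing_additive(1)] additive.diff[OF pairing_additive(1)]
  additive_zsmult[OF pairing_additive(1), unfolded zsmult_int]
lemmas pairing_left = additive.add[OF pairing_additive(2)] additive.diff[OF pairing_additive(2)]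
  additive.minus[OF pairing_additive(2)]
  additive_zsmult[OF pairing_additive(2), unfolded zsmult_int]

lemma finite_roots: "finite (roots D)"
  using rd(1) by (simp add: root_datum_def)

lemma pairing_coroot: "\<alpha> \<in> roots D \<Longrightarrow> p \<alpha> (coroot D \<alpha>) = 2"
  using rd(1) by (simp add: root_datum_def)

lemma reflection_roots: "\<alpha> \<in> roots D \<Longrightarrow> s \<alpha> ` roots D = roots D"
  using rd(1) by (simp add: root_datum_def)

lemma reflection_root: "\<alpha> \<in> roots D \<Longrightarrow> \<beta> \<in> roots D \<Longrightarrow> s \<alpha> \<beta> \<in> roots D"
  using reflection_roots by blast

lemma coreflection_coroots:
  "\<alpha> \<in> roots D \<Longrightarrow> coreflection D \<alpha> ` (coroot D ` roots D) = coroot D ` roots D"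
  using rd(1) by (simp add: root_datum_def)

text \<open>Pairing with the coroot of \<alpha> gives 2 n = 0.\<close>

lemma zsmult_root_eq_0: "\<alpha> \<in> roots D \<Longrightarrow> zsmult n \<alpha> = 0 \<Longrightarrow> n = 0"
  using pairing_left(4)[of n \<alpha> "coroot D \<alpha>"] pairing_coroot[of \<alpha>]
    additive.zero[OF pairing_additive(2)] by simp

lemma root_nonzero: "0 \<notin> roots D"
  using zsmult_root_eq_0[of 0 1] by auto

lemma additive_reflection: "additive (s \<alpha>)"
  by (rule additive.intro) (simp add: reflection_def pairing_left zmod.scale_left_distrib algebra_simps)

lemmas reflection_additive = additive.add[OF additive_reflection] additive.diff[OF additive_reflection]
  additive.minus[OF additive_reflection] additive_zsmult[OF additive_reflection]

lemma reflection_self: "\<alpha> \<in> roots D \<Longrightarrow> s \<alpha> \<alpha> = - \<alpha>"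
  by (simp add: reflection_def pairing_coroot zsmult_two)

lemma reflection_reflection: "\<alpha> \<in> roots D \<Longrightarrow> s \<alpha> (s \<alpha> x) = x"
proof -
  assume \<alpha>: "\<alpha> \<in> roots D"
  have "s \<alpha> (s \<alpha> x) = s \<alpha> x - zsmult (p x (coroot D \<alpha>)) (s \<alpha> \<alpha>)"
    by (subst (2) reflection_def) (simp only: reflection_additive)
  also have "\<dots> = x" unfolding reflection_self[OF \<alpha>] by (simp add: reflection_def)
  finally show ?thesis .
qed

lemma reflection_involution: "\<alpha> \<in> roots D \<Longrightarrow> s \<alpha> \<circ> s \<alpha> = id"
  by (rule ext) (simp add: reflection_reflection)

lemma root_uminus: "\<alpha> \<in> roots D \<Longrightarrow> - \<alpha> \<in> roots D"
  using reflection_root[of \<alpha> \<alpha>] reflection_self by simp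

lemma pairing_reflection: "p (s \<alpha> x) y = p x (coreflection D \<alpha> y)"
  by (simp add: reflection_def coreflection_def pairing_left pairing_right)

text \<open>The usual reflection-invariant form, a sum over coroots and hence positive semidefinite
  and integral. It is positive on roots, because the coroot of a root contributes 4.\<close>

definition inv_form :: "'x \<Rightarrow> 'x \<Rightarrow> int" where
  "inv_form x x' = (\<Sum>y\<in>coroot D ` roots D. p x y * p x' y)"

lemma inv_form_additive: "additive (inv_form x)"
  by (rule additive.intro) (simp add: inv_form_def pairing_left algebra_simps sum.distrib)

lemma inv_form_sym: "inv_form x y = inv_form y x"
  by (simp add: inv_form_def mult.commute)

lemmas inv_form_right = additive.diff[OF inv_form_additive] additive.minus[OF inv_form_additive]
  additive_zsmult[OF inv_form_additive, unfolded zsmult_int] additive.sum[OF inv_form_additive]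

text \<open>The coreflection maps the finite set of coroots onto itself, hence permutes it, and the
  sum is reindexed.\<close>

lemma inv_form_reflection:
  assumes "\<alpha> \<in> roots D"
  shows "inv_form (s \<alpha> x) (s \<alpha> x') = inv_form x x'"
proof -
  have "inj_on (coreflection D \<alpha>) (coroot D ` roots D)"
    using coreflection_coroots[OF assms] finite_roots by (simp add: eq_card_imp_inj_on)
  then have "(\<Sum>y\<in>coreflection D \<alpha> ` (coroot D ` roots D). p x y * p x' y) =
      (\<Sum>y\<in>coroot D ` roots D. p x (coreflection D \<alpha> y) * p x' (coreflection D \<alpha> y))"
    by (simp add: sum.reindex)
  then show ?thesis
    unfolding inv_form_def pairing_reflection coreflection_coroots[OF assms] by simp
qed

text \<open>The classical formula expressing the pairing with a coroot as 2 (x, \<alpha>) /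
  (\<alpha>, \<alpha>), cleared of denominators. It follows by applying invariance to \<alpha>,
  which its reflection negates.\<close>

lemma inv_form_root:
  assumes "\<alpha> \<in> roots D"
  shows "2 * inv_form x \<alpha> = p x (coroot D \<alpha>) * inv_form \<alpha> \<alpha>"
proof -
  have "inv_form (s \<alpha> x) \<alpha> = - inv_form x \<alpha>"
    using inv_form_reflection[OF assms, of x "- \<alpha>"] reflection_self[OF assms]
    by (simp add: reflection_additive inv_form_right)
  then have "inv_form \<alpha> (s \<alpha> x) = - inv_form \<alpha> x" by (simp add: inv_form_sym)
  then show ?thesis by (simp add: reflection_def inv_form_right inv_form_sym)
qed

lemma inv_form_root_pos:
  assumes "\<alpha> \<in> roots D"
  shows "inv_form \<alpha> \<alpha> > 0"
proof -
  have "p \<alpha> (coroot D \<alpha>) * p \<alpha> (coroot D \<alpha>) \<le> inv_form \<alpha> \<alpha>"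
    unfolding inv_form_def using assms finite_roots
    by (intro member_le_sum[where f = "\<lambda>y. p \<alpha> y * p \<alpha> y"]) auto
  then show ?thesis using pairing_coroot[OF assms] by simp
qed

text \<open>The axioms of a root datum do not say that reflections commute with \<open>coroot\<close>; the invariant
  form gives it after pairing with any weight.\<close>

lemma pairing_coroot_reflection:
  assumes "\<alpha> \<in> roots D" "\<beta> \<in> roots D"
  shows "p x (coroot D (s \<alpha> \<beta>)) = p (s \<alpha> x) (coroot D \<beta>)"
proof -
  have "inv_form x (s \<alpha> \<beta>) = inv_form (s \<alpha> x) \<beta>"
    using inv_form_reflection[OF assms(1), of "s \<alpha> x" \<beta>] reflection_reflection[OF assms(1)] by simp
  then have "p x (coroot D (s \<alpha> \<beta>)) * inv_form (s \<alpha> \<beta>) (s \<alpha> \<beta>) = p (s \<alpha> x) (coroot D \<beta>) * inv_form \<beta> \<beta>"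
    using inv_form_root[OF reflection_root[OF assms], of x] inv_form_root[OF assms(2), of "s \<alpha> x"] by simp
  then show ?thesis
    using inv_form_reflection[OF assms(1), of \<beta> \<beta>] inv_form_root_pos[OF assms(2)] by simp
qed

text \<open>The coroot of \<open>s \<alpha> \<beta>\<close> enters a reflection only through its
  pairings, so \<open>pairing_coroot_reflection\<close> suffices.\<close>

lemma reflection_conjugate:
  assumes "\<alpha> \<in> roots D" "\<beta> \<in> roots D"
  shows "s (s \<alpha> \<beta>) = s \<alpha> \<circ> s \<beta> \<circ> s \<alpha>"
proof
  fix x
  have "s \<alpha> (s \<beta> (s \<alpha> x)) = x - zsmult (p (s \<alpha> x) (coroot D \<beta>)) (s \<alpha> \<beta>)"
    unfolding reflection_def[of D \<beta>] reflection_additive(2,4) reflection_reflection[OF assms(1)] ..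
  then show "s (s \<alpha> \<beta>) x = (s \<alpha> \<circ> s \<beta> \<circ> s \<alpha>) x"
    unfolding reflection_def[of D "s \<alpha> \<beta>"] pairing_coroot_reflection[OF assms] by simp
qed

text \<open>Conjugation of \<open>s \<alpha>\<close> by itself, since
  \<open>s \<alpha> \<alpha>\<close> is \<open>- \<alpha>\<close>.\<close>

lemma reflection_uminus: "\<alpha> \<in> roots D \<Longrightarrow> s (- \<alpha>) = s \<alpha>"
  using reflection_conjugate[of \<alpha> \<alpha>] reflection_self[of \<alpha>] reflection_reflection[of \<alpha>] by auto

subsection \<open>Positive roots\<close>

abbreviation comb :: "('x \<Rightarrow> int) \<Rightarrow> 'x" where
  "comb c \<equiv> (\<Sum>\<alpha>\<in>simple_roots D. zsmult (c \<alpha>) \<alpha>)"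

lemma simple_root: "\<alpha> \<in> simple_roots D \<Longrightarrow> \<alpha> \<in> roots D"
  using rd(3) by (auto simp: base_def)

lemma finite_simple_roots: "finite (simple_roots D)"
  using rd(3) finite_roots by (auto simp: base_def intro: finite_subset)

lemma comb_unique:
  assumes "comb c = comb d" "\<alpha> \<in> simple_roots D"
  shows "c \<alpha> = d \<alpha>"
proof -
  have "(\<Sum>\<alpha>\<in>simple_roots D. zsmult (c \<alpha> - d \<alpha>) \<alpha>) = 0"
    using assms(1) by (simp add: zmod.scale_left_diff_distrib sum_subtractf)
  moreover have "\<not> zmod.dependent (simple_roots D)" using rd(3) by (simp add: base_def)
  ultimately have "c \<alpha> - d \<alpha> = 0"
    using zmod.independentD[of "simple_roots D" "simple_roots D" "\<lambda>\<alpha>. c \<alpha> - d \<alpha>" \<alpha>] assms(2)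
      finite_simple_roots by blast
  then show ?thesis by simp
qed

text \<open>With k the pairing of the combination with the coroot of \<alpha>, this is the effect of
  a simple reflection on coordinates: only one of them changes.\<close>

lemma comb_update:
  assumes "\<alpha> \<in> simple_roots D"
  shows "comb (c(\<alpha> := c \<alpha> - k)) = comb c - zsmult k \<alpha>"
proof -
  have "comb (c(\<alpha> := c \<alpha> - k)) = zsmult (c \<alpha> - k) \<alpha> + (\<Sum>\<gamma>\<in>simple_roots D - {\<alpha>}. zsmult (c \<gamma>) \<gamma>)"
    using assms finite_simple_roots by (simp add: sum.remove[of _ \<alpha>])
  also have "\<dots> = comb c - zsmult k \<alpha>"
    using assms finite_simple_roots
    by (simp add: sum.remove[of _ \<alpha>] zmod.scale_left_diff_distrib)
  finally show ?thesis .
qed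

lemma comb_single:
  assumes "\<alpha> \<in> simple_roots D" "\<And>\<gamma>. \<gamma> \<in> simple_roots D \<Longrightarrow> \<gamma> \<noteq> \<alpha> \<Longrightarrow> c \<gamma> = 0"
  shows "comb c = zsmult (c \<alpha>) \<alpha>"
  using assms finite_simple_roots by (simp add: sum.remove[of _ \<alpha>])

definition pos :: "'x \<Rightarrow> bool" where
  "pos \<beta> \<longleftrightarrow> \<beta> \<in> roots D \<and> (\<exists>c. (\<forall>\<alpha>. 0 \<le> c \<alpha>) \<and> \<beta> = comb c)"

lemma pos_cases:
  assumes "\<beta> \<in> roots D"
  shows "pos \<beta> \<or> pos (- \<beta>)"
proof -
  obtain c :: "'x \<Rightarrow> nat" where c: "\<beta> = comb (\<lambda>\<alpha>. int (c \<alpha>)) \<or> \<beta> = - comb (\<lambda>\<alpha>. int (c \<alpha>))"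
    using rd(3) assms unfolding base_def by blast
  from c show ?thesis
  proof
    assume "\<beta> = comb (\<lambda>\<alpha>. int (c \<alpha>))"
    then have "pos \<beta>" unfolding pos_def using assms by (intro conjI exI[of _ "\<lambda>\<alpha>. int (c \<alpha>)"]) auto
    then show ?thesis ..
  next
    assume "\<beta> = - comb (\<lambda>\<alpha>. int (c \<alpha>))"
    then have "pos (- \<beta>)"
      unfolding pos_def using root_uminus[OF assms] by (intro conjI exI[of _ "\<lambda>\<alpha>. int (c \<alpha>)"]) auto
    then show ?thesis ..
  qed
qed

lemma pos_uminus:
  assumes "\<beta> \<in> roots D"
  shows "pos (- \<beta>) \<longleftrightarrow> \<not> pos \<beta>"
proof -
  have "\<not> (pos \<beta> \<and> pos (- \<beta>))"
  proof
    assume "pos \<beta> \<and> pos (- \<beta>)"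
    then obtain c d where c: "\<And>\<alpha>. 0 \<le> c \<alpha>" "\<beta> = comb c" and d: "\<And>\<alpha>. 0 \<le> d \<alpha>" "- \<beta> = comb d"
      unfolding pos_def by blast
    have "comb c + comb d = 0" using c d by (metis add.right_inverse)
    then have "comb (\<lambda>\<alpha>. c \<alpha> + d \<alpha>) = comb (\<lambda>\<alpha>. 0)"
      by (simp add: zmod.scale_left_distrib sum.distrib)
    then have "c \<alpha> + d \<alpha> = 0" if "\<alpha> \<in> simple_roots D" for \<alpha>
      using comb_unique[of "\<lambda>\<alpha>. c \<alpha> + d \<alpha>" "\<lambda>\<alpha>. 0"] that by simp
    then have "c \<alpha> = 0" if "\<alpha> \<in> simple_roots D" for \<alpha>
      using c(1)[of \<alpha>] d(1)[of \<alpha>] that by fastforce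
    then have "\<beta> = 0" unfolding c(2) by simp
    then show False using assms root_nonzero by simp
  qed
  then show ?thesis using pos_cases[OF assms] by blast
qed

lemma pos_simple: "\<alpha> \<in> simple_roots D \<Longrightarrow> pos \<alpha>"
  unfolding pos_def using comb_single[of \<alpha> "\<lambda>\<gamma>. if \<gamma> = \<alpha> then 1 else 0"] simple_root
  by (intro conjI exI[of _ "\<lambda>\<gamma>. if \<gamma> = \<alpha> then 1 else 0"]) auto

text \<open>The reflection changes only the \<alpha>-coordinate. If the image were negative, all
  other coordinates of \<beta> would be both nonnegative and nonpositive, so \<beta> would be a
  multiple of \<alpha>. Reducedness leaves \<beta> = - \<alpha>, which contradicts
  positivity.\<close>

lemma pos_simple_reflection:
  assumes "pos \<beta>" "\<alpha> \<in> simple_roots D" "\<beta> \<noteq> \<alpha>"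
  shows "pos (s \<alpha> \<beta>)"
proof (rule ccontr)
  obtain c where c: "\<And>\<gamma>. 0 \<le> c \<gamma>" "\<beta> = comb c" using assms(1) unfolding pos_def by blast
  have \<beta>: "\<beta> \<in> roots D" and \<alpha>: "\<alpha> \<in> roots D" using assms(1,2) simple_root by (auto simp: pos_def)
  assume "\<not> pos (s \<alpha> \<beta>)"
  then have "pos (- s \<alpha> \<beta>)" using pos_uminus[OF reflection_root[OF \<alpha> \<beta>]] by simp
  then obtain d where d: "\<And>\<gamma>. 0 \<le> d \<gamma>" "- s \<alpha> \<beta> = comb d" unfolding pos_def by blast
  define k where "k = p \<beta> (coroot D \<alpha>)"
  have "comb (\<lambda>\<gamma>. - d \<gamma>) = s \<alpha> \<beta>" using arg_cong[OF d(2), of uminus] by (simp add: sum_negf)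
  also have "\<dots> = comb (c(\<alpha> := c \<alpha> - k))"
    unfolding comb_update[OF assms(2)] k_def c(2)[symmetric] by (simp add: reflection_def)
  finally have eq: "comb (\<lambda>\<gamma>. - d \<gamma>) = comb (c(\<alpha> := c \<alpha> - k))" .
  have "c \<gamma> = 0" if "\<gamma> \<in> simple_roots D" "\<gamma> \<noteq> \<alpha>" for \<gamma>
    using comb_unique[OF eq that(1)] that(2) c(1)[of \<gamma>] d(1)[of \<gamma>] by simp
  then have \<beta>c: "\<beta> = zsmult (c \<alpha>) \<alpha>" unfolding c(2) using comb_single[OF assms(2)] by blast
  then have "c \<alpha> \<noteq> 0" using \<beta> root_nonzero by auto
  then have "\<beta> = \<alpha> \<or> \<beta> = - \<alpha>"
    using rd(2) \<alpha> \<beta> \<beta>c unfolding reduced_def by (metis zero_neq_one zmod.scale_one)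
  then have "zsmult (c \<alpha> + 1) \<alpha> = 0" using assms(3) \<beta>c by (simp add: zmod.scale_left_distrib)
  then have "c \<alpha> + 1 = 0" using zsmult_root_eq_0[OF \<alpha>] by blast
  then show False using c(1)[of \<alpha>] by simp
qed

text \<open>Induction on the height, the sum of the coordinates. Expanding (\<beta>, \<beta>) > 0
  along the base gives a simple \<alpha> with (\<beta>, \<alpha>) > 0. Unless \<beta> = \<alpha>,
  reflecting in \<alpha> yields a positive root of smaller height, whose reflection is conjugate to
  that of \<beta>.\<close>

lemma pos_reflection_simple_word:
  assumes "pos \<beta>"
  shows "\<exists>\<alpha>s. set \<alpha>s \<subseteq> simple_roots D \<and> s \<beta> = reflection_word D \<alpha>s"
proof -
  have "\<exists>\<alpha>s. set \<alpha>s \<subseteq> simple_roots D \<and> s \<beta> = reflection_word D \<alpha>s"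
    if "\<beta> \<in> roots D" "\<And>\<gamma>. 0 \<le> c \<gamma>" "\<beta> = comb c" "nat (sum c (simple_roots D)) = n" for n \<beta> c
    using that
  proof (induction n arbitrary: \<beta> c rule: less_induct)
    case (less n)
    have "inv_form \<beta> \<beta> = (\<Sum>\<alpha>\<in>simple_roots D. c \<alpha> * inv_form \<beta> \<alpha>)"
      by (subst (2) less.prems(3)) (simp add: inv_form_right)
    then have "0 < (\<Sum>\<alpha>\<in>simple_roots D. c \<alpha> * inv_form \<beta> \<alpha>)"
      using inv_form_root_pos[OF less.prems(1)] by simp
    then obtain \<alpha> where \<alpha>: "\<alpha> \<in> simple_roots D" "c \<alpha> * inv_form \<beta> \<alpha> > 0"
      by (meson not_le sum_nonpos)
    then have form: "inv_form \<beta> \<alpha> > 0" using less.prems(2)[of \<alpha>] by (simp add: zero_less_mult_iff)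
    have \<alpha>R: "\<alpha> \<in> roots D" using \<alpha>(1) by (rule simple_root)
    define k where "k = p \<beta> (coroot D \<alpha>)"
    \<comment> \<open>The pairing \<open>k\<close> has the sign of the form, so the reflection
      lowers the height by a positive amount.\<close>
    have "k * inv_form \<alpha> \<alpha> > 0" using form inv_form_root[OF \<alpha>R, of \<beta>] by (simp add: k_def)
    then have k: "k > 0" using inv_form_root_pos[OF \<alpha>R] by (simp add: zero_less_mult_iff)
    show ?case
    proof (cases "\<beta> = \<alpha>")
      case True
      then show ?thesis using \<alpha>(1) by (intro exI[of _ "[\<alpha>]"]) simp
    next
      case False
      have "pos \<beta>" unfolding pos_def using less.prems by blast
      then have "pos (s \<alpha> \<beta>)" using \<alpha>(1) False by (rule pos_simple_reflection)
      then obtain d where d: "\<And>\<gamma>. 0 \<le> d \<gamma>" "s \<alpha> \<beta> = comb d" and R: "s \<alpha> \<beta> \<in> roots D"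
        unfolding pos_def by blast
      have eq: "comb d = comb (c(\<alpha> := c \<alpha> - k))"
        unfolding comb_update[OF \<alpha>(1)] k_def d(2)[symmetric] less.prems(3)[symmetric]
        by (simp add: reflection_def)
      have "sum d (simple_roots D) = sum (c(\<alpha> := c \<alpha> - k)) (simple_roots D)"
        using comb_unique[OF eq] by (rule sum.cong[OF refl])
      also have "\<dots> = sum c (simple_roots D) - k"
        using \<alpha>(1) finite_simple_roots by (simp add: sum.remove[of _ \<alpha>])
      finally have "sum d (simple_roots D) < sum c (simple_roots D)" using k by simp
      moreover have "0 \<le> sum d (simple_roots D)" using d(1) by (simp add: sum_nonneg)
      ultimately have "nat (sum d (simple_roots D)) < n" using less.prems(4) by simp
      then obtain \<alpha>s where \<alpha>s: "set \<alpha>s \<subseteq> simple_roots D" "s (s \<alpha> \<beta>) = reflection_word D \<alpha>s"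
        using less.IH[OF _ R d refl] by blast
      have "s \<beta> = s \<alpha> \<circ> s (s \<alpha> \<beta>) \<circ> s \<alpha>"
        using reflection_conjugate[OF \<alpha>R R] reflection_reflection[OF \<alpha>R] by simp
      then have "s \<beta> = reflection_word D (\<alpha> # \<alpha>s @ [\<alpha>])"
        by (simp add: \<alpha>s(2) reflection_word_append comp_assoc)
      then show ?thesis using \<alpha>s(1) \<alpha>(1) by (intro exI[of _ "\<alpha> # \<alpha>s @ [\<alpha>]"]) simp
    qed
  qed
  then show ?thesis using assms unfolding pos_def by blast
qed

text \<open>\<open>weyl_group\<close> is defined by words in all roots, whereas lengths and the
  relations of the algebra refer to simple roots; this lemma passes from one to the other.\<close>

lemma weyl_simple_word:
  assumes "w \<in> W"
  obtains \<alpha>s where "set \<alpha>s \<subseteq> simple_roots D" "w = reflection_word D \<alpha>s"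
proof -
  have one: "\<exists>\<alpha>s. set \<alpha>s \<subseteq> simple_roots D \<and> s \<beta> = reflection_word D \<alpha>s" if "\<beta> \<in> roots D" for \<beta>
    using pos_cases[OF that] pos_reflection_simple_word[of \<beta>] pos_reflection_simple_word[of "- \<beta>"]
      reflection_uminus[OF that] by auto
  have "\<exists>\<alpha>s. set \<alpha>s \<subseteq> simple_roots D \<and> reflection_word D \<beta>s = reflection_word D \<alpha>s"
    if "set \<beta>s \<subseteq> roots D" for \<beta>s
    using that
  proof (induction \<beta>s)
    case Nil
    show ?case by (intro exI[of _ "[]"]) simp
  next
    case (Cons \<beta> \<beta>s)
    then obtain \<alpha>s where \<alpha>s: "set \<alpha>s \<subseteq> simple_roots D" "reflection_word D \<beta>s = reflection_word D \<alpha>s" by auto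
    obtain \<gamma>s where \<gamma>s: "set \<gamma>s \<subseteq> simple_roots D" "s \<beta> = reflection_word D \<gamma>s"
      using one[of \<beta>] Cons.prems by auto
    show ?case using \<alpha>s \<gamma>s
      by (intro exI[of _ "\<gamma>s @ \<alpha>s"]) (simp add: reflection_word_append)
  qed
  then show ?thesis using assms that unfolding weyl_group_def by blast
qed

subsection \<open>The Weyl group and its length function\<close>

lemma weyl_id: "id \<in> W"
  unfolding weyl_group_def by (intro CollectI exI[of _ "[]"]) simp

lemma weyl_comp: "v \<in> W \<Longrightarrow> w \<in> W \<Longrightarrow> v \<circ> w \<in> W"
proof -
  assume "v \<in> W" "w \<in> W"
  then obtain \<alpha>s \<beta>s where "set \<alpha>s \<subseteq> roots D" "v = reflection_word D \<alpha>s"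
    "set \<beta>s \<subseteq> roots D" "w = reflection_word D \<beta>s" unfolding weyl_group_def by blast
  then show "v \<circ> w \<in> W"
    unfolding weyl_group_def by (intro CollectI exI[of _ "\<alpha>s @ \<beta>s"]) (simp add: reflection_word_append)
qed

lemma weyl_reflection: "\<alpha> \<in> roots D \<Longrightarrow> s \<alpha> \<in> W"
  unfolding weyl_group_def by (intro CollectI exI[of _ "[\<alpha>]"]) simp

lemma weyl_word: "set \<alpha>s \<subseteq> simple_roots D \<Longrightarrow> reflection_word D \<alpha>s \<in> W"
  unfolding weyl_group_def using simple_root by blast

lemma weyl_induct [consumes 1, case_names id step]:
  assumes "w \<in> W" "P id"
    and "\<And>\<alpha> w. \<alpha> \<in> roots D \<Longrightarrow> w \<in> W \<Longrightarrow> P w \<Longrightarrow> P (s \<alpha> \<circ> w)"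
  shows "P w"
proof -
  have "P (reflection_word D \<alpha>s)" if "set \<alpha>s \<subseteq> roots D" for \<alpha>s
    using that
  proof (induction \<alpha>s)
    case (Cons \<alpha> \<alpha>s)
    then have "reflection_word D \<alpha>s \<in> W" unfolding weyl_group_def by auto
    then show ?case unfolding reflection_word_simps by (rule assms(3)[rotated]) (use Cons in auto)
  qed (use assms(2) in simp)
  then show ?thesis using assms(1) unfolding weyl_group_def by blast
qed

text \<open>The Weyl group acts trivially on X modulo the root lattice. This is why the factors T w
  do not affect degrees.\<close>

lemma weyl_diff_span: "w \<in> W \<Longrightarrow> w x - x \<in> root_span"
proof (induction w rule: weyl_induct)
  case id
  show ?case by (simp add: zmod.span_zero)
next
  case (step \<alpha> w)
  have "(w x - x) - zsmult (p (w x) (coroot D \<alpha>)) \<alpha> \<in> root_span"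
    by (intro zmod.span_diff zmod.span_scale step zmod.span_base)
  then show ?case by (simp add: reflection_def algebra_simps)
qed

lemma weyl_root: "w \<in> W \<Longrightarrow> \<beta> \<in> roots D \<Longrightarrow> w \<beta> \<in> roots D"
  by (induction w rule: weyl_induct) (auto intro: reflection_root)

lemma weyl_uminus: "w \<in> W \<Longrightarrow> w (- x) = - w x"
  by (induction w rule: weyl_induct) (simp_all add: reflection_additive)

text \<open>Classically equal to the length; only the parities are compared here.\<close>

definition inversions :: "('x \<Rightarrow> 'x) \<Rightarrow> nat" where
  "inversions w = card {\<beta>. pos \<beta> \<and> \<not> pos (w \<beta>)}"

text \<open>Since \<open>s \<alpha>\<close> permutes the positive roots other than \<alpha>, the
  inversions of w and of \<open>w \<circ> s \<alpha>\<close> away from \<alpha> correspond. At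
  \<alpha> itself the sign is reversed.\<close>

lemma even_inversions_simple:
  assumes w: "w \<in> W" and \<alpha>: "\<alpha> \<in> simple_roots D"
  shows "even (inversions (w \<circ> s \<alpha>)) \<longleftrightarrow> odd (inversions w)"
proof -
  define P where "P v = {\<beta>. pos \<beta> \<and> \<beta> \<noteq> \<alpha> \<and> \<not> pos (v \<beta>)}" for v :: "'x \<Rightarrow> 'x"
  have \<alpha>R: "\<alpha> \<in> roots D" using \<alpha> by (rule simple_root)
  have fin: "finite {\<beta>. pos \<beta> \<and> Q \<beta>}" for Q
    using finite_roots by (rule rev_finite_subset) (auto simp: pos_def)
  have finP: "finite (P v)" for v unfolding P_def by (rule fin)
  have split: "inversions v = card (P v) + (if pos (v \<alpha>) then 0 else 1)" for v
  proof -
    have "{\<beta>. pos \<beta> \<and> \<not> pos (v \<beta>)} = (if pos (v \<alpha>) then P v else insert \<alpha> (P v))"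
      using pos_simple[OF \<alpha>] by (auto simp: P_def)
    moreover have "\<alpha> \<notin> P v" by (simp add: P_def)
    ultimately show ?thesis using finP by (simp add: inversions_def)
  qed
  have ne: "s \<alpha> \<beta> \<noteq> \<alpha>" if "pos \<beta>" for \<beta>
  proof
    assume "s \<alpha> \<beta> = \<alpha>"
    then have "\<beta> = - \<alpha>" using reflection_reflection[OF \<alpha>R, of \<beta>] reflection_self[OF \<alpha>R] by simp
    then show False using that pos_uminus[OF \<alpha>R] pos_simple[OF \<alpha>] by simp
  qed
  have "P (w \<circ> s \<alpha>) = s \<alpha> ` P w"
  proof (intro equalityI subsetI)
    fix \<beta> assume "\<beta> \<in> P (w \<circ> s \<alpha>)"
    then have "s \<alpha> \<beta> \<in> P w" using pos_simple_reflection[OF _ \<alpha>] ne by (simp add: P_def)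
    then show "\<beta> \<in> s \<alpha> ` P w" using reflection_reflection[OF \<alpha>R, of \<beta>] by (metis imageI)
  next
    fix \<beta> assume "\<beta> \<in> s \<alpha> ` P w"
    then show "\<beta> \<in> P (w \<circ> s \<alpha>)"
      using pos_simple_reflection[OF _ \<alpha>] ne reflection_reflection[OF \<alpha>R] by (auto simp: P_def)
  qed
  moreover have "inj_on (s \<alpha>) (P w)"
    by (rule inj_on_inverseI[of _ "s \<alpha>"]) (rule reflection_reflection[OF \<alpha>R])
  ultimately have "card (P (w \<circ> s \<alpha>)) = card (P w)" by (simp add: card_image)
  moreover have "pos ((w \<circ> s \<alpha>) \<alpha>) \<longleftrightarrow> \<not> pos (w \<alpha>)"
    using pos_uminus[OF weyl_root[OF w \<alpha>R]] by (simp add: reflection_self[OF \<alpha>R] weyl_uminus[OF w])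
  ultimately show ?thesis unfolding split by auto
qed

text \<open>Each letter flips the parity of \<open>inversions\<close>, so the parity of a word
  depends only on the element it represents. Letters are removed on the right because
  \<open>even_inversions_simple\<close> multiplies there.\<close>

lemma even_length_word:
  "set \<alpha>s \<subseteq> simple_roots D \<Longrightarrow> even (length \<alpha>s) \<longleftrightarrow> even (inversions (reflection_word D \<alpha>s))"
proof (induction \<alpha>s rule: rev_induct)
  case Nil
  have "{\<beta>. pos \<beta> \<and> \<not> pos \<beta>} = {}" by blast
  then show ?case by (simp add: inversions_def)
next
  case (snoc \<alpha> \<alpha>s)
  have eq: "reflection_word D (\<alpha>s @ [\<alpha>]) = reflection_word D \<alpha>s \<circ> s \<alpha>"
    by (rule ext) (simp add: reflection_word_append)
  have "even (length (\<alpha>s @ [\<alpha>])) \<longleftrightarrow> odd (inversions (reflection_word D \<alpha>s))"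
    using snoc by simp
  also have "\<dots> \<longleftrightarrow> even (inversions (reflection_word D \<alpha>s \<circ> s \<alpha>))"
    by (rule even_inversions_simple[OF weyl_word, symmetric]) (use snoc.prems in auto)
  finally show ?case unfolding eq .
qed

lemma weyl_length_word:
  assumes "w \<in> W"
  obtains \<alpha>s where "set \<alpha>s \<subseteq> simple_roots D" "length \<alpha>s = weyl_length D w" "reflection_word D \<alpha>s = w"
proof -
  have "\<exists>n. \<exists>\<alpha>s. set \<alpha>s \<subseteq> simple_roots D \<and> length \<alpha>s = n \<and> reflection_word D \<alpha>s = w"
    using weyl_simple_word[OF assms] by metis
  from LeastI_ex[OF this] show ?thesis unfolding weyl_length_def[symmetric] using that by blast
qed

lemma weyl_length_le:
  "set \<alpha>s \<subseteq> simple_roots D \<Longrightarrow> weyl_length D (reflection_word D \<alpha>s) \<le> length \<alpha>s"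
  unfolding weyl_length_def by (rule Least_le) blast

lemma even_weyl_length: "w \<in> W \<Longrightarrow> even (weyl_length D w) \<longleftrightarrow> even (inversions w)"
  using weyl_length_word even_length_word by metis

lemma weyl_length_simple_le:
  assumes "w \<in> W" "\<alpha> \<in> simple_roots D"
  shows "weyl_length D (s \<alpha> \<circ> w) \<le> weyl_length D w + 1"
proof -
  obtain \<alpha>s where "set \<alpha>s \<subseteq> simple_roots D" "length \<alpha>s = weyl_length D w" "reflection_word D \<alpha>s = w"
    using weyl_length_word[OF assms(1)] .
  then show ?thesis using weyl_length_le[of "\<alpha> # \<alpha>s"] assms(2) by simp
qed

text \<open>Prefixing a letter, in either direction, shows that the lengths differ by at most one,
  and parity excludes equality. The two cases decide whether T_s T_w is a basis element or has to be
  rewritten by the quadratic relation.\<close>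

lemma weyl_length_simple_cases:
  assumes w: "w \<in> W" and \<alpha>: "\<alpha> \<in> simple_roots D"
  shows "weyl_length D (s \<alpha> \<circ> w) = weyl_length D w + 1 \<or> weyl_length D w = weyl_length D (s \<alpha> \<circ> w) + 1"
proof -
  have \<alpha>R: "\<alpha> \<in> roots D" using \<alpha> by (rule simple_root)
  have sw: "s \<alpha> \<circ> w \<in> W" using weyl_comp[OF weyl_reflection[OF \<alpha>R] w] .
  obtain \<alpha>s where \<alpha>s: "set \<alpha>s \<subseteq> simple_roots D" "length \<alpha>s = weyl_length D w" "reflection_word D \<alpha>s = w"
    using weyl_length_word[OF w] .
  have "even (weyl_length D (s \<alpha> \<circ> w)) \<longleftrightarrow> even (length (\<alpha> # \<alpha>s))"
    using even_weyl_length[OF sw] even_length_word[of "\<alpha> # \<alpha>s"] \<alpha>s \<alpha> by simp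
  then have "weyl_length D (s \<alpha> \<circ> w) \<noteq> weyl_length D w" using \<alpha>s(2) by auto
  moreover have "weyl_length D (s \<alpha> \<circ> w) \<le> weyl_length D w + 1" using w \<alpha> by (rule weyl_length_simple_le)
  moreover have "s \<alpha> \<circ> (s \<alpha> \<circ> w) = w"
    using reflection_involution[OF \<alpha>R] by (simp add: comp_assoc[symmetric])
  then have "weyl_length D w \<le> weyl_length D (s \<alpha> \<circ> w) + 1" using weyl_length_simple_le[OF sw \<alpha>] by simp
  ultimately show ?thesis by linarith
qed

text \<open>Every tail of a reduced word is reduced, so in each step the length grows by exactly
  one. Precisely then the relations give T (s \<alpha> \<circ> w) as the product of T (s \<alpha>)
  and T w.\<close>

lemma weyl_length_induct [consumes 1, case_names id step]:
  assumes "w \<in> W" "P id"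
    and step: "\<And>\<alpha> w. \<alpha> \<in> simple_roots D \<Longrightarrow> w \<in> W \<Longrightarrow>
      weyl_length D (s \<alpha> \<circ> w) = weyl_length D w + 1 \<Longrightarrow> P w \<Longrightarrow> P (s \<alpha> \<circ> w)"
  shows "P w"
proof -
  have "P (reflection_word D \<alpha>s)"
    if "set \<alpha>s \<subseteq> simple_roots D" "length \<alpha>s = weyl_length D (reflection_word D \<alpha>s)" for \<alpha>s
    using that
  proof (induction \<alpha>s)
    case (Cons \<alpha> \<alpha>s)
    let ?w = "reflection_word D \<alpha>s"
    have \<alpha>: "\<alpha> \<in> simple_roots D" "set \<alpha>s \<subseteq> simple_roots D" using Cons.prems by auto
    have w: "?w \<in> W" using \<alpha>(2) by (rule weyl_word)
    have len: "length \<alpha>s + 1 = weyl_length D (s \<alpha> \<circ> ?w)"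
      using Cons.prems(2) by (simp only: reflection_word_simps list.size One_nat_def)
    have le: "weyl_length D ?w \<le> length \<alpha>s" using \<alpha>(2) by (rule weyl_length_le)
    have eq: "length \<alpha>s = weyl_length D ?w" using len le weyl_length_simple_le[OF w \<alpha>(1)] by linarith
    then have "P ?w" using Cons.IH \<alpha>(2) by blast
    moreover have "weyl_length D (s \<alpha> \<circ> ?w) = weyl_length D ?w + 1" using len eq by linarith
    ultimately show ?case unfolding reflection_word_simps by (intro step[OF \<alpha>(1) w])
  qed (simp add: assms(2))
  then show ?thesis using weyl_length_word[OF assms(1)] by metis
qed

lemma weyl_length_id: "weyl_length D id = 0"
  using weyl_length_le[of "[]"] by simp

lemma weyl_length_simple: "\<alpha> \<in> simple_roots D \<Longrightarrow> weyl_length D (s \<alpha>) = 1"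
  using weyl_length_simple_cases[OF weyl_id, of \<alpha>] by (simp add: weyl_length_id)

end

section \<open>Affine Hecke algebras\<close>

lemma complex_ring_simps [simp]:
  "carrier complex_ring = UNIV" "x \<oplus>\<^bsub>complex_ring\<^esub> y = x + y" "x \<otimes>\<^bsub>complex_ring\<^esub> y = x * y"
  "\<zero>\<^bsub>complex_ring\<^esub> = 0" "\<one>\<^bsub>complex_ring\<^esub> = 1"
  by (simp_all add: ring_of_type_algebra_def)

section \<open>Linear combinations and spans over the complex numbers\<close>

locale complex_module = left_module complex_ring K for K :: "(complex, 'k) module"
begin

lemma smult_closed' [simp]: "v \<in> carrier K \<Longrightarrow> c \<odot>\<^bsub>K\<^esub> v \<in> carrier K"
  by (rule smult_closed) simp

text \<open>Summing over the support matches the basis clause in the definition of the algebra. For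
  infinite support the value is zero by convention, so \<open>lincomb_closed\<close> holds for all
  coefficient functions.\<close>

definition lincomb :: "('i \<Rightarrow> 'k) \<Rightarrow> ('i \<Rightarrow> complex) \<Rightarrow> 'k" where
  "lincomb B c = finsum K (\<lambda>i. c i \<odot>\<^bsub>K\<^esub> B i) {i. c i \<noteq> 0}"

lemma smult_zero_complex [simp]: "v \<in> carrier K \<Longrightarrow> 0 \<odot>\<^bsub>K\<^esub> v = \<zero>\<^bsub>K\<^esub>"
  using smult_l_null[of v] by simp

lemma smult_one_complex [simp]: "v \<in> carrier K \<Longrightarrow> 1 \<odot>\<^bsub>K\<^esub> v = v"
  using smult_one[of v] by simp

lemma lincomb_eq:
  assumes "finite P" "{i. c i \<noteq> 0} \<subseteq> P" "\<And>i. i \<in> P \<Longrightarrow> B i \<in> carrier K"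
  shows "lincomb B c = finsum K (\<lambda>i. c i \<odot>\<^bsub>K\<^esub> B i) P"
  unfolding lincomb_def using assms
  by (intro M.add.finprod_mono_neutral_cong_left) auto

lemma lincomb_closed:
  assumes "\<And>i. c i \<noteq> 0 \<Longrightarrow> B i \<in> carrier K"
  shows "lincomb B c \<in> carrier K"
  unfolding lincomb_def using assms by (intro M.finsum_closed) auto

lemma lincomb_add:
  assumes fin: "finite {i. c i \<noteq> 0}" "finite {i. d i \<noteq> 0}"
    and B: "\<And>i. c i \<noteq> 0 \<Longrightarrow> B i \<in> carrier K" "\<And>i. d i \<noteq> 0 \<Longrightarrow> B i \<in> carrier K"
  shows "lincomb B (\<lambda>i. c i + d i) = lincomb B c \<oplus>\<^bsub>K\<^esub> lincomb B d"
proof -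
  let ?P = "{i. c i \<noteq> 0} \<union> {i. d i \<noteq> 0}"
  have P: "finite ?P" "\<And>i. i \<in> ?P \<Longrightarrow> B i \<in> carrier K" using assms by auto
  have "lincomb B (\<lambda>i. c i + d i) = finsum K (\<lambda>i. (c i + d i) \<odot>\<^bsub>K\<^esub> B i) ?P"
    using P by (intro lincomb_eq) auto
  also have "\<dots> = finsum K (\<lambda>i. c i \<odot>\<^bsub>K\<^esub> B i \<oplus>\<^bsub>K\<^esub> d i \<odot>\<^bsub>K\<^esub> B i) ?P"
  proof (rule M.finsum_cong')
    fix i assume "i \<in> ?P"
    then have "B i \<in> carrier K" by (rule P(2))
    then show "(c i + d i) \<odot>\<^bsub>K\<^esub> B i = c i \<odot>\<^bsub>K\<^esub> B i \<oplus>\<^bsub>K\<^esub> d i \<odot>\<^bsub>K\<^esub> B i"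
      using smult_l_distr[of "c i" "d i" "B i"] by simp
  qed (use P in auto)
  also have "\<dots> = finsum K (\<lambda>i. c i \<odot>\<^bsub>K\<^esub> B i) ?P \<oplus>\<^bsub>K\<^esub> finsum K (\<lambda>i. d i \<odot>\<^bsub>K\<^esub> B i) ?P"
    using P by (intro M.finsum_addf) auto
  also have "\<dots> = lincomb B c \<oplus>\<^bsub>K\<^esub> lincomb B d"
    using lincomb_eq[OF P(1) Un_upper1 P(2)] lincomb_eq[OF P(1) Un_upper2 P(2)] by simp
  finally show ?thesis .
qed

lemma lincomb_smult:
  assumes fin: "finite {i. c i \<noteq> 0}" and B: "\<And>i. c i \<noteq> 0 \<Longrightarrow> B i \<in> carrier K"
  shows "lincomb B (\<lambda>i. a * c i) = a \<odot>\<^bsub>K\<^esub> lincomb B c"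
proof -
  have "lincomb B (\<lambda>i. a * c i) = finsum K (\<lambda>i. (a * c i) \<odot>\<^bsub>K\<^esub> B i) {i. c i \<noteq> 0}"
    using fin B by (intro lincomb_eq) auto
  also have "\<dots> = finsum K (\<lambda>i. a \<odot>\<^bsub>K\<^esub> (c i \<odot>\<^bsub>K\<^esub> B i)) {i. c i \<noteq> 0}"
    using B smult_assoc[of a] by (intro M.finsum_cong') auto
  also have "\<dots> = a \<odot>\<^bsub>K\<^esub> lincomb B c"
    unfolding lincomb_def using fin B by (intro finsum_smult[symmetric]) auto
  finally show ?thesis .
qed

lemma lincomb_single:
  assumes "B i \<in> carrier K"
  shows "lincomb B (\<lambda>j. if j = i then a else 0) = a \<odot>\<^bsub>K\<^esub> B i"
  using assms by (subst lincomb_eq[of "{i}"]) auto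

lemma linear_span_subset:
  assumes V: "submodule V complex_ring K" and "E \<subseteq> V"
  shows "linear_span K E \<subseteq> V"
proof
  fix x assume "x \<in> linear_span K E"
  then obtain c F where "x = finsum K (\<lambda>e. c e \<odot>\<^bsub>K\<^esub> e) F" "F \<subseteq> E" unfolding linear_span_def by blast
  then show "x \<in> V" using assms submoduleD(4)[OF V] by (auto intro!: submodule_finsum)
qed

lemma linear_span_superset:
  assumes "E \<subseteq> carrier K"
  shows "E \<subseteq> linear_span K E"
proof
  fix e assume "e \<in> E"
  then show "e \<in> linear_span K E"
    unfolding linear_span_def using assms
    by (intro CollectI exI[of _ "\<lambda>_. 1"] exI[of _ "{e}"]) auto
qed

lemma submodule_linear_span:
  assumes E: "E \<subseteq> carrier K"
  shows "submodule (linear_span K E) complex_ring K"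
proof (rule submoduleI)
  \<comment> \<open>A finite sum over a subset of E becomes a combination with support in E, so that
    \<open>lincomb_add\<close> deals with differing supports.\<close>
  have *: "linear_span K E = {lincomb (\<lambda>e. e) c | c. finite {e. c e \<noteq> 0} \<and> {e. c e \<noteq> 0} \<subseteq> E}"
  proof (intro equalityI subsetI)
    fix x assume "x \<in> linear_span K E"
    then obtain c F where c: "x = finsum K (\<lambda>e. c e \<odot>\<^bsub>K\<^esub> e) F" "finite F" "F \<subseteq> E"
      unfolding linear_span_def by blast
    let ?c = "\<lambda>e. if e \<in> F then c e else 0"
    have "lincomb (\<lambda>e. e) ?c = finsum K (\<lambda>e. ?c e \<odot>\<^bsub>K\<^esub> e) F"
      using c E by (intro lincomb_eq) auto
    also have "\<dots> = x" unfolding c(1) using c E by (intro M.finsum_cong') auto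
    finally have "x = lincomb (\<lambda>e. e) ?c" by simp
    moreover have "finite {e. ?c e \<noteq> 0}" "{e. ?c e \<noteq> 0} \<subseteq> E" using c by auto
    ultimately show "x \<in> {lincomb (\<lambda>e. e) c | c. finite {e. c e \<noteq> 0} \<and> {e. c e \<noteq> 0} \<subseteq> E}" by blast
  next
    fix x assume "x \<in> {lincomb (\<lambda>e. e) c | c. finite {e. c e \<noteq> 0} \<and> {e. c e \<noteq> 0} \<subseteq> E}"
    then show "x \<in> linear_span K E" unfolding linear_span_def lincomb_def by blast
  qed
  show "linear_span K E \<subseteq> carrier K" unfolding * using E by (auto intro!: lincomb_closed)
  show "\<zero>\<^bsub>K\<^esub> \<in> linear_span K E"
    unfolding * by (intro CollectI exI[of _ "\<lambda>_. 0"]) (simp add: lincomb_def)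
  fix v w assume "v \<in> linear_span K E" "w \<in> linear_span K E"
  then obtain c d where c: "v = lincomb (\<lambda>e. e) c" "finite {e. c e \<noteq> 0}" "{e. c e \<noteq> 0} \<subseteq> E"
    and d: "w = lincomb (\<lambda>e. e) d" "finite {e. d e \<noteq> 0}" "{e. d e \<noteq> 0} \<subseteq> E"
    unfolding * by blast
  have "{e. c e + d e \<noteq> 0} \<subseteq> {e. c e \<noteq> 0} \<union> {e. d e \<noteq> 0}" by auto
  then have "finite {e. c e + d e \<noteq> 0}" "{e. c e + d e \<noteq> 0} \<subseteq> E"
    using c d finite_subset[OF _ finite_UnI] by auto
  moreover have "v \<oplus>\<^bsub>K\<^esub> w = lincomb (\<lambda>e. e) (\<lambda>e. c e + d e)"
    unfolding c(1) d(1) using c d E by (intro lincomb_add[symmetric]) auto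
  ultimately show "v \<oplus>\<^bsub>K\<^esub> w \<in> linear_span K E" unfolding * by blast
next
  fix a v assume "v \<in> linear_span K E"
  then obtain c F where c: "v = finsum K (\<lambda>e. c e \<odot>\<^bsub>K\<^esub> e) F" "finite F" "F \<subseteq> E"
    unfolding linear_span_def by blast
  have "a \<odot>\<^bsub>K\<^esub> v = finsum K (\<lambda>e. a \<odot>\<^bsub>K\<^esub> (c e \<odot>\<^bsub>K\<^esub> e)) F"
    unfolding c(1) using c E by (intro finsum_smult) auto
  also have "\<dots> = finsum K (\<lambda>e. (a * c e) \<odot>\<^bsub>K\<^esub> e) F"
    using c E smult_assoc[of a] by (intro M.finsum_cong') auto
  finally show "a \<odot>\<^bsub>K\<^esub> v \<in> linear_span K E"
    unfolding linear_span_def using c(2,3)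
    by (intro CollectI exI[of _ "\<lambda>e. a * c e"] exI[of _ F] conjI)
qed

end

lemma submodule_linear_preimage:
  assumes "complex_module K" "complex_module L" "u \<in> module_homs complex_ring K L"
    "submodule V complex_ring L"
  shows "submodule {v \<in> carrier K. u v \<in> V} complex_ring K"
  using assms left_module.submodule_carrier by (intro submodule_preimage) (auto simp: complex_module_def)

lemma module_homs_comp:
  "u \<in> module_homs R K L \<Longrightarrow> v \<in> module_homs R L M \<Longrightarrow> (\<lambda>a. v (u a)) \<in> module_homs R K M"
  unfolding module_homs_def by (simp add: Pi_iff)

text \<open>Reduces an identity between linear maps to its verification on basis elements.\<close>

lemma submodule_equalizer:
  assumes "complex_module K" "complex_module L"
    and u: "u \<in> module_homs complex_ring K L" and v: "v \<in> module_homs complex_ring K L"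
  shows "submodule {a \<in> carrier K. u a = v a} complex_ring K"
proof -
  interpret K: complex_module K by fact
  interpret L: complex_module L by fact
  note uD = module_homsD[OF u] and vD = module_homsD[OF v]
  have zero: "u \<zero>\<^bsub>K\<^esub> = \<zero>\<^bsub>L\<^esub>" "v \<zero>\<^bsub>K\<^esub> = \<zero>\<^bsub>L\<^esub>"
    using module_homs_zero[OF K.left_module_axioms L.left_module_axioms u]
      module_homs_zero[OF K.left_module_axioms L.left_module_axioms v] .
  show ?thesis by (rule K.submoduleI) (use zero uD vD in auto)
qed

lemma id_hom: "complex_module K \<Longrightarrow> (\<lambda>a. a) \<in> module_homs complex_ring K K"
  by (simp add: module_homs_def)

section \<open>The basis of an affine Hecke algebra and its coefficient functions\<close>

locale hecke_algebra =
  fixes \<H> :: "('x::ab_group_add, 'y::ab_group_add, 'h) hecke"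
  assumes hecke: "affine_hecke_algebra \<H>"
begin

sublocale based_root_datum "datum \<H>"
  using hecke by (simp add: based_root_datum_def affine_hecke_algebra_def Let_def)

abbreviation "H \<equiv> alg \<H>"
abbreviation "\<theta> \<equiv> theta \<H>"
abbreviation "T \<equiv> Tw \<H>"

lemma complex_algebra: "complex_algebra H"
  using hecke by (simp add: affine_hecke_algebra_def Let_def)

sublocale ring H
  using complex_algebra by (simp add: complex_algebra_def)

sublocale V: complex_module H
proof -
  interpret Mod: Module.module complex_ring H using complex_algebra by (simp add: complex_algebra_def)
  show "complex_module H"
    by (intro complex_module.intro left_module.intro left_module_axioms.intro
        Mod.R.ring_axioms abelian_group_axioms Mod.smult_closed Mod.smult_l_distr
        Mod.smult_r_distr Mod.smult_assoc1 Mod.smult_one)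
qed

lemma smult_mult:
  assumes "a \<in> carrier H" "b \<in> carrier H"
  shows "(c \<odot>\<^bsub>H\<^esub> a) \<otimes>\<^bsub>H\<^esub> b = c \<odot>\<^bsub>H\<^esub> (a \<otimes>\<^bsub>H\<^esub> b)" "a \<otimes>\<^bsub>H\<^esub> (c \<odot>\<^bsub>H\<^esub> b) = c \<odot>\<^bsub>H\<^esub> (a \<otimes>\<^bsub>H\<^esub> b)"
  using complex_algebra assms by (auto simp: complex_algebra_def)

lemma theta_closed [simp]: "\<theta> x \<in> carrier H"
  using hecke by (auto simp: affine_hecke_algebra_def Let_def)

lemma T_closed [simp]: "w \<in> W \<Longrightarrow> T w \<in> carrier H"
  using hecke by (auto simp: affine_hecke_algebra_def Let_def)

lemma theta_0: "\<theta> 0 = \<one>\<^bsub>H\<^esub>" and T_id: "T id = \<one>\<^bsub>H\<^esub>"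
  using hecke by (simp_all add: affine_hecke_algebra_def Let_def)

lemma theta_mult: "\<theta> x \<otimes>\<^bsub>H\<^esub> \<theta> y = \<theta> (x + y)"
  using hecke by (simp add: affine_hecke_algebra_def Let_def)

lemma T_mult:
  "v \<in> W \<Longrightarrow> w \<in> W \<Longrightarrow> weyl_length (datum \<H>) (v \<circ> w) = weyl_length (datum \<H>) v + weyl_length (datum \<H>) w \<Longrightarrow>
    T v \<otimes>\<^bsub>H\<^esub> T w = T (v \<circ> w)"
  using hecke by (simp add: affine_hecke_algebra_def Let_def)

lemma T_quadratic:
  "\<alpha> \<in> simple_roots (datum \<H>) \<Longrightarrow> (T (s \<alpha>) \<oplus>\<^bsub>H\<^esub> \<one>\<^bsub>H\<^esub>) \<otimes>\<^bsub>H\<^esub>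
    (T (s \<alpha>) \<ominus>\<^bsub>H\<^esub> complex_of_real (qpar \<H> powr lam \<H> \<alpha>) \<odot>\<^bsub>H\<^esub> \<one>\<^bsub>H\<^esub>) = \<zero>\<^bsub>H\<^esub>"
  using hecke by (simp add: affine_hecke_algebra_def Let_def)

lemma bernstein: "\<alpha> \<in> simple_roots (datum \<H>) \<Longrightarrow> bernstein_relation \<H> \<alpha> x"
  using hecke by (simp add: affine_hecke_algebra_def Let_def)

definition basis :: "'x \<times> ('x \<Rightarrow> 'x) \<Rightarrow> 'h" where
  "basis = (\<lambda>(x, w). \<theta> x \<otimes>\<^bsub>H\<^esub> T w)"

lemma basis_closed [simp]: "w \<in> W \<Longrightarrow> basis (x, w) \<in> carrier H"
  by (simp add: basis_def)

definition coef :: "'h \<Rightarrow> 'x \<times> ('x \<Rightarrow> 'x) \<Rightarrow> complex" where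
  "coef h = (THE c. finite {i. c i \<noteq> 0} \<and> {i. c i \<noteq> 0} \<subseteq> UNIV \<times> W \<and> h = V.lincomb basis c)"

lemma basis_unique:
  assumes "h \<in> carrier H"
  shows "\<exists>!c. finite {i. c i \<noteq> 0} \<and> {i. c i \<noteq> 0} \<subseteq> UNIV \<times> W \<and> h = V.lincomb basis c"
proof -
  have "\<exists>!c. finite {i. c i \<noteq> 0} \<and> {i. c i \<noteq> 0} \<subseteq> UNIV \<times> W \<and>
        h = finsum H (\<lambda>(x, w). c (x, w) \<odot>\<^bsub>H\<^esub> (\<theta> x \<otimes>\<^bsub>H\<^esub> T w)) {i. c i \<noteq> 0}"
    using hecke assms by (simp add: affine_hecke_algebra_def Let_def)
  moreover have "finsum H (\<lambda>(x, w). c (x, w) \<odot>\<^bsub>H\<^esub> (\<theta> x \<otimes>\<^bsub>H\<^esub> T w)) {i. c i \<noteq> 0} = V.lincomb basis c" for c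
    unfolding V.lincomb_def basis_def by (rule arg_cong[where f = "\<lambda>g. finsum H g _"]) auto
  ultimately show ?thesis by simp
qed

lemma coef:
  assumes "h \<in> carrier H"
  shows "finite {i. coef h i \<noteq> 0}" "{i. coef h i \<noteq> 0} \<subseteq> UNIV \<times> W" "V.lincomb basis (coef h) = h"
  using theI'[OF basis_unique[OF assms]] unfolding coef_def[symmetric] by auto

lemma coef_eqI:
  assumes "h \<in> carrier H" "finite {i. c i \<noteq> 0}" "{i. c i \<noteq> 0} \<subseteq> UNIV \<times> W" "h = V.lincomb basis c"
  shows "coef h = c"
  unfolding coef_def using basis_unique[OF assms(1)] assms(2-4) by (intro the1_equality) auto

lemma coef_support: "h \<in> carrier H \<Longrightarrow> coef h i \<noteq> 0 \<Longrightarrow> snd i \<in> W"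
  using coef(2)[of h] by (cases i) auto

lemma coef_support_basis: "h \<in> carrier H \<Longrightarrow> coef h i \<noteq> 0 \<Longrightarrow> basis i \<in> carrier H"
  using coef_support[of h i] by (cases i) simp

lemma coef_add:
  assumes "a \<in> carrier H" "b \<in> carrier H"
  shows "coef (a \<oplus>\<^bsub>H\<^esub> b) = (\<lambda>i. coef a i + coef b i)"
proof (rule coef_eqI)
  have *: "{i. coef a i + coef b i \<noteq> 0} \<subseteq> {i. coef a i \<noteq> 0} \<union> {i. coef b i \<noteq> 0}" by auto
  show "finite {i. coef a i + coef b i \<noteq> 0}"
    using coef(1) assms by (intro finite_subset[OF *]) auto
  show "{i. coef a i + coef b i \<noteq> 0} \<subseteq> UNIV \<times> W" using * coef(2) assms by blast
  show "a \<oplus>\<^bsub>H\<^esub> b = V.lincomb basis (\<lambda>i. coef a i + coef b i)"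
    using V.lincomb_add[OF coef(1)[OF assms(1)] coef(1)[OF assms(2)], of basis]
      coef_support_basis coef(3) assms by simp
qed (use assms in simp)

lemma coef_smult:
  assumes "a \<in> carrier H"
  shows "coef (c \<odot>\<^bsub>H\<^esub> a) = (\<lambda>i. c * coef a i)"
proof (rule coef_eqI)
  have *: "{i. c * coef a i \<noteq> 0} \<subseteq> {i. coef a i \<noteq> 0}" by auto
  show "finite {i. c * coef a i \<noteq> 0}" using coef(1)[OF assms] by (rule finite_subset[OF *])
  show "{i. c * coef a i \<noteq> 0} \<subseteq> UNIV \<times> W" using * coef(2)[OF assms] by blast
  show "c \<odot>\<^bsub>H\<^esub> a = V.lincomb basis (\<lambda>i. c * coef a i)"
    using V.lincomb_smult[OF coef(1)[OF assms], of basis c] coef_support_basis coef(3) assms by simp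
qed (use assms in simp)

lemma coef_basis:
  assumes "w \<in> W"
  shows "coef (basis (x, w)) = (\<lambda>i. if i = (x, w) then 1 else 0)"
  using assms V.lincomb_single[of basis "(x, w)" 1] by (intro coef_eqI) auto

text \<open>The basis case carries a scalar because V is later cut out by the action on a module for
  which no complex scalars are at hand.\<close>

lemma basis_induct:
  assumes "a \<in> carrier H" "\<zero>\<^bsub>H\<^esub> \<in> V"
    and add: "\<And>a b. a \<in> carrier H \<Longrightarrow> b \<in> carrier H \<Longrightarrow> a \<in> V \<Longrightarrow> b \<in> V \<Longrightarrow> a \<oplus>\<^bsub>H\<^esub> b \<in> V"
    and basis: "\<And>c x w. w \<in> W \<Longrightarrow> c \<odot>\<^bsub>H\<^esub> basis (x, w) \<in> V"
  shows "a \<in> V"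
proof -
  have "finsum H (\<lambda>i. coef a i \<odot>\<^bsub>H\<^esub> basis i) P \<in> V" if "finite P" "P \<subseteq> UNIV \<times> W" for P
    using that
  proof (induction P)
    case (insert i P)
    then have i: "snd i \<in> W" "\<And>r. r \<in> P \<Longrightarrow> snd r \<in> W" by auto
    have mem: "coef a r \<odot>\<^bsub>H\<^esub> basis r \<in> carrier H" if "snd r \<in> W" for r
      using that by (cases r) simp
    have "coef a i \<odot>\<^bsub>H\<^esub> basis i \<in> V" using basis[of "snd i" "coef a i" "fst i"] i(1) by simp
    then show ?case
      using insert i mem by (simp add: finsum_insert Pi_I) (rule add, auto intro!: finsum_closed)
  qed (simp add: assms(2))
  from this[OF coef(1,2)[OF assms(1)]] show ?thesis
    by (simp only: V.lincomb_def[symmetric] coef(3)[OF assms(1)])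
qed

lemma carrier_subset_submodule:
  assumes "submodule U complex_ring H" "\<And>x w. w \<in> W \<Longrightarrow> basis (x, w) \<in> U"
  shows "carrier H \<subseteq> U"
proof
  fix a assume "a \<in> carrier H"
  then show "a \<in> U"
    using assms(2) V.submoduleD[OF assms(1)] by (rule_tac basis_induct) auto
qed

definition lin_ext :: "(complex, 'k) module \<Rightarrow> ('x \<times> ('x \<Rightarrow> 'x) \<Rightarrow> 'k) \<Rightarrow> 'h \<Rightarrow> 'k" where
  "lin_ext K B h = complex_module.lincomb K B (coef h)"

lemma lin_ext:
  assumes K: "complex_module K" and B: "\<And>x w. w \<in> W \<Longrightarrow> B (x, w) \<in> carrier K"
  shows "lin_ext K B \<in> module_homs complex_ring H K"
    and "\<And>x w. w \<in> W \<Longrightarrow> lin_ext K B (basis (x, w)) = B (x, w)"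
proof -
  interpret K: complex_module K by fact
  have B': "B i \<in> carrier K" if "h \<in> carrier H" "coef h i \<noteq> 0" for h i
    using coef_support[OF that] B[of "snd i" "fst i"] by simp
  show "lin_ext K B \<in> module_homs complex_ring H K"
    unfolding module_homs_def lin_ext_def
    using B' coef(1) by (auto simp: coef_add coef_smult K.lincomb_add K.lincomb_smult intro!: K.lincomb_closed)
  show "lin_ext K B (basis (x, w)) = B (x, w)" if "w \<in> W" for x w
    using that B[OF that, of x] by (simp add: lin_ext_def coef_basis K.lincomb_single)
qed

lemma linear_eq_on_basis:
  assumes K: "complex_module K" and u: "u \<in> module_homs complex_ring H K"
    and v: "v \<in> module_homs complex_ring H K"
    and eq: "\<And>x w. w \<in> W \<Longrightarrow> u (basis (x, w)) = v (basis (x, w))"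
    and "a \<in> carrier H"
  shows "u a = v a"
proof -
  have "carrier H \<subseteq> {a \<in> carrier H. u a = v a}"
    by (rule carrier_subset_submodule[OF submodule_equalizer[OF V.complex_module_axioms K u v]])
      (simp add: eq)
  then show ?thesis using assms(5) by blast
qed

text \<open>For a coset of the root lattice this is a graded piece. Other index sets are needed too:
  \<open>{0}\<close> gives the span of the T w, \<open>range f\<close> the image of a central
  morphism, and its complement the part of the algebra outside that image.\<close>

definition pieces :: "'x set \<Rightarrow> 'h set" where
  "pieces Y = linear_span H {basis (x, w) | x w. x \<in> Y \<and> w \<in> W}"

abbreviation coset :: "'x \<Rightarrow> 'x set" where
  "coset y \<equiv> {x. x - y \<in> root_span}"

lemma graded_piece_eq: "graded_piece \<H> y = pieces (coset y)"
  by (simp add: graded_piece_def pieces_def basis_def)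

lemma submodule_pieces: "submodule (pieces Y) complex_ring H"
  unfolding pieces_def by (rule V.submodule_linear_span) auto

lemmas piecesD = V.submoduleD[OF submodule_pieces]

lemma basis_pieces: "x \<in> Y \<Longrightarrow> w \<in> W \<Longrightarrow> basis (x, w) \<in> pieces Y"
  unfolding pieces_def
  by (rule subsetD[OF V.linear_span_superset]) auto

lemma pieces_subset:
  assumes "submodule U complex_ring H" "\<And>x w. x \<in> Y \<Longrightarrow> w \<in> W \<Longrightarrow> basis (x, w) \<in> U"
  shows "pieces Y \<subseteq> U"
  unfolding pieces_def using assms by (intro V.linear_span_subset) auto

lemma pieces_mono: "Y \<subseteq> Z \<Longrightarrow> pieces Y \<subseteq> pieces Z"
  by (intro pieces_subset submodule_pieces) (auto intro: basis_pieces)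

lemma pieces_closed: "a \<in> pieces Y \<Longrightarrow> a \<in> carrier H"
  using piecesD(1) by blast

lemma pieces_UNIV: "pieces UNIV = carrier H"
  using carrier_subset_submodule[OF submodule_pieces[of UNIV]] piecesD(1)[of UNIV] basis_pieces by blast

section \<open>Linear extension of products and the finite Hecke algebra\<close>

lemma submodule_left_mult:
  assumes "submodule U complex_ring H" "a \<in> carrier H"
  shows "submodule {b \<in> carrier H. a \<otimes>\<^bsub>H\<^esub> b \<in> U} complex_ring H"
  using V.submoduleD[OF assms(1)] assms(2)
  by (intro V.submoduleI) (auto simp: r_distr smult_mult)

lemma submodule_right_mult:
  assumes "submodule U complex_ring H" "b \<in> carrier H"
  shows "submodule {a \<in> carrier H. a \<otimes>\<^bsub>H\<^esub> b \<in> U} complex_ring H"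
  using V.submoduleD[OF assms(1)] assms(2)
  by (intro V.submoduleI) (auto simp: l_distr smult_mult)

lemma theta_mult_basis: "w \<in> W \<Longrightarrow> \<theta> y \<otimes>\<^bsub>H\<^esub> basis (x, w) = basis (y + x, w)"
  by (simp add: basis_def m_assoc[symmetric] theta_mult)

lemma theta_mult_pieces:
  assumes "a \<in> pieces Y" "\<And>x. x \<in> Y \<Longrightarrow> y + x \<in> Z"
  shows "\<theta> y \<otimes>\<^bsub>H\<^esub> a \<in> pieces Z"
proof -
  have "pieces Y \<subseteq> {a \<in> carrier H. \<theta> y \<otimes>\<^bsub>H\<^esub> a \<in> pieces Z}"
    using assms(2)
    by (intro pieces_subset submodule_left_mult submodule_pieces) (auto simp: theta_mult_basis basis_pieces)
  then show ?thesis using assms(1) by blast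
qed

lemma T_basis: "w \<in> W \<Longrightarrow> T w = basis (0, w)"
  by (simp add: basis_def theta_0)

lemma theta_basis: "\<theta> x = basis (x, id)"
  by (simp add: basis_def T_id)

text \<open>If the length drops, then w = s v with T_w = T_s T_v. Multiplying the quadratic relation
  by T_v on the right gives T_s T_w = (Q - 1) T_w + Q T_v, where Q is the parameter of s.\<close>

lemma T_simple_mult_T:
  assumes \<alpha>: "\<alpha> \<in> simple_roots (datum \<H>)" and w: "w \<in> W"
  shows "T (s \<alpha>) \<otimes>\<^bsub>H\<^esub> T w \<in> pieces {0}"
proof -
  have \<alpha>R: "\<alpha> \<in> root_datum.roots (datum \<H>)" using \<alpha> by (rule simple_root)
  have sW: "s \<alpha> \<in> W" using \<alpha>R by (rule weyl_reflection)
  have sw: "s \<alpha> \<circ> w \<in> W" using weyl_comp[OF sW w] .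
  have len: "weyl_length (datum \<H>) (s \<alpha>) = 1" using \<alpha> by (rule weyl_length_simple)
  have T0: "T v \<in> pieces {0}" if "v \<in> W" for v
    using basis_pieces[of 0 "{0}" v] that by (simp add: T_basis)
  from weyl_length_simple_cases[OF w \<alpha>] show ?thesis
  proof
    assume "weyl_length (datum \<H>) (s \<alpha> \<circ> w) = weyl_length (datum \<H>) w + 1"
    then have "T (s \<alpha>) \<otimes>\<^bsub>H\<^esub> T w = T (s \<alpha> \<circ> w)" using T_mult[OF sW w] len by linarith
    then show ?thesis using T0[OF sw] by (simp only:)
  next
    let ?q = "complex_of_real (qpar \<H> powr lam \<H> \<alpha>)" and ?S = "T (s \<alpha>)" and ?v = "s \<alpha> \<circ> w"
    assume *: "weyl_length (datum \<H>) w = weyl_length (datum \<H>) (s \<alpha> \<circ> w) + 1"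
    have sv: "s \<alpha> \<circ> ?v = w" by (simp only: comp_assoc[symmetric] reflection_involution[OF \<alpha>R] id_comp)
    have Tw: "?S \<otimes>\<^bsub>H\<^esub> T ?v = T w" using T_mult[OF sW sw] * len unfolding sv by linarith
    have S: "?S \<in> carrier H" "T ?v \<in> carrier H" "T w \<in> carrier H" using sW sw w by auto
    have "\<zero>\<^bsub>H\<^esub> = (?S \<oplus>\<^bsub>H\<^esub> \<one>\<^bsub>H\<^esub>) \<otimes>\<^bsub>H\<^esub> (?S \<ominus>\<^bsub>H\<^esub> ?q \<odot>\<^bsub>H\<^esub> \<one>\<^bsub>H\<^esub>) \<otimes>\<^bsub>H\<^esub> T ?v"
      using T_quadratic[OF \<alpha>] S by simp
    also have "\<dots> = (?S \<oplus>\<^bsub>H\<^esub> \<one>\<^bsub>H\<^esub>) \<otimes>\<^bsub>H\<^esub> (T w \<ominus>\<^bsub>H\<^esub> ?q \<odot>\<^bsub>H\<^esub> T ?v)"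
      using S by (simp add: m_assoc minus_eq l_distr l_minus smult_mult Tw)
    also have "\<dots> = ?S \<otimes>\<^bsub>H\<^esub> T w \<ominus>\<^bsub>H\<^esub> ?q \<odot>\<^bsub>H\<^esub> T w \<oplus>\<^bsub>H\<^esub> (T w \<ominus>\<^bsub>H\<^esub> ?q \<odot>\<^bsub>H\<^esub> T ?v)"
    proof -
      have "?S \<otimes>\<^bsub>H\<^esub> (T w \<ominus>\<^bsub>H\<^esub> ?q \<odot>\<^bsub>H\<^esub> T ?v) = ?S \<otimes>\<^bsub>H\<^esub> T w \<ominus>\<^bsub>H\<^esub> ?q \<odot>\<^bsub>H\<^esub> T w"
        using S by (simp add: minus_eq r_distr r_minus smult_mult Tw)
      then show ?thesis using S by (subst l_distr) simp_all
    qed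
    finally have z: "?S \<otimes>\<^bsub>H\<^esub> T w \<ominus>\<^bsub>H\<^esub> ?q \<odot>\<^bsub>H\<^esub> T w \<oplus>\<^bsub>H\<^esub> (T w \<ominus>\<^bsub>H\<^esub> ?q \<odot>\<^bsub>H\<^esub> T ?v) = \<zero>\<^bsub>H\<^esub>" by simp
    have "?S \<otimes>\<^bsub>H\<^esub> T w = \<ominus>\<^bsub>H\<^esub> (T w \<ominus>\<^bsub>H\<^esub> ?q \<odot>\<^bsub>H\<^esub> T ?v) \<oplus>\<^bsub>H\<^esub> ?q \<odot>\<^bsub>H\<^esub> T w"
      using minus_equality[OF z] add_minus_cancel(3)[of "?S \<otimes>\<^bsub>H\<^esub> T w" "?q \<odot>\<^bsub>H\<^esub> T w"] S by simp
    also have "\<dots> \<in> pieces {0}"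
      using T0[OF w] T0[OF sw] by (intro piecesD(3,4,5,6)) simp_all
    finally show ?thesis .
  qed
qed

text \<open>The space \<open>pieces {0}\<close> is the finite Hecke algebra. Simple generators
  preserve it by left multiplication, hence so does a product along a reduced word.\<close>

lemma T_mult_T:
  assumes "v \<in> W" "w \<in> W"
  shows "T v \<otimes>\<^bsub>H\<^esub> T w \<in> pieces {0}"
  using assms(1)
proof (induction v rule: weyl_length_induct)
  case id
  show ?case unfolding T_id using assms(2) basis_pieces[of 0 "{0}" w] by (simp add: T_basis)
next
  case (step \<alpha> v)
  have sW: "s \<alpha> \<in> W" using step(1) by (intro weyl_reflection simple_root)
  have "T (s \<alpha>) \<otimes>\<^bsub>H\<^esub> T v = T (s \<alpha> \<circ> v)"
    using T_mult[OF sW step(2)] step(3) weyl_length_simple[OF step(1)] by linarith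
  then have "T (s \<alpha> \<circ> v) \<otimes>\<^bsub>H\<^esub> T w = T (s \<alpha>) \<otimes>\<^bsub>H\<^esub> (T v \<otimes>\<^bsub>H\<^esub> T w)"
    using sW step(2) assms(2) m_assoc[of "T (s \<alpha>)" "T v" "T w"] by simp
  moreover have "pieces {0} \<subseteq> {b \<in> carrier H. T (s \<alpha>) \<otimes>\<^bsub>H\<^esub> b \<in> pieces {0}}"
    using sW T_simple_mult_T[OF step(1)]
    by (intro pieces_subset submodule_left_mult submodule_pieces) (auto simp: T_basis[symmetric])
  ultimately have "T (s \<alpha> \<circ> v) \<otimes>\<^bsub>H\<^esub> T w \<in> pieces {0}" using step.IH by auto
  then show ?case .
qed

section \<open>Division in the lattice algebra\<close>

definition lattice_pieces :: "'x set \<Rightarrow> 'h set" where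
  "lattice_pieces Y = linear_span H (\<theta> ` Y)"

lemma lattice_algebra_eq: "lattice_algebra \<H> = lattice_pieces UNIV"
  by (simp add: lattice_algebra_def lattice_pieces_def)

lemma submodule_lattice_pieces: "submodule (lattice_pieces Y) complex_ring H"
  unfolding lattice_pieces_def by (rule V.submodule_linear_span) auto

lemmas lattice_piecesD = V.submoduleD[OF submodule_lattice_pieces]

lemma theta_lattice_pieces: "x \<in> Y \<Longrightarrow> \<theta> x \<in> lattice_pieces Y"
  unfolding lattice_pieces_def by (rule subsetD[OF V.linear_span_superset]) auto

lemma lattice_pieces_subset:
  assumes "submodule U complex_ring H" "\<And>x. x \<in> Y \<Longrightarrow> \<theta> x \<in> U"
  shows "lattice_pieces Y \<subseteq> U"
  unfolding lattice_pieces_def using assms by (intro V.linear_span_subset) auto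

lemma lattice_pieces_mono: "Y \<subseteq> Z \<Longrightarrow> lattice_pieces Y \<subseteq> lattice_pieces Z"
  by (intro lattice_pieces_subset submodule_lattice_pieces) (auto intro: theta_lattice_pieces)

lemma theta_mult_lattice_pieces:
  assumes "a \<in> lattice_pieces Y" "\<And>x. x \<in> Y \<Longrightarrow> y + x \<in> Z"
  shows "\<theta> y \<otimes>\<^bsub>H\<^esub> a \<in> lattice_pieces Z"
proof -
  have "lattice_pieces Y \<subseteq> {a \<in> carrier H. \<theta> y \<otimes>\<^bsub>H\<^esub> a \<in> lattice_pieces Z}"
    using assms(2)
    by (intro lattice_pieces_subset submodule_left_mult submodule_lattice_pieces)
      (auto simp: theta_mult theta_lattice_pieces)
  then show ?thesis using assms(1) by blast
qed

lemma coef_mult_theta: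
  assumes "d \<in> lattice_pieces Y"
  shows "coef (d \<otimes>\<^bsub>H\<^esub> \<theta> y) (x, w) = coef d (x - y, w)"
proof -
  have "submodule {d \<in> carrier H. \<forall>x w. coef (d \<otimes>\<^bsub>H\<^esub> \<theta> y) (x, w) = coef d (x - y, w)} complex_ring H"
  proof (rule V.submoduleI)
    have "coef \<zero>\<^bsub>H\<^esub> = (\<lambda>_. 0)" using coef_smult[of "\<zero>\<^bsub>H\<^esub>" 0] by simp
    then show "\<zero>\<^bsub>H\<^esub> \<in> {d \<in> carrier H. \<forall>x w. coef (d \<otimes>\<^bsub>H\<^esub> \<theta> y) (x, w) = coef d (x - y, w)}" by simp
  qed (auto simp: l_distr smult_mult coef_add coef_smult)
  moreover have "\<theta> z \<in> {d \<in> carrier H. \<forall>x w. coef (d \<otimes>\<^bsub>H\<^esub> \<theta> y) (x, w) = coef d (x - y, w)}" for z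
    by (auto simp: theta_mult) (auto simp: theta_basis coef_basis weyl_id)
  ultimately have "lattice_pieces Y \<subseteq> {d \<in> carrier H. \<forall>x w. coef (d \<otimes>\<^bsub>H\<^esub> \<theta> y) (x, w) = coef d (x - y, w)}"
    by (rule lattice_pieces_subset)
  then show ?thesis using assms by blast
qed

lemma coef_zero_imp:
  assumes "a \<in> carrier H" "\<And>i. coef a i = 0"
  shows "a = \<zero>\<^bsub>H\<^esub>"
  using coef(3)[OF assms(1)] assms(2) by (simp add: V.lincomb_def)

text \<open>The coefficients of \<open>d\<close> are periodic in the direction \<open>\<beta>\<close> and have finite support.\<close>

lemma lattice_cancel:
  assumes tf: "\<And>n. zsmult n \<beta> = 0 \<Longrightarrow> n = 0" and d: "d \<in> lattice_pieces Y"
    and eq: "d \<otimes>\<^bsub>H\<^esub> (\<one>\<^bsub>H\<^esub> \<ominus>\<^bsub>H\<^esub> \<theta> (- \<beta>)) = \<zero>\<^bsub>H\<^esub>"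
  shows "d = \<zero>\<^bsub>H\<^esub>"
proof (rule coef_zero_imp)
  show dH: "d \<in> carrier H" using d lattice_piecesD(1) by blast
  have "d \<ominus>\<^bsub>H\<^esub> d \<otimes>\<^bsub>H\<^esub> \<theta> (- \<beta>) = \<zero>\<^bsub>H\<^esub>"
    using eq dH by (simp add: minus_eq r_distr r_minus)
  then have deq: "d = d \<otimes>\<^bsub>H\<^esub> \<theta> (- \<beta>)" by (rule eq_if_minus_eq_zero[rotated 2]) (simp_all add: dH)
  have shift: "coef d (x, w) = coef d (x + \<beta>, w)" for x w
    using coef_mult_theta[OF d, of "- \<beta>" x w] unfolding deq[symmetric] by simp
  fix i :: "'x \<times> ('x \<Rightarrow> 'x)"
  obtain x w where i: "i = (x, w)" by (cases i)
  show "coef d i = 0"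
  proof (rule ccontr)
    assume ne: "coef d i \<noteq> 0"
    have "coef d (x + zsmult (int n) \<beta>, w) = coef d (x, w)" for n
    proof (induction n)
      case (Suc n)
      have "x + zsmult (int (Suc n)) \<beta> = (x + zsmult (int n) \<beta>) + \<beta>"
        by (simp add: zmod.scale_left_distrib algebra_simps)
      then show ?case using Suc shift[of "x + zsmult (int n) \<beta>" w] by (simp only:)
    qed simp
    then have "range (\<lambda>n::nat. (x + zsmult (int n) \<beta>, w)) \<subseteq> {i. coef d i \<noteq> 0}" using ne i by auto
    then have "finite (range (\<lambda>n::nat. (x + zsmult (int n) \<beta>, w)))"
      using coef(1)[OF dH] by (rule finite_subset)
    moreover have "inj (\<lambda>n::nat. (x + zsmult (int n) \<beta>, w))"
    proof (rule injI)
      fix n m :: nat assume "(x + zsmult (int n) \<beta>, w) = (x + zsmult (int m) \<beta>, w)"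
      then have "zsmult (int n - int m) \<beta> = 0" by (simp add: zmod.scale_left_diff_distrib)
      then show "n = m" using tf[of "int n - int m"] by simp
    qed
    ultimately show False using finite_imageD[of _ UNIV] by auto
  qed
qed

text \<open>For m \<ge> 0 the quotient is the geometric sum of the \<theta> (x - i \<beta>) with 0
  \<le> i < m, and the product with 1 - \<theta>_(-\<beta>) telescopes.\<close>

lemma lattice_quotient_exists:
  "\<exists>d\<in>lattice_pieces {z. \<exists>k. z = x + zsmult k \<beta>}.
    d \<otimes>\<^bsub>H\<^esub> (\<one>\<^bsub>H\<^esub> \<ominus>\<^bsub>H\<^esub> \<theta> (- \<beta>)) = \<theta> x \<ominus>\<^bsub>H\<^esub> \<theta> (x - zsmult m \<beta>)"
proof -
  let ?b = "\<one>\<^bsub>H\<^esub> \<ominus>\<^bsub>H\<^esub> \<theta> (- \<beta>)"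
  have b: "?b \<in> carrier H" by simp
  have nat: "\<exists>d\<in>lattice_pieces {z. \<exists>k. z = x + zsmult k \<beta>}.
    d \<otimes>\<^bsub>H\<^esub> ?b = \<theta> x \<ominus>\<^bsub>H\<^esub> \<theta> (x - zsmult (int n) \<beta>)" for x n
  proof (induction n)
    case 0
    have "\<zero>\<^bsub>H\<^esub> \<otimes>\<^bsub>H\<^esub> ?b = \<theta> x \<ominus>\<^bsub>H\<^esub> \<theta> (x - zsmult (int 0) \<beta>)" by (simp add: minus_eq r_neg)
    then show ?case using lattice_piecesD(2) by blast
  next
    case (Suc n)
    then obtain d where d: "d \<in> lattice_pieces {z. \<exists>k. z = x + zsmult k \<beta>}"
      "d \<otimes>\<^bsub>H\<^esub> ?b = \<theta> x \<ominus>\<^bsub>H\<^esub> \<theta> (x - zsmult (int n) \<beta>)" by blast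
    let ?y = "x - zsmult (int n) \<beta>"
    have y: "?y = x + zsmult (- int n) \<beta>" by simp
    have e: "\<theta> ?y \<in> lattice_pieces {z. \<exists>k. z = x + zsmult k \<beta>}"
      by (rule theta_lattice_pieces) (use y in blast)
    have dH: "d \<in> carrier H" using d(1) lattice_piecesD(1) by blast
    have y': "?y - \<beta> = x - zsmult (int (Suc n)) \<beta>"
      by (simp add: zmod.scale_left_distrib algebra_simps)
    have "\<theta> ?y \<otimes>\<^bsub>H\<^esub> ?b = \<theta> ?y \<ominus>\<^bsub>H\<^esub> \<theta> (?y - \<beta>)"
      by (simp add: minus_eq r_distr r_minus theta_mult)
    then have "(d \<oplus>\<^bsub>H\<^esub> \<theta> ?y) \<otimes>\<^bsub>H\<^esub> ?b = (\<theta> x \<ominus>\<^bsub>H\<^esub> \<theta> ?y) \<oplus>\<^bsub>H\<^esub> (\<theta> ?y \<ominus>\<^bsub>H\<^esub> \<theta> (?y - \<beta>))"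
      using d(2) dH by (simp add: l_distr)
    also have "\<dots> = (\<theta> x \<ominus>\<^bsub>H\<^esub> \<theta> ?y \<oplus>\<^bsub>H\<^esub> \<theta> ?y) \<ominus>\<^bsub>H\<^esub> \<theta> (?y - \<beta>)"
      by (simp add: minus_eq a_assoc)
    also have "\<dots> = \<theta> x \<ominus>\<^bsub>H\<^esub> \<theta> (?y - \<beta>)" by (simp add: add_minus_cancel)
    finally have "(d \<oplus>\<^bsub>H\<^esub> \<theta> ?y) \<otimes>\<^bsub>H\<^esub> ?b = \<theta> x \<ominus>\<^bsub>H\<^esub> \<theta> (x - zsmult (int (Suc n)) \<beta>)" unfolding y' .
    then show ?case using lattice_piecesD(3)[OF d(1) e] by blast
  qed
  show ?thesis
  proof (cases "0 \<le> m")
    case True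
    then show ?thesis using nat[of x "nat m"] by simp
  next
    case False
    \<comment> \<open>For negative m the two end points are exchanged and the quotient is
      negated.\<close>
    let ?x = "x - zsmult m \<beta>"
    have x: "?x - zsmult (int (nat (- m))) \<beta> = x" using False by simp
    obtain d where d: "d \<in> lattice_pieces {z. \<exists>k. z = ?x + zsmult k \<beta>}" "d \<otimes>\<^bsub>H\<^esub> ?b = \<theta> ?x \<ominus>\<^bsub>H\<^esub> \<theta> x"
      using nat[of ?x "nat (- m)"] unfolding x by blast
    have "{z. \<exists>k. z = ?x + zsmult k \<beta>} \<subseteq> {z. \<exists>k. z = x + zsmult k \<beta>}"
    proof safe
      fix k
      have "?x + zsmult k \<beta> = x + zsmult (k - m) \<beta>" by (simp add: zmod.scale_left_diff_distrib)
      then show "\<exists>k'. ?x + zsmult k \<beta> = x + zsmult k' \<beta>" by blast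
    qed
    then have d': "\<ominus>\<^bsub>H\<^esub> d \<in> lattice_pieces {z. \<exists>k. z = x + zsmult k \<beta>}"
      using d(1) lattice_pieces_mono lattice_piecesD(5) by blast
    have dH: "d \<in> carrier H" using d(1) lattice_piecesD(1) by blast
    have "\<ominus>\<^bsub>H\<^esub> d \<otimes>\<^bsub>H\<^esub> ?b = \<ominus>\<^bsub>H\<^esub> (\<theta> ?x \<ominus>\<^bsub>H\<^esub> \<theta> x)" using dH d(2) by (simp add: l_minus)
    also have "\<dots> = \<theta> x \<ominus>\<^bsub>H\<^esub> \<theta> ?x" by (simp add: minus_eq minus_add a_comm)
    finally show ?thesis using d' by blast
  qed
qed

text \<open>The difference of two quotients is annihilated by 1 - \<theta>_(-\<beta>), hence zero,
  and so the definite description denotes the telescoping sum. Its support lies on the line x +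
  \<int>\<beta>, which is inside the coset of x for \<beta> = \<alpha> as well as for \<beta> = 2
  \<alpha>.\<close>

lemma lattice_quotient_mem:
  assumes tf: "\<And>n. zsmult n \<beta> = 0 \<Longrightarrow> n = 0"
  shows "lattice_quotient \<H> (\<theta> x \<ominus>\<^bsub>H\<^esub> \<theta> (x - zsmult m \<beta>)) (\<one>\<^bsub>H\<^esub> \<ominus>\<^bsub>H\<^esub> \<theta> (- \<beta>))
    \<in> lattice_pieces {z. \<exists>k. z = x + zsmult k \<beta>}"
proof -
  let ?b = "\<one>\<^bsub>H\<^esub> \<ominus>\<^bsub>H\<^esub> \<theta> (- \<beta>)"
  obtain d where d: "d \<in> lattice_pieces {z. \<exists>k. z = x + zsmult k \<beta>}"
    "d \<otimes>\<^bsub>H\<^esub> ?b = \<theta> x \<ominus>\<^bsub>H\<^esub> \<theta> (x - zsmult m \<beta>)"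
    using lattice_quotient_exists by blast
  have dU: "d \<in> lattice_pieces UNIV" using d(1) lattice_pieces_mono by blast
  have dH: "d \<in> carrier H" using d(1) lattice_piecesD(1) by blast
  have "lattice_quotient \<H> (\<theta> x \<ominus>\<^bsub>H\<^esub> \<theta> (x - zsmult m \<beta>)) ?b = d"
    unfolding lattice_quotient_def lattice_algebra_eq
  proof (rule the_equality)
    fix e assume e: "e \<in> lattice_pieces UNIV \<and> e \<otimes>\<^bsub>H\<^esub> ?b = \<theta> x \<ominus>\<^bsub>H\<^esub> \<theta> (x - zsmult m \<beta>)"
    then have eH: "e \<in> carrier H" using lattice_piecesD(1) by blast
    have "(e \<ominus>\<^bsub>H\<^esub> d) \<otimes>\<^bsub>H\<^esub> ?b = e \<otimes>\<^bsub>H\<^esub> ?b \<ominus>\<^bsub>H\<^esub> d \<otimes>\<^bsub>H\<^esub> ?b"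
      unfolding minus_eq[of e d] minus_eq[of "e \<otimes>\<^bsub>H\<^esub> ?b"] using eH dH
      by (subst l_distr) (simp_all add: l_minus)
    also have "\<dots> = \<zero>\<^bsub>H\<^esub>" using e d(2) by simp
    finally have "e \<ominus>\<^bsub>H\<^esub> d = \<zero>\<^bsub>H\<^esub>"
      using lattice_cancel[OF tf, where d = "e \<ominus>\<^bsub>H\<^esub> d" and Y = UNIV] lattice_piecesD(6) e dU by blast
    then show "e = d" using eq_if_minus_eq_zero eH dH by blast
  qed (use d dU in simp)
  then show ?thesis using d(1) by simp
qed

text \<open>All that is kept of the Bernstein relation is the coset containing the correction term.
  The parameters enter only as scalars.\<close>

lemma T_simple_theta:
  assumes \<alpha>: "\<alpha> \<in> simple_roots (datum \<H>)"
  obtains c where "c \<in> lattice_pieces (coset x)"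
    and "T (s \<alpha>) \<otimes>\<^bsub>H\<^esub> \<theta> x = \<theta> (s \<alpha> x) \<otimes>\<^bsub>H\<^esub> T (s \<alpha>) \<oplus>\<^bsub>H\<^esub> c"
proof -
  have \<alpha>R: "\<alpha> \<in> root_datum.roots (datum \<H>)" using \<alpha> by (rule simple_root)
  have span: "\<alpha> \<in> root_span" using \<alpha>R by (rule zmod.span_base)
  show ?thesis
  proof (cases "even_coroot (datum \<H>) \<alpha>")
    case False
    let ?d = "lattice_quotient \<H> (\<theta> x \<ominus>\<^bsub>H\<^esub> \<theta> (s \<alpha> x)) (\<one>\<^bsub>H\<^esub> \<ominus>\<^bsub>H\<^esub> \<theta> (- \<alpha>))"
    have "?d \<in> lattice_pieces {z. \<exists>k. z = x + zsmult k \<alpha>}"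
      unfolding reflection_def by (rule lattice_quotient_mem) (rule zsmult_root_eq_0[OF \<alpha>R])
    moreover have "{z. \<exists>k. z = x + zsmult k \<alpha>} \<subseteq> coset x" using zmod.span_scale[OF span] by auto
    ultimately have "?d \<in> lattice_pieces (coset x)" using lattice_pieces_mono by blast
    then have "(complex_of_real (qpar \<H> powr lam \<H> \<alpha>) - 1) \<odot>\<^bsub>H\<^esub> ?d \<in> lattice_pieces (coset x)"
      by (intro lattice_piecesD(4)) simp_all
    then show ?thesis
      using bernstein[OF \<alpha>, of x] False by (intro that) (auto simp: bernstein_relation_def Let_def)
  next
    case True
    then obtain y where y: "coroot (datum \<H>) \<alpha> = y + y" by (auto simp: even_coroot_def)
    let ?\<beta> = "\<alpha> + \<alpha>"
    let ?d = "lattice_quotient \<H> (\<theta> x \<ominus>\<^bsub>H\<^esub> \<theta> (s \<alpha> x)) (\<one>\<^bsub>H\<^esub> \<ominus>\<^bsub>H\<^esub> \<theta> (- ?\<beta>))"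
    have tw: "zsmult n ?\<beta> = zsmult (n + n) \<alpha>" for n
      by (simp only: zmod.scale_right_distrib zmod.scale_left_distrib)
    \<comment> \<open>Halving the coroot turns the displacement of x into a multiple of 2 \<alpha>,
      the direction of the denominator in the even case.\<close>
    have sx: "s \<alpha> x = x - zsmult (p x y) ?\<beta>" by (simp add: reflection_def y pairing_right tw)
    have tf: "n = 0" if "zsmult n ?\<beta> = 0" for n
      using zsmult_root_eq_0[OF \<alpha>R, of "n + n"] that by (simp add: tw)
    have "?d \<in> lattice_pieces {z. \<exists>k. z = x + zsmult k ?\<beta>}"
      unfolding sx by (rule lattice_quotient_mem) (rule tf)
    moreover have "{z. \<exists>k. z = x + zsmult k ?\<beta>} \<subseteq> coset x"
      using zmod.span_scale[OF zmod.span_add[OF span span]] by auto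
    ultimately have d: "?d \<in> lattice_pieces (coset x)" using lattice_pieces_mono by blast
    have dH: "?d \<in> carrier H" using d lattice_piecesD(1) by blast
    have td: "\<theta> (- \<alpha>) \<otimes>\<^bsub>H\<^esub> ?d \<in> lattice_pieces (coset x)"
    proof (rule theta_mult_lattice_pieces[OF d])
      fix z assume "z \<in> coset x"
      then have "(z - x) - \<alpha> \<in> root_span" using zmod.span_diff[OF _ span, of "z - x"] by simp
      then show "- \<alpha> + z \<in> coset x" by (simp add: algebra_simps)
    qed
    have "(c \<odot>\<^bsub>H\<^esub> \<one>\<^bsub>H\<^esub> \<oplus>\<^bsub>H\<^esub> c' \<odot>\<^bsub>H\<^esub> \<theta> (- \<alpha>)) \<otimes>\<^bsub>H\<^esub> ?d = c \<odot>\<^bsub>H\<^esub> ?d \<oplus>\<^bsub>H\<^esub> c' \<odot>\<^bsub>H\<^esub> (\<theta> (- \<alpha>) \<otimes>\<^bsub>H\<^esub> ?d)" for c c'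
      using dH by (simp add: l_distr smult_mult)
    moreover have "c \<odot>\<^bsub>H\<^esub> ?d \<oplus>\<^bsub>H\<^esub> c' \<odot>\<^bsub>H\<^esub> (\<theta> (- \<alpha>) \<otimes>\<^bsub>H\<^esub> ?d) \<in> lattice_pieces (coset x)" for c c'
      using d td by (intro lattice_piecesD(3,4)) simp_all
    ultimately have mem: "(c \<odot>\<^bsub>H\<^esub> \<one>\<^bsub>H\<^esub> \<oplus>\<^bsub>H\<^esub> c' \<odot>\<^bsub>H\<^esub> \<theta> (- \<alpha>)) \<otimes>\<^bsub>H\<^esub> ?d \<in> lattice_pieces (coset x)" for c c'
      by simp
    show ?thesis
      using bernstein[OF \<alpha>, of x] True mem by (intro that) (auto simp: bernstein_relation_def Let_def)
  qed
qed

section \<open>Compatibility of the product with the grading\<close>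

lemma lattice_pieces_mult_T:
  assumes "a \<in> lattice_pieces Y" "w \<in> W"
  shows "a \<otimes>\<^bsub>H\<^esub> T w \<in> pieces Y"
proof -
  have "lattice_pieces Y \<subseteq> {a \<in> carrier H. a \<otimes>\<^bsub>H\<^esub> T w \<in> pieces Y}"
    using assms(2) basis_pieces[of _ Y w]
    by (intro lattice_pieces_subset submodule_right_mult submodule_pieces) (auto simp: basis_def)
  then show ?thesis using assms(1) by blast
qed

text \<open>Moving T_s past \<theta>_y produces \<theta>_(s y) T_s and a correction, both over the
  coset of y. The coset is therefore preserved along a reduced word.\<close>

lemma T_mult_theta:
  assumes "w \<in> W"
  shows "T w \<otimes>\<^bsub>H\<^esub> \<theta> x \<in> pieces (coset x)"
  using assms
proof (induction w rule: weyl_length_induct)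
  case id
  have "\<theta> x \<in> pieces (coset x)"
    unfolding theta_basis by (rule basis_pieces) (simp_all add: weyl_id zmod.span_zero)
  then show ?case unfolding T_id by simp
next
  case (step \<alpha> w)
  have \<alpha>R: "\<alpha> \<in> root_datum.roots (datum \<H>)" using step(1) by (rule simple_root)
  have sW: "s \<alpha> \<in> W" using \<alpha>R by (rule weyl_reflection)
  have "T (s \<alpha>) \<otimes>\<^bsub>H\<^esub> T w = T (s \<alpha> \<circ> w)"
    using T_mult[OF sW step(2)] step(3) weyl_length_simple[OF step(1)] by linarith
  then have "T (s \<alpha> \<circ> w) \<otimes>\<^bsub>H\<^esub> \<theta> x = T (s \<alpha>) \<otimes>\<^bsub>H\<^esub> (T w \<otimes>\<^bsub>H\<^esub> \<theta> x)"
    using sW step(2) m_assoc[of "T (s \<alpha>)" "T w" "\<theta> x"] by simp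
  moreover have "pieces (coset x) \<subseteq> {b \<in> carrier H. T (s \<alpha>) \<otimes>\<^bsub>H\<^esub> b \<in> pieces (coset x)}"
  proof (intro pieces_subset submodule_left_mult submodule_pieces)
    fix y u assume y: "y \<in> coset x" and u: "u \<in> W"
    obtain c where c: "c \<in> lattice_pieces (coset y)"
      "T (s \<alpha>) \<otimes>\<^bsub>H\<^esub> \<theta> y = \<theta> (s \<alpha> y) \<otimes>\<^bsub>H\<^esub> T (s \<alpha>) \<oplus>\<^bsub>H\<^esub> c"
      using T_simple_theta[OF step(1)] .
    have sub: "coset y \<subseteq> coset x"
    proof
      fix z assume "z \<in> coset y"
      then have "(z - y) + (y - x) \<in> root_span" using y by (intro zmod.span_add) auto
      then show "z \<in> coset x" by simp
    qed
    have cH: "c \<in> carrier H" using c(1) lattice_piecesD(1) by blast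
    have "T (s \<alpha>) \<otimes>\<^bsub>H\<^esub> basis (y, u) = \<theta> (s \<alpha> y) \<otimes>\<^bsub>H\<^esub> (T (s \<alpha>) \<otimes>\<^bsub>H\<^esub> T u) \<oplus>\<^bsub>H\<^esub> c \<otimes>\<^bsub>H\<^esub> T u"
      using u sW cH by (simp add: basis_def m_assoc[symmetric] c(2) l_distr)
    moreover have "\<theta> (s \<alpha> y) \<otimes>\<^bsub>H\<^esub> (T (s \<alpha>) \<otimes>\<^bsub>H\<^esub> T u) \<in> pieces (coset x)"
    proof (rule theta_mult_pieces[OF T_simple_mult_T[OF step(1) u]])
      fix z :: 'x assume "z \<in> {0}"
      then show "s \<alpha> y + z \<in> coset x" using weyl_diff_span[OF sW, of y] sub by auto
    qed
    moreover have "c \<otimes>\<^bsub>H\<^esub> T u \<in> pieces (coset x)"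
      using lattice_pieces_mult_T[OF c(1) u] pieces_mono[OF sub] by blast
    ultimately show "basis (y, u) \<in> {b \<in> carrier H. T (s \<alpha>) \<otimes>\<^bsub>H\<^esub> b \<in> pieces (coset x)}"
      using u piecesD(3) by simp
  qed (use sW in simp)
  ultimately have "T (s \<alpha> \<circ> w) \<otimes>\<^bsub>H\<^esub> \<theta> x \<in> pieces (coset x)" using step.IH by auto
  then show ?case .
qed

text \<open>The inner product of T w and \<theta>_x' stays over the coset of x'. Multiplying by T w'
  on the right does not change cosets, and \<theta>_x on the left translates them.\<close>

lemma basis_mult_basis:
  assumes w: "w \<in> W" and w': "w' \<in> W"
  shows "basis (x, w) \<otimes>\<^bsub>H\<^esub> basis (x', w') \<in> pieces (coset (x + x'))"
proof -
  have "pieces (coset x') \<subseteq> {a \<in> carrier H. a \<otimes>\<^bsub>H\<^esub> T w' \<in> pieces (coset x')}"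
  proof (intro pieces_subset submodule_right_mult submodule_pieces)
    fix z u assume z: "z \<in> coset x'" and u: "u \<in> W"
    have "basis (z, u) \<otimes>\<^bsub>H\<^esub> T w' = \<theta> z \<otimes>\<^bsub>H\<^esub> (T u \<otimes>\<^bsub>H\<^esub> T w')"
      using u w' by (simp add: basis_def m_assoc)
    also have "\<dots> \<in> pieces (coset x')"
      using z by (intro theta_mult_pieces[OF T_mult_T[OF u w']]) auto
    finally show "basis (z, u) \<in> {a \<in> carrier H. a \<otimes>\<^bsub>H\<^esub> T w' \<in> pieces (coset x')}" using u by simp
  qed (use w' in simp)
  then have "(T w \<otimes>\<^bsub>H\<^esub> \<theta> x') \<otimes>\<^bsub>H\<^esub> T w' \<in> pieces (coset x')"
    using T_mult_theta[OF w, of x'] by blast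
  then have "\<theta> x \<otimes>\<^bsub>H\<^esub> ((T w \<otimes>\<^bsub>H\<^esub> \<theta> x') \<otimes>\<^bsub>H\<^esub> T w') \<in> pieces (coset (x + x'))"
    by (rule theta_mult_pieces) (simp add: algebra_simps)
  then show ?thesis using w w' by (simp add: basis_def m_assoc)
qed

text \<open>Bilinear extension from basis elements. The index sets are arbitrary because the lemma
  is also applied to \<open>range f\<close> and its complement.\<close>

lemma pieces_mult:
  assumes a: "a \<in> pieces Y" and b: "b \<in> pieces Y'"
    and Z: "\<And>y y'. y \<in> Y \<Longrightarrow> y' \<in> Y' \<Longrightarrow> coset (y + y') \<subseteq> Z"
  shows "a \<otimes>\<^bsub>H\<^esub> b \<in> pieces Z"
proof -
  have "pieces Y \<subseteq> {a \<in> carrier H. a \<otimes>\<^bsub>H\<^esub> b \<in> pieces Z}"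
  proof (intro pieces_subset submodule_right_mult submodule_pieces)
    fix y w assume y: "y \<in> Y" and w: "w \<in> W"
    have "pieces Y' \<subseteq> {b \<in> carrier H. basis (y, w) \<otimes>\<^bsub>H\<^esub> b \<in> pieces Z}"
    proof (intro pieces_subset submodule_left_mult submodule_pieces)
      fix y' w' assume y': "y' \<in> Y'" and w': "w' \<in> W"
      show "basis (y', w') \<in> {b \<in> carrier H. basis (y, w) \<otimes>\<^bsub>H\<^esub> b \<in> pieces Z}"
        using basis_mult_basis[OF w w'] pieces_mono[OF Z[OF y y']] w' by auto
    qed (use w in simp)
    then show "basis (y, w) \<in> {a \<in> carrier H. a \<otimes>\<^bsub>H\<^esub> b \<in> pieces Z}" using b w by auto
  qed (use b pieces_closed in simp)
  then show ?thesis using a by blast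
qed

end

section \<open>Central morphisms\<close>

locale hecke_morphism =
  fixes \<H>1 :: "('x1::ab_group_add, 'y1::ab_group_add, 'h1) hecke"
    and \<H>2 :: "('x2::ab_group_add, 'y2::ab_group_add, 'h2) hecke"
    and f :: "'x1 \<Rightarrow> 'x2" and \<phi> :: "'h1 \<Rightarrow> 'h2"
  assumes morphism: "central_morphism \<H>1 \<H>2 f \<phi>"
begin

sublocale A1: hecke_algebra \<H>1
  using morphism by (simp add: central_morphism_def hecke_algebra_def)

sublocale A2: hecke_algebra \<H>2
  using morphism by (simp add: central_morphism_def hecke_algebra_def)

abbreviation "D1 \<equiv> datum \<H>1"
abbreviation "D2 \<equiv> datum \<H>2"
abbreviation "H1 \<equiv> alg \<H>1"
abbreviation "H2 \<equiv> alg \<H>2"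
abbreviation "\<theta>1 \<equiv> theta \<H>1"
abbreviation "\<theta>2 \<equiv> theta \<H>2"
abbreviation "W1 \<equiv> weyl_group D1"
abbreviation "W2 \<equiv> weyl_group D2"

lemma morphism_data: "central_morphism_data D1 D2 f"
  using morphism by (simp add: central_morphism_def)

lemma f_additive: "additive f"
  using morphism_data by (simp add: central_morphism_data_def)

lemmas f_simps = additive.add[OF f_additive] additive.diff[OF f_additive] additive.minus[OF f_additive]
  additive.zero[OF f_additive] additive_zsmult[OF f_additive]

lemma f_span: "bij_betw f A1.root_span A2.root_span"
  and f_roots: "f ` root_datum.roots D1 = root_datum.roots D2"
  using morphism_data by (auto simp: central_morphism_data_def bij_betw_def)

text \<open>By the transpose of f, the pairing of f x with the coroot of f \<alpha> equals that of x
  with the coroot of \<alpha>.\<close>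

lemma f_reflection:
  assumes "\<alpha> \<in> root_datum.roots D1"
  shows "reflection D2 (f \<alpha>) (f x) = f (reflection D1 \<alpha> x)"
proof -
  obtain ft where "\<And>x y. pairing D2 (f x) y = pairing D1 x (ft y)"
    "\<And>\<alpha>. \<alpha> \<in> root_datum.roots D1 \<Longrightarrow> ft (coroot D2 (f \<alpha>)) = coroot D1 \<alpha>"
    using morphism_data unfolding central_morphism_data_def by blast
  then show ?thesis using assms by (simp add: reflection_def f_simps)
qed

lemma f_eqD: "f x = f y \<Longrightarrow> x - y \<in> A1.root_span \<Longrightarrow> x = y"
  using inj_onD[OF bij_betw_imp_inj_on[OF f_span], of "x - y" 0] by (simp add: f_simps zmod.span_zero)

lemma \<phi>_hom: "\<phi> \<in> ring_hom H1 H2" "\<phi> \<in> module_homs complex_ring H1 H2"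
  using morphism by (simp_all add: central_morphism_def algebra_homs_def)

lemmas \<phi>_closed [simp] = ring_hom_closed[OF \<phi>_hom(1)]
lemmas \<phi>_simps = ring_hom_add[OF \<phi>_hom(1)] ring_hom_mult[OF \<phi>_hom(1)] ring_hom_one[OF \<phi>_hom(1)]
lemmas \<phi>_smult = module_homsD(3)[OF \<phi>_hom(2), simplified]

lemma \<phi>_basis_related:
  "w \<in> W1 \<Longrightarrow> w' \<in> W2 \<Longrightarrow> w' \<circ> f = f \<circ> w \<Longrightarrow> \<phi> (A1.basis (x, w)) = A2.basis (f x, w')"
  using morphism by (simp add: central_morphism_def A1.basis_def A2.basis_def)

lemma weyl_related_exists:
  assumes "w \<in> W1"
  shows "\<exists>w'\<in>W2. w' \<circ> f = f \<circ> w"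
  using assms
proof (induction w rule: A1.weyl_induct)
  case id
  have "id \<circ> f = f \<circ> id" by simp
  then show ?case using A2.weyl_id by blast
next
  case (step \<alpha> w)
  then obtain w' where w': "w' \<in> W2" "w' \<circ> f = f \<circ> w" by blast
  have "f \<alpha> \<in> root_datum.roots D2" using step(1) f_roots by blast
  then have "reflection D2 (f \<alpha>) \<circ> w' \<in> W2" using w'(1) by (intro A2.weyl_comp A2.weyl_reflection)
  moreover have "(reflection D2 (f \<alpha>) \<circ> w') \<circ> f = f \<circ> (reflection D1 \<alpha> \<circ> w)"
  proof
    fix x
    have "w' (f x) = f (w x)" using fun_cong[OF w'(2), of x] by simp
    then show "((reflection D2 (f \<alpha>) \<circ> w') \<circ> f) x = (f \<circ> (reflection D1 \<alpha> \<circ> w)) x"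
      using f_reflection[OF step(1), of "w x"] by simp
  qed
  ultimately show ?case by blast
qed

lemma weyl_related_exists':
  assumes "w' \<in> W2"
  shows "\<exists>w\<in>W1. w' \<circ> f = f \<circ> w"
  using assms
proof (induction w' rule: A2.weyl_induct)
  case id
  have "id \<circ> f = f \<circ> id" by simp
  then show ?case using A1.weyl_id by blast
next
  case (step \<beta> w')
  then obtain w where w: "w \<in> W1" "w' \<circ> f = f \<circ> w" by blast
  obtain \<alpha> where \<alpha>: "\<alpha> \<in> root_datum.roots D1" "\<beta> = f \<alpha>" using step(1) f_roots by blast
  then have "reflection D1 \<alpha> \<circ> w \<in> W1" using w(1) by (intro A1.weyl_comp A1.weyl_reflection)
  moreover have "(reflection D2 \<beta> \<circ> w') \<circ> f = f \<circ> (reflection D1 \<alpha> \<circ> w)"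
  proof
    fix x
    have "w' (f x) = f (w x)" using fun_cong[OF w(2), of x] by simp
    then show "((reflection D2 \<beta> \<circ> w') \<circ> f) x = (f \<circ> (reflection D1 \<alpha> \<circ> w)) x"
      using f_reflection[OF \<alpha>(1), of "w x"] \<alpha>(2) by simp
  qed
  ultimately show ?case by blast
qed

text \<open>The identification of the two Weyl groups; \<open>\<omega>_unique\<close> shows that
  there is no real choice.\<close>

definition \<omega> :: "('x1 \<Rightarrow> 'x1) \<Rightarrow> 'x2 \<Rightarrow> 'x2" where
  "\<omega> w = (SOME w'. w' \<in> W2 \<and> w' \<circ> f = f \<circ> w)"

lemma \<omega>: "w \<in> W1 \<Longrightarrow> \<omega> w \<in> W2" "w \<in> W1 \<Longrightarrow> \<omega> w \<circ> f = f \<circ> w"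
  using someI_ex[of "\<lambda>w'. w' \<in> W2 \<and> w' \<circ> f = f \<circ> w"] weyl_related_exists[of w]
  unfolding \<omega>_def by blast+

text \<open>An element of \<open>W2\<close> is determined by its values on \<open>range f\<close> because \<open>\<phi>\<close> is a function
  and \<open>\<theta>\<^sub>0 T\<^sub>w\<close> are basis elements.\<close>

lemma \<omega>_unique:
  assumes "w \<in> W1" "w' \<in> W2" "w' \<circ> f = f \<circ> w"
  shows "w' = \<omega> w"
proof -
  have "A2.basis (f 0, w') = A2.basis (f 0, \<omega> w)"
    using \<phi>_basis_related[OF assms, of 0] \<phi>_basis_related[OF assms(1) \<omega>[OF assms(1)], of 0] by simp
  then have "A2.coef (A2.basis (f 0, w')) (f 0, w') = A2.coef (A2.basis (f 0, \<omega> w)) (f 0, w')" by simp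
  then show ?thesis
    unfolding A2.coef_basis[OF assms(2)] A2.coef_basis[OF \<omega>(1)[OF assms(1)]]
    by (simp split: if_splits)
qed

text \<open>The points v x and w x differ by an element of the root lattice, on which f is
  injective.\<close>

lemma \<omega>_inj: "inj_on \<omega> W1"
proof (rule inj_onI, rule ext)
  fix v w x assume v: "v \<in> W1" and w: "w \<in> W1" and eq: "\<omega> v = \<omega> w"
  have "f (v x) = f (w x)" using fun_cong[OF \<omega>(2)[OF v], of x] fun_cong[OF \<omega>(2)[OF w], of x] eq by simp
  moreover have "(v x - x) - (w x - x) \<in> A1.root_span"
    using A1.weyl_diff_span[OF v] A1.weyl_diff_span[OF w] by (rule zmod.span_diff)
  ultimately show "v x = w x" using f_eqD by simp
qed

lemma \<omega>_surj: "w' \<in> W2 \<Longrightarrow> \<exists>w\<in>W1. w' = \<omega> w"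
  using weyl_related_exists'[of w'] \<omega>_unique by blast

lemma \<omega>_inv: "w \<in> W1 \<Longrightarrow> inv_into W1 \<omega> (\<omega> w) = w"
  using \<omega>_inj by (rule inv_into_f_f)

lemma \<phi>_basis: "w \<in> W1 \<Longrightarrow> \<phi> (A1.basis (x, w)) = A2.basis (f x, \<omega> w)"
  using \<phi>_basis_related \<omega> by blast

lemma \<omega>_id: "\<omega> id = id"
  using \<omega>_unique[OF A1.weyl_id A2.weyl_id] by simp

lemma \<phi>_theta: "\<phi> (\<theta>1 x) = \<theta>2 (f x)"
  using \<phi>_basis[OF A1.weyl_id, of x] unfolding A1.theta_basis A2.theta_basis \<omega>_id .

subsection \<open>Partial sections of a central morphism\<close>

definition sec :: "'x1 set \<Rightarrow> 'h2 \<Rightarrow> 'h1" where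
  "sec Y = A2.lin_ext H1 (\<lambda>(y, w'). if y \<in> f ` Y
     then A1.basis (inv_into Y f y, inv_into W1 \<omega> w') else \<zero>\<^bsub>H1\<^esub>)"

lemma sec:
  "sec Y \<in> module_homs complex_ring H2 H1"
  "w \<in> W1 \<Longrightarrow> x \<in> Y \<Longrightarrow> sec Y (A2.basis (f x, \<omega> w)) = A1.basis (inv_into Y f (f x), w)"
proof -
  let ?B = "\<lambda>(y, w'). if y \<in> f ` Y then A1.basis (inv_into Y f y, inv_into W1 \<omega> w') else \<zero>\<^bsub>H1\<^esub>"
  have "inv_into W1 \<omega> w' \<in> W1" if "w' \<in> W2" for w'
    using \<omega>_surj[OF that] by (auto simp: \<omega>_inv)
  then have B: "\<And>y w'. w' \<in> W2 \<Longrightarrow> ?B (y, w') \<in> carrier H1" by simp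
  show "sec Y \<in> module_homs complex_ring H2 H1"
    unfolding sec_def by (rule A2.lin_ext(1)[where B = ?B, OF A1.V.complex_module_axioms B])
  show "sec Y (A2.basis (f x, \<omega> w)) = A1.basis (inv_into Y f (f x), w)" if "w \<in> W1" "x \<in> Y"
    using A2.lin_ext(2)[where B = ?B, OF A1.V.complex_module_axioms B \<omega>(1)[OF that(1)], of "f x"] that(2)
    unfolding sec_def by (simp add: \<omega>_inv[OF that(1)])
qed

lemma sec_outside:
  assumes "w' \<in> W2" "y \<notin> f ` Y"
  shows "sec Y (A2.basis (y, w')) = \<zero>\<^bsub>H1\<^esub>"
proof -
  have "inv_into W1 \<omega> w' \<in> W1" if "w' \<in> W2" for w'
    using \<omega>_surj[OF that] by (auto simp: \<omega>_inv)
  then show ?thesis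
    unfolding sec_def using assms by (subst A2.lin_ext(2)) (auto intro: A1.V.complex_module_axioms)
qed

lemma \<phi>_sec:
  assumes "z \<in> A2.pieces (f ` Y)"
  shows "\<phi> (sec Y z) = z" "sec Y z \<in> A1.pieces Y"
proof -
  have "A2.pieces (f ` Y) \<subseteq> {z \<in> carrier H2. \<phi> (sec Y z) = z}"
  proof (rule A2.pieces_subset)
    show "submodule {z \<in> carrier H2. \<phi> (sec Y z) = z} complex_ring H2"
      by (rule submodule_equalizer[OF A2.V.complex_module_axioms A2.V.complex_module_axioms
            module_homs_comp[OF sec(1) \<phi>_hom(2)] id_hom[OF A2.V.complex_module_axioms]])
    fix y w' assume y: "y \<in> f ` Y" and w': "w' \<in> W2"
    obtain w where w: "w \<in> W1" "w' = \<omega> w" using \<omega>_surj[OF w'] by blast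
    obtain x where x: "x \<in> Y" "y = f x" using y by blast
    have "f (inv_into Y f (f x)) = f x" using x(1) by (intro f_inv_into_f) blast
    then have "\<phi> (sec Y (A2.basis (y, w'))) = A2.basis (y, w')"
      unfolding w(2) x(2) sec(2)[OF w(1) x(1)] \<phi>_basis[OF w(1)] by simp
    then show "A2.basis (y, w') \<in> {z \<in> carrier H2. \<phi> (sec Y z) = z}" using w' by simp
  qed
  then show "\<phi> (sec Y z) = z" using assms by blast
  have "A2.pieces (f ` Y) \<subseteq> {z \<in> carrier H2. sec Y z \<in> A1.pieces Y}"
  proof (rule A2.pieces_subset)
    show "submodule {z \<in> carrier H2. sec Y z \<in> A1.pieces Y} complex_ring H2"
      by (rule submodule_linear_preimage[OF A2.V.complex_module_axioms A1.V.complex_module_axioms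
            sec(1) A1.submodule_pieces])
    fix y w' assume y: "y \<in> f ` Y" and w': "w' \<in> W2"
    obtain w where w: "w \<in> W1" "w' = \<omega> w" using \<omega>_surj[OF w'] by blast
    obtain x where x: "x \<in> Y" "y = f x" using y by blast
    have "inv_into Y f (f x) \<in> Y" using x(1) by (intro inv_into_into) blast
    then have "sec Y (A2.basis (y, w')) \<in> A1.pieces Y"
      unfolding w(2) x(2) sec(2)[OF w(1) x(1)] using w(1) by (rule A1.basis_pieces)
    then show "A2.basis (y, w') \<in> {z \<in> carrier H2. sec Y z \<in> A1.pieces Y}" using w' by simp
  qed
  then show "sec Y z \<in> A1.pieces Y" using assms by blast
qed

lemma sec_\<phi>:
  assumes inj: "inj_on f Y" and "a \<in> A1.pieces Y"
  shows "sec Y (\<phi> a) = a"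
proof -
  have "A1.pieces Y \<subseteq> {a \<in> carrier H1. sec Y (\<phi> a) = a}"
  proof (rule A1.pieces_subset)
    show "submodule {a \<in> carrier H1. sec Y (\<phi> a) = a} complex_ring H1"
      by (rule submodule_equalizer[OF A1.V.complex_module_axioms A1.V.complex_module_axioms
            module_homs_comp[OF \<phi>_hom(2) sec(1)] id_hom[OF A1.V.complex_module_axioms]])
    fix x w assume "x \<in> Y" "w \<in> W1"
    then show "A1.basis (x, w) \<in> {a \<in> carrier H1. sec Y (\<phi> a) = a}"
      using inv_into_f_f[OF inj] by (simp add: \<phi>_basis sec(2))
  qed
  then show ?thesis using assms(2) by blast
qed

lemma inj_on_coset: "inj_on f (A1.coset y)"
proof (rule inj_onI)
  fix x x' assume "x \<in> A1.coset y" "x' \<in> A1.coset y" "f x = f x'"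
  then show "x = x'" using zmod.span_diff[of "x - y" _ "x' - y"] f_eqD[of x x'] by simp
qed

lemma f_coset: "f ` A1.coset y = A2.coset (f y)"
proof (intro equalityI subsetI)
  fix z assume "z \<in> f ` A1.coset y"
  then obtain x where x: "x - y \<in> A1.root_span" "z = f x" by blast
  then have "f (x - y) \<in> A2.root_span" using bij_betw_apply[OF f_span] by blast
  then show "z \<in> A2.coset (f y)" using x by (simp add: f_simps)
next
  fix z assume "z \<in> A2.coset (f y)"
  then have "z - f y \<in> f ` A1.root_span" using f_span by (simp add: bij_betw_def)
  then obtain r where r: "r \<in> A1.root_span" "z - f y = f r" by blast
  then have "z = f (r + y)" by (simp add: f_simps algebra_simps)
  moreover have "r + y \<in> A1.coset y" using r(1) by simp
  ultimately show "z \<in> f ` A1.coset y" by blast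
qed

lemma \<phi>_pieces:
  assumes "a \<in> A1.pieces Y"
  shows "\<phi> a \<in> A2.pieces (f ` Y)"
proof -
  have "A1.pieces Y \<subseteq> {a \<in> carrier H1. \<phi> a \<in> A2.pieces (f ` Y)}"
  proof (rule A1.pieces_subset)
    show "submodule {a \<in> carrier H1. \<phi> a \<in> A2.pieces (f ` Y)} complex_ring H1"
      by (rule submodule_linear_preimage[OF A1.V.complex_module_axioms A2.V.complex_module_axioms
            \<phi>_hom(2) A2.submodule_pieces])
  qed (auto simp: \<phi>_basis \<omega>(1) intro!: A2.basis_pieces)
  then show ?thesis using assms by blast
qed

text \<open>Identities within one graded piece of H1 can be checked in H2, where conjugation is an
  honest operation. All properties of the lifts are obtained this way.\<close>

lemma \<phi>_inj_piece:
  assumes "a \<in> A1.pieces (A1.coset y)" "b \<in> A1.pieces (A1.coset y)" "\<phi> a = \<phi> b"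
  shows "a = b"
proof -
  have "sec (A1.coset y) (\<phi> a) = sec (A1.coset y) (\<phi> b)" by (simp only: assms(3))
  then show ?thesis
    by (simp only: sec_\<phi>[OF inj_on_coset assms(1)] sec_\<phi>[OF inj_on_coset assms(2)])
qed

lemma basis_coset: "w \<in> W1 \<Longrightarrow> A1.basis (x, w) \<in> A1.pieces (A1.coset x)"
  by (rule A1.basis_pieces) (simp_all add: zmod.span_zero)

subsection \<open>Conjugation by lattice elements\<close>

abbreviation conj :: "'x2 \<Rightarrow> 'h2 \<Rightarrow> 'h2" where
  "conj g z \<equiv> \<theta>2 (- g) \<otimes>\<^bsub>H2\<^esub> z \<otimes>\<^bsub>H2\<^esub> \<theta>2 g"

lemma theta_inv: "inv\<^bsub>H2\<^esub> (\<theta>2 g) = \<theta>2 (- g)"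
  by (rule A2.inv_char) (simp_all add: A2.theta_mult A2.theta_0)

lemma conj_hom: "conj g \<in> module_homs complex_ring H2 H2"
  unfolding module_homs_def
  by (auto simp: A2.r_distr A2.l_distr A2.smult_mult)

text \<open>The two factors shift the degree by - g and by g, and degrees add in an abelian
  group.\<close>

lemma conj_pieces:
  assumes "z \<in> A2.pieces (A2.coset y)"
  shows "conj g z \<in> A2.pieces (A2.coset y)"
proof -
  have "\<theta>2 (- g) \<otimes>\<^bsub>H2\<^esub> z \<in> A2.pieces (A2.coset (y - g))"
    by (rule A2.theta_mult_pieces[OF assms]) (simp add: algebra_simps)
  moreover have "\<theta>2 g \<in> A2.pieces {g}"
    unfolding A2.theta_basis by (rule A2.basis_pieces) (simp_all add: A2.weyl_id)
  ultimately show ?thesis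
  proof (rule A2.pieces_mult)
    fix x x' assume x: "x \<in> A2.coset (y - g)" "x' \<in> {g}"
    show "A2.coset (x + x') \<subseteq> A2.coset y"
    proof
      fix z assume "z \<in> A2.coset (x + x')"
      then have "(z - (x + x')) + (x - (y - g)) \<in> A2.root_span" using x by (intro zmod.span_add) simp_all
      then show "z \<in> A2.coset y" using x by (simp add: algebra_simps)
    qed
  qed
qed

lemma is_conj_lift_iff:
  "is_conj_lift \<H>1 \<H>2 \<phi> (\<theta>2 g) \<psi> \<longleftrightarrow>
    \<psi> \<in> extensional (carrier H1) \<and> \<psi> \<in> module_homs complex_ring H1 H1 \<and>
    (\<forall>a\<in>carrier H1. \<phi> (\<psi> a) = conj g (\<phi> a)) \<and>
    (\<forall>y. \<psi> ` A1.pieces (A1.coset y) \<subseteq> A1.pieces (A1.coset y))"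
  unfolding is_conj_lift_def theta_inv A1.graded_piece_eq ..

text \<open>The conjugate of the image of a basis element over x stays in the image of the piece of
  x, where \<open>sec\<close> of that coset supplies a preimage. The linear extension of these
  values is restricted to the carrier to make it extensional.\<close>

lemma conj_lift_exists: "\<exists>\<psi>. is_conj_lift \<H>1 \<H>2 \<phi> (\<theta>2 g) \<psi>"
proof -
  define B where "B = (\<lambda>(x, w). sec (A1.coset x) (conj g (\<phi> (A1.basis (x, w)))))"
  define L where "L = A1.lin_ext H1 B"
  have conj: "conj g (\<phi> (A1.basis (x, w))) \<in> A2.pieces (f ` A1.coset x)" if "w \<in> W1" for x w
    unfolding f_coset using \<phi>_pieces[OF basis_coset[OF that, of x]]
    unfolding f_coset by (rule conj_pieces)
  have B: "B (x, w) \<in> A1.pieces (A1.coset x)" "\<phi> (B (x, w)) = conj g (\<phi> (A1.basis (x, w)))"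
    if "w \<in> W1" for x w
    using \<phi>_sec[OF conj[OF that, of x]] by (simp_all add: B_def)
  have BH: "B (x, w) \<in> carrier H1" if "w \<in> W1" for x w using B(1)[OF that] by (rule A1.pieces_closed)
  have L: "L \<in> module_homs complex_ring H1 H1" "\<And>x w. w \<in> W1 \<Longrightarrow> L (A1.basis (x, w)) = B (x, w)"
    unfolding L_def using A1.lin_ext[where B = B, OF A1.V.complex_module_axioms BH] by auto
  have "\<phi> (L a) = conj g (\<phi> a)" if "a \<in> carrier H1" for a
    using that
    by (rule A1.linear_eq_on_basis[OF A2.V.complex_module_axioms
          module_homs_comp[OF L(1) \<phi>_hom(2)] module_homs_comp[OF \<phi>_hom(2) conj_hom], rotated])
      (simp add: L(2) B(2))
  moreover have "L a \<in> A1.pieces (A1.coset y)" if "a \<in> A1.pieces (A1.coset y)" for a y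
  proof -
    have "A1.pieces (A1.coset y) \<subseteq> {a \<in> carrier H1. L a \<in> A1.pieces (A1.coset y)}"
    proof (rule A1.pieces_subset)
      show "submodule {a \<in> carrier H1. L a \<in> A1.pieces (A1.coset y)} complex_ring H1"
        by (rule submodule_linear_preimage[OF A1.V.complex_module_axioms A1.V.complex_module_axioms
              L(1) A1.submodule_pieces])
      fix x w assume x: "x \<in> A1.coset y" and w: "w \<in> W1"
      have "A1.coset x \<subseteq> A1.coset y"
      proof
        fix z assume "z \<in> A1.coset x"
        then have "(z - x) + (x - y) \<in> A1.root_span" using x by (intro zmod.span_add) simp_all
        then show "z \<in> A1.coset y" by simp
      qed
      then show "A1.basis (x, w) \<in> {a \<in> carrier H1. L a \<in> A1.pieces (A1.coset y)}"
        using B(1)[OF w, of x] A1.pieces_mono w by (auto simp: L(2))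
    qed
    then show ?thesis using that by blast
  qed
  moreover have "restrict L (carrier H1) \<in> module_homs complex_ring H1 H1"
    using module_homsD[OF L(1)] by (auto simp: module_homs_def)
  ultimately have "is_conj_lift \<H>1 \<H>2 \<phi> (\<theta>2 g) (restrict L (carrier H1))"
    unfolding is_conj_lift_iff using A1.pieces_closed by auto
  then show ?thesis by (rule exI[of _ "restrict L (carrier H1)"])
qed

text \<open>Both lifts of a basis element lie in its graded piece and have the same image under
  \<phi>.\<close>

lemma conj_lift_unique:
  assumes "is_conj_lift \<H>1 \<H>2 \<phi> (\<theta>2 g) \<psi>" "is_conj_lift \<H>1 \<H>2 \<phi> (\<theta>2 g) \<psi>'"
  shows "\<psi> = \<psi>'"
proof
  have *: "\<psi> \<in> module_homs complex_ring H1 H1" "\<psi>' \<in> module_homs complex_ring H1 H1"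
    "\<psi> \<in> extensional (carrier H1)" "\<psi>' \<in> extensional (carrier H1)"
    using assms by (simp_all add: is_conj_lift_iff)
  fix a
  show "\<psi> a = \<psi>' a"
  proof (cases "a \<in> carrier H1")
    case True
    then show ?thesis
    proof (rule A1.linear_eq_on_basis[OF A1.V.complex_module_axioms *(1,2), rotated])
      fix x w assume w: "w \<in> W1"
      show "\<psi> (A1.basis (x, w)) = \<psi>' (A1.basis (x, w))"
      proof (rule \<phi>_inj_piece)
        show "\<psi> (A1.basis (x, w)) \<in> A1.pieces (A1.coset x)" "\<psi>' (A1.basis (x, w)) \<in> A1.pieces (A1.coset x)"
          using assms basis_coset[OF w, of x] unfolding is_conj_lift_iff by blast+
        show "\<phi> (\<psi> (A1.basis (x, w))) = \<phi> (\<psi>' (A1.basis (x, w)))"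
          using assms w by (simp add: is_conj_lift_iff)
      qed
    qed
  next
    case False
    then show ?thesis using *(3,4) by (simp add: extensional_def)
  qed
qed

abbreviation clift :: "'x2 \<Rightarrow> 'h1 \<Rightarrow> 'h1" where
  "clift g \<equiv> conj_lift \<H>1 \<H>2 \<phi> (\<theta>2 g)"

lemma is_conj_lift_clift: "is_conj_lift \<H>1 \<H>2 \<phi> (\<theta>2 g) (clift g)"
  unfolding conj_lift_def using conj_lift_exists conj_lift_unique by (metis theI)

lemma clift_linear: "clift g \<in> module_homs complex_ring H1 H1"
  and \<phi>_clift: "a \<in> carrier H1 \<Longrightarrow> \<phi> (clift g a) = conj g (\<phi> a)"
  and clift_pieces: "a \<in> A1.pieces (A1.coset y) \<Longrightarrow> clift g a \<in> A1.pieces (A1.coset y)"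
  using is_conj_lift_clift[of g] by (auto simp: is_conj_lift_iff)

lemmas cliftD = module_homsD[OF clift_linear, simplified]

text \<open>The conjugation identity without inverses, for moving \<open>\<phi> a\<close> past
  \<theta>_g inside a tensor.\<close>

lemma theta_\<phi>_clift:
  assumes "a \<in> carrier H1"
  shows "\<theta>2 g \<otimes>\<^bsub>H2\<^esub> \<phi> (clift g a) = \<phi> a \<otimes>\<^bsub>H2\<^esub> \<theta>2 g"
proof -
  have "\<theta>2 g \<otimes>\<^bsub>H2\<^esub> \<phi> (clift g a) = (\<theta>2 g \<otimes>\<^bsub>H2\<^esub> \<theta>2 (- g)) \<otimes>\<^bsub>H2\<^esub> (\<phi> a \<otimes>\<^bsub>H2\<^esub> \<theta>2 g)"
    using assms by (simp only: \<phi>_clift A2.m_assoc A2.theta_closed \<phi>_closed A2.m_closed)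
  then show ?thesis using assms by (simp add: A2.theta_mult A2.theta_0)
qed

text \<open>Both sides lie in the piece of degree y + y', so they can be compared after applying
  \<phi>, where conjugation is multiplicative.\<close>

lemma clift_mult_pieces:
  assumes a: "a \<in> A1.pieces (A1.coset y)" and b: "b \<in> A1.pieces (A1.coset y')"
  shows "clift g (a \<otimes>\<^bsub>H1\<^esub> b) = clift g a \<otimes>\<^bsub>H1\<^esub> clift g b"
proof (rule \<phi>_inj_piece)
  have mult: "c \<otimes>\<^bsub>H1\<^esub> d \<in> A1.pieces (A1.coset (y + y'))"
    if "c \<in> A1.pieces (A1.coset y)" "d \<in> A1.pieces (A1.coset y')" for c d
    using that
  proof (rule A1.pieces_mult)
    fix x x' assume x: "x \<in> A1.coset y" "x' \<in> A1.coset y'"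
    show "A1.coset (x + x') \<subseteq> A1.coset (y + y')"
    proof
      fix z assume "z \<in> A1.coset (x + x')"
      then have "(z - (x + x')) + ((x - y) + (x' - y')) \<in> A1.root_span"
        using x by (intro zmod.span_add) simp_all
      then show "z \<in> A1.coset (y + y')" by (simp add: algebra_simps)
    qed
  qed
  show "clift g (a \<otimes>\<^bsub>H1\<^esub> b) \<in> A1.pieces (A1.coset (y + y'))" using mult[OF a b] by (rule clift_pieces)
  show "clift g a \<otimes>\<^bsub>H1\<^esub> clift g b \<in> A1.pieces (A1.coset (y + y'))"
    using clift_pieces[OF a] clift_pieces[OF b] by (rule mult)
  have H: "a \<in> carrier H1" "b \<in> carrier H1" using a b A1.pieces_closed by auto
  have pH: "\<phi> a \<in> carrier H2" "\<phi> b \<in> carrier H2" using H by auto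
  have "conj g (\<phi> a) \<otimes>\<^bsub>H2\<^esub> conj g (\<phi> b) =
      (\<theta>2 (- g) \<otimes>\<^bsub>H2\<^esub> \<phi> a) \<otimes>\<^bsub>H2\<^esub> (\<theta>2 g \<otimes>\<^bsub>H2\<^esub> \<theta>2 (- g)) \<otimes>\<^bsub>H2\<^esub> (\<phi> b \<otimes>\<^bsub>H2\<^esub> \<theta>2 g)"
    using pH by (simp only: A2.m_assoc A2.theta_closed A2.m_closed)
  also have "\<dots> = conj g (\<phi> (a \<otimes>\<^bsub>H1\<^esub> b))"
    using pH H by (simp add: A2.theta_mult A2.theta_0 A2.m_assoc \<phi>_simps)
  finally show "\<phi> (clift g (a \<otimes>\<^bsub>H1\<^esub> b)) = \<phi> (clift g a \<otimes>\<^bsub>H1\<^esub> clift g b)"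
    using H cliftD(1) by (simp add: \<phi>_clift \<phi>_simps)
qed

text \<open>Elements that are not homogeneous cannot be compared through \<phi>. The identity is
  therefore extended from basis elements, one argument at a time.\<close>

lemma clift_mult:
  assumes a: "a \<in> carrier H1" and b: "b \<in> carrier H1"
  shows "clift g (a \<otimes>\<^bsub>H1\<^esub> b) = clift g a \<otimes>\<^bsub>H1\<^esub> clift g b"
proof -
  have left: "(\<lambda>a. clift g (a \<otimes>\<^bsub>H1\<^esub> b)) \<in> module_homs complex_ring H1 H1"
    "(\<lambda>a. clift g a \<otimes>\<^bsub>H1\<^esub> clift g b) \<in> module_homs complex_ring H1 H1" if "b \<in> carrier H1" for b
    using that cliftD by (auto simp: module_homs_def A1.l_distr A1.smult_mult)
  have right: "(\<lambda>b. clift g (a \<otimes>\<^bsub>H1\<^esub> b)) \<in> module_homs complex_ring H1 H1"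
    "(\<lambda>b. clift g a \<otimes>\<^bsub>H1\<^esub> clift g b) \<in> module_homs complex_ring H1 H1" if "a \<in> carrier H1" for a
    using that cliftD by (auto simp: module_homs_def A1.r_distr A1.smult_mult)
  have 1: "clift g (A1.basis (x, w) \<otimes>\<^bsub>H1\<^esub> b) = clift g (A1.basis (x, w)) \<otimes>\<^bsub>H1\<^esub> clift g b"
    if w: "w \<in> W1" for x w
    using b
  proof (rule A1.linear_eq_on_basis[OF A1.V.complex_module_axioms right, rotated 3])
    fix x' w' assume "w' \<in> W1"
    then show "clift g (A1.basis (x, w) \<otimes>\<^bsub>H1\<^esub> A1.basis (x', w')) =
        clift g (A1.basis (x, w)) \<otimes>\<^bsub>H1\<^esub> clift g (A1.basis (x', w'))"
      using clift_mult_pieces basis_coset w by blast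
  qed (use w in simp_all)
  show ?thesis
    using a by (rule A1.linear_eq_on_basis[OF A1.V.complex_module_axioms left[OF b], rotated]) (rule 1)
qed

text \<open>In H2 lattice elements commute with \<theta>_g.\<close>

lemma clift_theta: "clift g (\<theta>1 x) = \<theta>1 x"
proof (rule \<phi>_inj_piece)
  show mem: "\<theta>1 x \<in> A1.pieces (A1.coset x)"
    unfolding A1.theta_basis using A1.weyl_id by (rule basis_coset)
  then show "clift g (\<theta>1 x) \<in> A1.pieces (A1.coset x)" by (rule clift_pieces)
  show "\<phi> (clift g (\<theta>1 x)) = \<phi> (\<theta>1 x)"
    by (simp add: \<phi>_clift \<phi>_theta A2.theta_mult)
qed

lemma clift_ring_hom: "clift g \<in> ring_hom H1 H1"
  using cliftD clift_mult clift_theta[of g 0] by (intro ring_hom_memI) (auto simp: A1.theta_0)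

lemma clift_lattice:
  assumes "a \<in> lattice_algebra \<H>1"
  shows "clift g a = a"
proof -
  have "A1.lattice_pieces UNIV \<subseteq> {a \<in> carrier H1. clift g a = a}"
    by (rule A1.lattice_pieces_subset[OF submodule_equalizer[OF A1.V.complex_module_axioms
            A1.V.complex_module_axioms clift_linear id_hom[OF A1.V.complex_module_axioms]]])
      (simp add: clift_theta)
  then show ?thesis using assms by (auto simp: A1.lattice_algebra_eq)
qed

text \<open>Lifts for g and - g are mutually inverse, which makes each of them a bijection of
  H1.\<close>

lemma clift_clift:
  assumes "a \<in> carrier H1"
  shows "clift (- g) (clift g a) = a"
  using assms
proof (rule A1.linear_eq_on_basis[OF A1.V.complex_module_axioms
      module_homs_comp[OF clift_linear clift_linear] id_hom[OF A1.V.complex_module_axioms], rotated])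
  fix x w assume w: "w \<in> W1"
  let ?b = "A1.basis (x, w)"
  show "clift (- g) (clift g ?b) = ?b"
  proof (rule \<phi>_inj_piece)
    show "clift (- g) (clift g ?b) \<in> A1.pieces (A1.coset x)" "?b \<in> A1.pieces (A1.coset x)"
      using basis_coset[OF w] by (auto intro!: clift_pieces)
    have b: "\<phi> ?b \<in> carrier H2" using w by simp
    have "\<phi> (clift (- g) (clift g ?b)) = (\<theta>2 g \<otimes>\<^bsub>H2\<^esub> \<theta>2 (- g)) \<otimes>\<^bsub>H2\<^esub> \<phi> ?b \<otimes>\<^bsub>H2\<^esub> (\<theta>2 g \<otimes>\<^bsub>H2\<^esub> \<theta>2 (- g))"
      using b w cliftD(1) by (simp add: \<phi>_clift A2.m_assoc)
    then show "\<phi> (clift (- g) (clift g ?b)) = \<phi> ?b" using b by (simp add: A2.theta_mult A2.theta_0)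
  qed
qed

lemma clift_image: "clift g ` carrier H1 = carrier H1"
proof
  show "clift g ` carrier H1 \<subseteq> carrier H1" using cliftD(1) by blast
  show "carrier H1 \<subseteq> clift g ` carrier H1"
  proof
    fix a assume "a \<in> carrier H1"
    then have "a = clift g (clift (- g) a)" "clift (- g) a \<in> carrier H1"
      using clift_clift[of a "- g"] cliftD(1) by simp_all
    then show "a \<in> clift g ` carrier H1" by blast
  qed
qed

end

section \<open>Restriction of induced modules\<close>

context left_module begin

text \<open>The N-component of a vector is unique because N and C meet in zero. Uniqueness makes the
  chosen function additive and linear.\<close>

lemma exists_projection:
  assumes N: "submodule N R M" and C: "submodule C R M"
    and int: "N \<inter> C = {\<zero>\<^bsub>M\<^esub>}" and sum: "submodule_sum N C = carrier M"
  obtains u where "\<And>v. v \<in> carrier M \<Longrightarrow> u v \<in> N" "\<And>v. v \<in> N \<Longrightarrow> u v = v"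
    and "\<And>v w. v \<in> carrier M \<Longrightarrow> w \<in> carrier M \<Longrightarrow> u (v \<oplus>\<^bsub>M\<^esub> w) = u v \<oplus>\<^bsub>M\<^esub> u w"
    and "\<And>a v. a \<in> carrier R \<Longrightarrow> v \<in> carrier M \<Longrightarrow> u (a \<odot>\<^bsub>M\<^esub> v) = a \<odot>\<^bsub>M\<^esub> u v"
proof -
  note n = submoduleD[OF N] and c = submoduleD[OF C]
  define u where "u v = (SOME x. x \<in> N \<and> (\<exists>y\<in>C. v = x \<oplus>\<^bsub>M\<^esub> y))" for v
  have ex: "\<exists>x. x \<in> N \<and> (\<exists>y\<in>C. v = x \<oplus>\<^bsub>M\<^esub> y)" if "v \<in> carrier M" for v
    using that unfolding sum[symmetric] submodule_sum_def by blast
  have u: "u v \<in> N" "\<exists>y\<in>C. v = u v \<oplus>\<^bsub>M\<^esub> y" if "v \<in> carrier M" for v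
    using someI_ex[OF ex[OF that]] unfolding u_def by blast+
  have unique: "u v = x" if "x \<in> N" "y \<in> C" "v = x \<oplus>\<^bsub>M\<^esub> y" for v x y
  proof -
    have "v \<in> carrier M" using that n(1) c(1) by auto
    then obtain z where z: "u v \<in> N" "z \<in> C" "v = u v \<oplus>\<^bsub>M\<^esub> z" using u by blast
    have car: "u v \<in> carrier M" "z \<in> carrier M" "x \<in> carrier M" "y \<in> carrier M"
      using z that n(1) c(1) by auto
    have "u v \<oplus>\<^bsub>M\<^esub> z = x \<oplus>\<^bsub>M\<^esub> y" using z(3) that(3) by (rule trans[OF sym])
    then have "u v \<ominus>\<^bsub>M\<^esub> x = y \<ominus>\<^bsub>M\<^esub> z" using car by (intro M.minus_eq_minus_if_add_eq_add) auto
    moreover have "u v \<ominus>\<^bsub>M\<^esub> x \<in> N" using z(1) that(1) by (rule n(6))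
    moreover have "y \<ominus>\<^bsub>M\<^esub> z \<in> C" using that(2) z(2) by (rule c(6))
    ultimately have "u v \<ominus>\<^bsub>M\<^esub> x = \<zero>\<^bsub>M\<^esub>" using int by auto
    then show "u v = x" using M.eq_if_minus_eq_zero car by blast
  qed
  show ?thesis
  proof (rule that[of u])
    show "u v \<in> N" if "v \<in> carrier M" for v using u(1)[OF that] .
    show "u v = v" if "v \<in> N" for v
      using unique[OF that c(2)] n(1) that by auto
    show "u (v \<oplus>\<^bsub>M\<^esub> w) = u v \<oplus>\<^bsub>M\<^esub> u w" if vw: "v \<in> carrier M" "w \<in> carrier M" for v w
    proof -
      obtain y z where y: "y \<in> C" "v = u v \<oplus>\<^bsub>M\<^esub> y" and z: "z \<in> C" "w = u w \<oplus>\<^bsub>M\<^esub> z"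
        using u(2) vw by meson
      have car: "u v \<in> carrier M" "y \<in> carrier M" "u w \<in> carrier M" "z \<in> carrier M"
        using u(1) vw y(1) z(1) n(1) c(1) by auto
      have "v \<oplus>\<^bsub>M\<^esub> w = (u v \<oplus>\<^bsub>M\<^esub> y) \<oplus>\<^bsub>M\<^esub> (u w \<oplus>\<^bsub>M\<^esub> z)" using y(2) z(2) by simp
      also have "\<dots> = (u v \<oplus>\<^bsub>M\<^esub> u w) \<oplus>\<^bsub>M\<^esub> (y \<oplus>\<^bsub>M\<^esub> z)" using car by (simp add: M.a_ac)
      finally show ?thesis
        using unique[OF n(3)[OF u(1)[OF vw(1)] u(1)[OF vw(2)]] c(3)[OF y(1) z(1)]] by blast
    qed
    show "u (a \<odot>\<^bsub>M\<^esub> v) = a \<odot>\<^bsub>M\<^esub> u v" if a: "a \<in> carrier R" and v: "v \<in> carrier M" for a v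
    proof -
      obtain y where y: "y \<in> C" "v = u v \<oplus>\<^bsub>M\<^esub> y" using u(2)[OF v] by blast
      have car: "u v \<in> carrier M" "y \<in> carrier M" using u(1)[OF v] y(1) n(1) c(1) by auto
      have "a \<odot>\<^bsub>M\<^esub> v = a \<odot>\<^bsub>M\<^esub> (u v \<oplus>\<^bsub>M\<^esub> y)" using y(2) by simp
      also have "\<dots> = a \<odot>\<^bsub>M\<^esub> u v \<oplus>\<^bsub>M\<^esub> a \<odot>\<^bsub>M\<^esub> y" using a car by (simp add: smult_r_distr)
      finally show ?thesis using unique[OF n(4)[OF a u(1)[OF v]] c(4)[OF a y(1)]] by blast
    qed
  qed
qed

text \<open>The complement is the kernel of u, and v = u v + (v - u v).\<close>

lemma complement_of_projection:
  assumes N: "submodule N R M" and u: "\<And>v. v \<in> carrier M \<Longrightarrow> u v \<in> N" "\<And>v. v \<in> N \<Longrightarrow> u v = v"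
    and add: "\<And>v w. v \<in> carrier M \<Longrightarrow> w \<in> carrier M \<Longrightarrow> u (v \<oplus>\<^bsub>M\<^esub> w) = u v \<oplus>\<^bsub>M\<^esub> u w"
    and smult: "\<And>a v. a \<in> carrier R \<Longrightarrow> v \<in> carrier M \<Longrightarrow> u (a \<odot>\<^bsub>M\<^esub> v) = a \<odot>\<^bsub>M\<^esub> u v"
  shows "\<exists>C. submodule C R M \<and> N \<inter> C = {\<zero>\<^bsub>M\<^esub>} \<and> submodule_sum N C = carrier M"
proof -
  note n = submoduleD[OF N]
  define C where "C = {v \<in> carrier M. u v = \<zero>\<^bsub>M\<^esub>}"
  have u0: "u \<zero>\<^bsub>M\<^esub> = \<zero>\<^bsub>M\<^esub>" using u(2) n(2) by blast
  have C: "submodule C R M"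
    by (rule submoduleI) (auto simp: C_def u0 add smult smult_closed smult_r_null)
  have "N \<inter> C = {\<zero>\<^bsub>M\<^esub>}" using n(1,2) u0 u(2) by (auto simp: C_def)
  moreover have "carrier M \<subseteq> submodule_sum N C"
  proof
    fix v assume v: "v \<in> carrier M"
    have uv: "u v \<in> N" "u v \<in> carrier M" using u(1)[OF v] n(1) by auto
    have w: "v \<ominus>\<^bsub>M\<^esub> u v \<in> carrier M" using v uv by simp
    have eq: "v = u v \<oplus>\<^bsub>M\<^esub> (v \<ominus>\<^bsub>M\<^esub> u v)"
      using M.add_minus_cancel(3)[OF v uv(2)] M.a_comm[OF uv(2) w] by simp
    have "u v \<oplus>\<^bsub>M\<^esub> u (v \<ominus>\<^bsub>M\<^esub> u v) = u v" using add[OF uv(2) w] eq u(2)[OF uv(1)] by simp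
    moreover have "u (v \<ominus>\<^bsub>M\<^esub> u v) \<in> carrier M" using u(1)[OF w] n(1) by blast
    ultimately have "u (v \<ominus>\<^bsub>M\<^esub> u v) = \<zero>\<^bsub>M\<^esub>" using uv(2) by simp
    then have "v \<ominus>\<^bsub>M\<^esub> u v \<in> C" using w by (simp add: C_def)
    then show "v \<in> submodule_sum N C" unfolding submodule_sum_def using eq uv(1) by blast
  qed
  moreover have "submodule_sum N C \<subseteq> carrier M"
    using submoduleD(1)[OF submodule_submodule_sum(1)[OF N C]] .
  ultimately show ?thesis using C by blast
qed

end

section \<open>Twists of the inducing module\<close>

locale hecke_induction = hecke_morphism \<H>1 \<H>2 f \<phi>
  for \<H>1 :: "('x1::ab_group_add, 'y1::ab_group_add, 'h1) hecke"
    and \<H>2 :: "('x2::ab_group_add, 'y2::ab_group_add, 'h2) hecke"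
    and f :: "'x1 \<Rightarrow> 'x2" and \<phi> :: "'h1 \<Rightarrow> 'h2" +
  fixes \<pi> :: "('h1, 'v) module" and S :: "'x2 set"
  assumes left_module_\<pi>: "left_module (alg \<H>1) \<pi>" and reps: "cokernel_reps f S"
begin

sublocale \<pi>: left_module H1 \<pi> by (rule left_module_\<pi>)

sublocale ind: induced_module H1 H2 \<pi> \<phi>
  by (intro induced_module.intro induced_module_axioms.intro A1.ring_axioms A2.ring_axioms
      left_module_\<pi> \<phi>_hom(1))

abbreviation "M \<equiv> Ind H1 H2 \<phi> \<pi>"
abbreviation "RM \<equiv> Res H1 \<phi> M"
abbreviation "tw g \<equiv> twist \<H>1 \<H>2 \<phi> \<pi> (\<theta>2 g)"
abbreviation "tens \<equiv> ind.tens"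

sublocale M: left_module H2 M by (rule ind.left_module_Ind)

lemma left_module_RM: "left_module H1 RM"
  using A1.ring_axioms ind.left_module_Ind \<phi>_hom(1) by (rule left_module_Res)

lemma left_module_tw: "left_module H1 (tw g)"
  unfolding twist_def using A1.ring_axioms left_module_\<pi> clift_ring_hom by (rule left_module_Res)

lemma tw_simps:
  "carrier (tw g) = carrier \<pi>" "\<zero>\<^bsub>tw g\<^esub> = \<zero>\<^bsub>\<pi>\<^esub>" "v \<oplus>\<^bsub>tw g\<^esub> w = v \<oplus>\<^bsub>\<pi>\<^esub> w"
  "a \<in> carrier H1 \<Longrightarrow> v \<in> carrier \<pi> \<Longrightarrow> a \<odot>\<^bsub>tw g\<^esub> v = clift g a \<odot>\<^bsub>\<pi>\<^esub> v"
  by (simp_all add: twist_def Res_simps)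

text \<open>As the lift is onto H1, the algebra acts by the same set of operators in both
  modules.\<close>

lemma submodule_tw_iff: "submodule N H1 (tw g) \<longleftrightarrow> submodule N H1 \<pi>"
proof -
  interpret tw: left_module H1 "tw g" by (rule left_module_tw)
  show ?thesis
  proof
    assume "submodule N H1 (tw g)"
    note n = tw.submoduleD[OF this, unfolded tw_simps(1-3)]
    show "submodule N H1 \<pi>"
    proof (rule \<pi>.submoduleI)
      fix a v assume a: "a \<in> carrier H1" and v: "v \<in> N"
      obtain b where b: "b \<in> carrier H1" "a = clift g b" using a clift_image by blast
      then show "a \<odot>\<^bsub>\<pi>\<^esub> v \<in> N" using n(4)[OF b(1) v] tw_simps(4)[OF b(1)] n(1) v by auto
    qed (use n in auto)
  next
    assume "submodule N H1 \<pi>"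
    note n = \<pi>.submoduleD[OF this]
    show "submodule N H1 (tw g)"
    proof (rule tw.submoduleI, unfold tw_simps(1-3))
      fix a v assume a: "a \<in> carrier H1" and v: "v \<in> N"
      show "a \<odot>\<^bsub>tw g\<^esub> v \<in> N"
        using n(4)[OF cliftD(1)[OF a] v] tw_simps(4)[OF a] n(1) v by auto
    qed (use n in auto)
  qed
qed

lemma simple_tw_iff: "simple_submodule P H1 (tw g) \<longleftrightarrow> simple_submodule P H1 \<pi>"
  unfolding simple_submodule_def submodule_tw_iff tw_simps(2) ..

lemma irreducible_tw: "irreducible_module H1 \<pi> \<Longrightarrow> irreducible_module H1 (tw g)"
  unfolding irreducible_module_iff simple_tw_iff tw_simps(1) using left_module_tw by blast

text \<open>An equality of records, not just an isomorphism: the restricted action is extensional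
  and sees only lattice elements, which the lift fixes.\<close>

lemma Res_lattice_tw:
  "Res (H1\<lparr>carrier := lattice_algebra \<H>1\<rparr>) id (tw g) = Res (H1\<lparr>carrier := lattice_algebra \<H>1\<rparr>) id \<pi>"
proof -
  have "a \<odot>\<^bsub>tw g\<^esub> v = a \<odot>\<^bsub>\<pi>\<^esub> v" if "a \<in> lattice_algebra \<H>1" "v \<in> carrier \<pi>" for a v
  proof -
    have "a \<in> carrier H1" using that(1) A1.lattice_piecesD(1) by (auto simp: A1.lattice_algebra_eq)
    then show ?thesis using that by (simp add: tw_simps(4) clift_lattice)
  qed
  then have "(\<lambda>a\<in>lattice_algebra \<H>1. \<lambda>v\<in>carrier \<pi>. a \<odot>\<^bsub>tw g\<^esub> v) =
      (\<lambda>a\<in>lattice_algebra \<H>1. \<lambda>v\<in>carrier \<pi>. a \<odot>\<^bsub>\<pi>\<^esub> v)"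
    by (intro restrict_ext) simp
  moreover have "monoid.mult (tw g) = monoid.mult \<pi>" "one (tw g) = one \<pi>" "add (tw g) = add \<pi>"
    by (simp_all add: twist_def Res_def)
  ultimately show ?thesis unfolding Res_def by (simp add: tw_simps)
qed

subsection \<open>Generators of the induced module\<close>

lemma S_decomp:
  obtains g x where "g \<in> S" "y = g + f x"
proof -
  obtain g where "g \<in> S" "y - g \<in> range f" using reps unfolding cokernel_reps_def by metis
  then show ?thesis using that by (metis add.commute diff_add_cancel imageE)
qed

lemma S_unique:
  assumes "g \<in> S" "g' \<in> S" "g - g' \<in> range f"
  shows "g = g'"
proof -
  have "g - g \<in> range f" using f_simps(4) by (metis cancel_comm_monoid_add_class.diff_cancel rangeI)
  then show ?thesis using reps assms unfolding cokernel_reps_def by blast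
qed

lemma range_f_diff: "x \<in> range f \<Longrightarrow> y \<in> range f \<Longrightarrow> x - y \<in> range f"
  by (auto simp: f_simps[symmetric])

lemma root_span_range: "r \<in> A2.root_span \<Longrightarrow> r \<in> range f"
  using f_span unfolding bij_betw_def by blast

text \<open>A basis element over y = g + f x is \<theta>_g times the image of one over x. So the
  \<theta>_g with g in S generate H2 as a right module over H1.\<close>

lemma H2_induct:
  assumes "b \<in> carrier H2" "\<zero>\<^bsub>H2\<^esub> \<in> V"
    and add: "\<And>a b. a \<in> carrier H2 \<Longrightarrow> b \<in> carrier H2 \<Longrightarrow> a \<in> V \<Longrightarrow> b \<in> V \<Longrightarrow> a \<oplus>\<^bsub>H2\<^esub> b \<in> V"
    and gen: "\<And>g a. g \<in> S \<Longrightarrow> a \<in> carrier H1 \<Longrightarrow> \<theta>2 g \<otimes>\<^bsub>H2\<^esub> \<phi> a \<in> V"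
  shows "b \<in> V"
  using assms(1-3)
proof (rule A2.basis_induct)
  fix c y w' assume "w' \<in> W2"
  then obtain w where w: "w \<in> W1" "w' = \<omega> w" using \<omega>_surj by blast
  obtain g x where g: "g \<in> S" "y = g + f x" by (rule S_decomp)
  have "c \<odot>\<^bsub>H2\<^esub> A2.basis (y, w') = \<theta>2 g \<otimes>\<^bsub>H2\<^esub> \<phi> (c \<odot>\<^bsub>H1\<^esub> A1.basis (x, w))"
    using w \<omega>(1)[OF w(1)] g(2) by (simp add: \<phi>_smult \<phi>_basis A2.smult_mult A2.theta_mult_basis)
  then show "c \<odot>\<^bsub>H2\<^esub> A2.basis (y, w') \<in> V" using gen[OF g(1)] w(1) by simp
qed

text \<open>This is where the twist comes from: \<open>\<phi> a\<close> passes \<theta>_g at the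
  cost of applying the lift, and the result crosses the tensor sign.\<close>

lemma smult_\<phi>_tens:
  assumes "a \<in> carrier H1" "v \<in> carrier \<pi>"
  shows "\<phi> a \<odot>\<^bsub>M\<^esub> tens (\<theta>2 g) v = tens (\<theta>2 g) (clift g a \<odot>\<^bsub>\<pi>\<^esub> v)"
proof -
  have "\<phi> a \<odot>\<^bsub>M\<^esub> tens (\<theta>2 g) v = tens (\<phi> a \<otimes>\<^bsub>H2\<^esub> \<theta>2 g) v"
    using assms by (simp add: ind.smult_tens)
  also have "\<dots> = tens (\<theta>2 g \<otimes>\<^bsub>H2\<^esub> \<phi> (clift g a)) v" by (simp only: theta_\<phi>_clift[OF assms(1)])
  also have "\<dots> = tens (\<theta>2 g) (clift g a \<odot>\<^bsub>\<pi>\<^esub> v)"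
    using assms by (intro ind.tens_balanced cliftD(1)) simp_all
  finally show ?thesis .
qed

lemma tens_hom: "tens (\<theta>2 g) \<in> module_homs H1 (tw g) RM"
  unfolding module_homs_def
  by (auto simp: Res_simps tw_simps ind.tens_add_right smult_\<phi>_tens ind.tens_closed)

lemma tens_zero:
  "v \<in> carrier \<pi> \<Longrightarrow> tens \<zero>\<^bsub>H2\<^esub> v = \<zero>\<^bsub>M\<^esub>" "b \<in> carrier H2 \<Longrightarrow> tens b \<zero>\<^bsub>\<pi>\<^esub> = \<zero>\<^bsub>M\<^esub>"
proof -
  show "tens \<zero>\<^bsub>H2\<^esub> v = \<zero>\<^bsub>M\<^esub>" if "v \<in> carrier \<pi>"
    using ind.tens_add_left[of "\<zero>\<^bsub>H2\<^esub>" "\<zero>\<^bsub>H2\<^esub>" v] ind.tens_closed[of "\<zero>\<^bsub>H2\<^esub>" v] that by simp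
  show "tens b \<zero>\<^bsub>\<pi>\<^esub> = \<zero>\<^bsub>M\<^esub>" if "b \<in> carrier H2"
    using ind.tens_add_right[of b "\<zero>\<^bsub>\<pi>\<^esub>" "\<zero>\<^bsub>\<pi>\<^esub>"] ind.tens_closed[of b "\<zero>\<^bsub>\<pi>\<^esub>"] that by simp
qed

lemma M_generated:
  assumes U: "\<zero>\<^bsub>M\<^esub> \<in> U" "\<And>C D. C \<in> U \<Longrightarrow> D \<in> U \<Longrightarrow> C \<oplus>\<^bsub>M\<^esub> D \<in> U" "\<And>C. C \<in> U \<Longrightarrow> \<ominus>\<^bsub>M\<^esub> C \<in> U"
    and gen: "\<And>g v. g \<in> S \<Longrightarrow> v \<in> carrier \<pi> \<Longrightarrow> tens (\<theta>2 g) v \<in> U"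
  shows "carrier M \<subseteq> U"
proof
  fix C assume "C \<in> carrier M"
  then show "C \<in> U"
  proof (induction C rule: ind.Ind_induct)
    case (minus C D)
    then show ?case using U(2,3) by (simp add: a_minus_def)
  next
    case (tens b v)
    have "b \<in> {b \<in> carrier H2. \<forall>v\<in>carrier \<pi>. tens b v \<in> U}"
      using tens(1)
    proof (rule H2_induct)
      fix g a assume g: "g \<in> S" and a: "a \<in> carrier H1"
      then show "\<theta>2 g \<otimes>\<^bsub>H2\<^esub> \<phi> a \<in> {b \<in> carrier H2. \<forall>v\<in>carrier \<pi>. tens b v \<in> U}"
        using gen[OF g] by (simp add: ind.tens_balanced \<pi>.smult_closed)
    qed (use U in \<open>auto simp: tens_zero ind.tens_add_left\<close>)
    then show ?case using tens(2) by blast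
  qed (rule U(1))
qed

text \<open>If N contains all simple submodules, its preimage in a twist under tensoring with
  \<theta>_g contains all simple submodules there, because their images are simple or zero. That
  preimage is therefore everything. Only generation by the images of the twists is used.\<close>

lemma simply_generated_RM:
  assumes "simply_generated H1 \<pi>"
  shows "simply_generated H1 RM"
  unfolding simply_generated_def
proof (intro allI impI)
  interpret RM: left_module H1 RM by (rule left_module_RM)
  fix N assume N: "submodule N H1 RM \<and> (\<forall>P. simple_submodule P H1 RM \<longrightarrow> P \<subseteq> N)"
  note n = RM.submoduleD[OF conjunct1[OF N], unfolded Res_simps(1-3)]
  have tens: "tens (\<theta>2 g) v \<in> N" if "v \<in> carrier \<pi>" for g v
  proof -
    interpret tw: left_module H1 "tw g" by (rule left_module_tw)
    let ?Q = "{v \<in> carrier (tw g). tens (\<theta>2 g) v \<in> N}"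
    have "submodule ?Q H1 (tw g)"
      using left_module_tw left_module_RM tens_hom tw.submodule_carrier conjunct1[OF N]
      by (rule submodule_preimage)
    moreover have "P \<subseteq> ?Q" if P: "simple_submodule P H1 \<pi>" for P
    proof -
      have Ptw: "simple_submodule P H1 (tw g)" using P by (simp only: simple_tw_iff)
      then have "P \<subseteq> carrier (tw g)" using tw.submoduleD(1) unfolding simple_submodule_def by blast
      moreover have "tens (\<theta>2 g) ` P = {\<zero>\<^bsub>RM\<^esub>} \<or> simple_submodule (tens (\<theta>2 g) ` P) H1 RM"
        using left_module_tw left_module_RM tens_hom Ptw by (rule simple_submodule_image)
      then have "tens (\<theta>2 g) ` P \<subseteq> N"
      proof
        assume "tens (\<theta>2 g) ` P = {\<zero>\<^bsub>RM\<^esub>}"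
        then show ?thesis using n(2) by (simp add: Res_simps)
      next
        assume "simple_submodule (tens (\<theta>2 g) ` P) H1 RM"
        then show ?thesis using N by blast
      qed
      ultimately show ?thesis by blast
    qed
    ultimately have "?Q = carrier \<pi>"
      using assms unfolding simply_generated_def submodule_tw_iff by blast
    then show ?thesis using that by blast
  qed
  have "carrier M \<subseteq> N"
  proof (rule M_generated)
    \<comment> \<open>Negatives in the two records are identified through their common
      addition.\<close>
    have neg: "\<ominus>\<^bsub>M\<^esub> C = \<ominus>\<^bsub>RM\<^esub> C" if "C \<in> N" for C
    proof (rule ind.Ind.minus_equality)
      have "C \<in> carrier RM" using that n(1) by (auto simp: Res_simps)
      then show "\<ominus>\<^bsub>RM\<^esub> C \<oplus>\<^bsub>M\<^esub> C = \<zero>\<^bsub>M\<^esub>" "C \<in> carrier M" "\<ominus>\<^bsub>RM\<^esub> C \<in> carrier M"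
        using RM.M.l_neg[of C] RM.M.a_inv_closed[of C] by (simp_all add: Res_simps)
    qed
    show "\<ominus>\<^bsub>M\<^esub> C \<in> N" if "C \<in> N" for C using n(5)[OF that] neg[OF that] by simp
  qed (use n tens in auto)
  then show "N = carrier RM" using n(1) by (auto simp: Res_simps)
qed

subsection \<open>The decomposition of the restricted induced module\<close>

lemma sec_eq_zero:
  assumes "z \<in> A2.pieces Y" "Y \<inter> range f = {}"
  shows "sec UNIV z = \<zero>\<^bsub>H1\<^esub>"
proof -
  have "A2.pieces Y \<subseteq> {z \<in> carrier H2. sec UNIV z \<in> {\<zero>\<^bsub>H1\<^esub>}}"
  proof (rule A2.pieces_subset)
    show "submodule {z \<in> carrier H2. sec UNIV z \<in> {\<zero>\<^bsub>H1\<^esub>}} complex_ring H2"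
      by (rule submodule_linear_preimage[OF A2.V.complex_module_axioms A1.V.complex_module_axioms
            sec(1) A1.V.submodule_zero])
    fix y w' assume y: "y \<in> Y" and w': "w' \<in> W2"
    then have "sec UNIV (A2.basis (y, w')) = \<zero>\<^bsub>H1\<^esub>" using assms(2) sec_outside by blast
    then show "A2.basis (y, w') \<in> {z \<in> carrier H2. sec UNIV z \<in> {\<zero>\<^bsub>H1\<^esub>}}" using w' by simp
  qed
  then show ?thesis using assms(1) by blast
qed

lemmas secD = module_homsD[OF sec(1), simplified]

lemma sec_zero: "sec Y \<zero>\<^bsub>H2\<^esub> = \<zero>\<^bsub>H1\<^esub>"
  using additive_map_zero[OF A2.abelian_group_axioms A1.abelian_group_axioms, of "sec Y"] secD by blast

text \<open>Splits H2 into the image of \<phi> and the span of the basis elements outside it;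
  \<open>sec UNIV\<close> behaves differently on the two parts.\<close>

lemma pieces_range_cases:
  assumes "w' \<in> W2"
  obtains a where "a \<in> carrier H1" "c \<odot>\<^bsub>H2\<^esub> A2.basis (y, w') = \<phi> a"
  | "c \<odot>\<^bsub>H2\<^esub> A2.basis (y, w') \<in> A2.pieces (- range f)"
proof (cases "y \<in> range f")
  case True
  then obtain x where x: "y = f x" by blast
  obtain w where w: "w \<in> W1" "w' = \<omega> w" using \<omega>_surj[OF assms] by blast
  have "c \<odot>\<^bsub>H2\<^esub> A2.basis (y, w') = \<phi> (c \<odot>\<^bsub>H1\<^esub> A1.basis (x, w))"
    using w x by (simp add: \<phi>_smult \<phi>_basis)
  then show ?thesis by (rule that(1)[rotated]) (simp add: w)
next
  case False
  then have "A2.basis (y, w') \<in> A2.pieces (- range f)" using assms by (intro A2.basis_pieces) simp_all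
  then show ?thesis by (intro that(2) A2.piecesD(4)) simp_all
qed

lemma \<phi>_range_pieces: "a \<in> carrier H1 \<Longrightarrow> \<phi> a \<in> A2.pieces (range f)"
  using \<phi>_pieces[of a UNIV] by (simp add: A1.pieces_UNIV)

text \<open>\<open>range f\<close> is a subgroup containing the root lattice of the target, hence
  its complement is stable under adding its elements and under changes modulo that lattice.\<close>

lemma outside_mult:
  assumes a: "a \<in> carrier H1" and z: "z \<in> A2.pieces (- range f)"
  shows "z \<otimes>\<^bsub>H2\<^esub> \<phi> a \<in> A2.pieces (- range f)" "\<phi> a \<otimes>\<^bsub>H2\<^esub> z \<in> A2.pieces (- range f)"
proof -
  have key: "u \<in> - range f" if "y \<in> - range f" "y' \<in> range f" "u - (y + y') \<in> A2.root_span" for u y y'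
  proof
    assume "u \<in> range f"
    then have "u - (u - (y + y')) - y' \<in> range f"
      by (intro range_f_diff[OF range_f_diff[OF _ root_span_range[OF that(3)]] that(2)])
    moreover have "u - (u - (y + y')) - y' = y" by (simp add: algebra_simps)
    ultimately have "y \<in> range f" by (simp only:)
    then show False using that(1) by blast
  qed
  show "z \<otimes>\<^bsub>H2\<^esub> \<phi> a \<in> A2.pieces (- range f)"
    using z \<phi>_range_pieces[OF a]
  proof (rule A2.pieces_mult)
    fix y y' assume y: "y \<in> - range f" "y' \<in> range f"
    show "A2.coset (y + y') \<subseteq> - range f" by (rule subsetI) (rule key[OF y], simp)
  qed
  show "\<phi> a \<otimes>\<^bsub>H2\<^esub> z \<in> A2.pieces (- range f)"
    using \<phi>_range_pieces[OF a] z
  proof (rule A2.pieces_mult)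
    fix y' y assume y: "y' \<in> range f" "y \<in> - range f"
    show "A2.coset (y' + y) \<subseteq> - range f"
      by (rule subsetI) (rule key[OF y(2,1)], simp add: add.commute[of y' y])
  qed
qed

section \<open>Components of induced vectors when the kernel acts trivially\<close>

context
  assumes kernel: "kernel_acts_trivially \<H>1 f \<pi>"
begin

text \<open>The preimage chosen by \<open>sec UNIV\<close> may differ from the given basis element
  by a factor \<theta>_k with f k = 0, which acts as the identity.\<close>

lemma sec_\<phi>_acts:
  assumes "a \<in> carrier H1" "v \<in> carrier \<pi>"
  shows "sec UNIV (\<phi> a) \<odot>\<^bsub>\<pi>\<^esub> v = a \<odot>\<^bsub>\<pi>\<^esub> v"
proof -
  let ?U = "{a \<in> carrier H1. \<forall>v\<in>carrier \<pi>. sec UNIV (\<phi> a) \<odot>\<^bsub>\<pi>\<^esub> v = a \<odot>\<^bsub>\<pi>\<^esub> v}"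
  have "a \<in> ?U"
    using assms(1)
  proof (rule A1.basis_induct)
    have "\<phi> \<zero>\<^bsub>H1\<^esub> = \<zero>\<^bsub>H2\<^esub>"
      using additive_map_zero[OF A1.abelian_group_axioms A2.abelian_group_axioms, of \<phi>] \<phi>_simps(1) by auto
    then show "\<zero>\<^bsub>H1\<^esub> \<in> ?U"
      by (simp add: sec_zero)
    show "a \<oplus>\<^bsub>H1\<^esub> b \<in> ?U"
      if "a \<in> ?U"
        "b \<in> ?U" for a b
      using that by (auto simp: \<phi>_simps secD \<pi>.smult_l_distr)
    fix c x w assume w: "w \<in> W1"
    define x' where "x' = inv_into UNIV f (f x)"
    have fx': "f x' = f x" unfolding x'_def by (rule f_inv_into_f) blast
    define k where "k = x' - x"
    have k: "f k = 0" by (simp add: k_def f_simps fx')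
    let ?b = "c \<odot>\<^bsub>H1\<^esub> A1.basis (x, w)"
    have "sec UNIV (\<phi> ?b) = c \<odot>\<^bsub>H1\<^esub> A1.basis (x', w)"
      using w \<omega>(1)[OF w] by (simp add: \<phi>_smult \<phi>_basis secD sec(2) x'_def)
    also have "\<dots> = \<theta>1 k \<otimes>\<^bsub>H1\<^esub> ?b"
      using w by (simp add: A1.smult_mult A1.theta_mult_basis k_def)
    finally have "sec UNIV (\<phi> ?b) \<odot>\<^bsub>\<pi>\<^esub> v = ?b \<odot>\<^bsub>\<pi>\<^esub> v" if "v \<in> carrier \<pi>" for v
      using that w kernel k by (simp add: \<pi>.smult_assoc \<pi>.smult_closed kernel_acts_trivially_def)
    then show "?b \<in> ?U"
      using w by simp
  qed
  then show ?thesis using assms(2) by blast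
qed

text \<open>Up to the action on \<pi>, \<open>sec UNIV\<close> is linear over H1 from both sides. On
  the image of \<phi> this reduces to \<open>sec_\<phi>_acts\<close>; on the rest both sides vanish,
  since products stay outside the image.\<close>

lemma sec_mult:
  assumes z: "z \<in> carrier H2" and a: "a \<in> carrier H1" and v: "v \<in> carrier \<pi>"
  shows "sec UNIV (z \<otimes>\<^bsub>H2\<^esub> \<phi> a) \<odot>\<^bsub>\<pi>\<^esub> v = (sec UNIV z \<otimes>\<^bsub>H1\<^esub> a) \<odot>\<^bsub>\<pi>\<^esub> v"
    and "sec UNIV (\<phi> a \<otimes>\<^bsub>H2\<^esub> z) \<odot>\<^bsub>\<pi>\<^esub> v = (a \<otimes>\<^bsub>H1\<^esub> sec UNIV z) \<odot>\<^bsub>\<pi>\<^esub> v"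
proof -
  let ?V = "{z \<in> carrier H2. sec UNIV (z \<otimes>\<^bsub>H2\<^esub> \<phi> a) \<odot>\<^bsub>\<pi>\<^esub> v = (sec UNIV z \<otimes>\<^bsub>H1\<^esub> a) \<odot>\<^bsub>\<pi>\<^esub> v \<and>
    sec UNIV (\<phi> a \<otimes>\<^bsub>H2\<^esub> z) \<odot>\<^bsub>\<pi>\<^esub> v = (a \<otimes>\<^bsub>H1\<^esub> sec UNIV z) \<odot>\<^bsub>\<pi>\<^esub> v}"
  have "z \<in> ?V"
    using z
  proof (rule A2.basis_induct)
    show "\<zero>\<^bsub>H2\<^esub> \<in> ?V" using a by (simp add: sec_zero)
    show "x \<oplus>\<^bsub>H2\<^esub> y \<in> ?V" if "x \<in> ?V" "y \<in> ?V" for x y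
      using that a v by (auto simp: A1.l_distr A1.r_distr A2.l_distr A2.r_distr secD \<pi>.smult_l_distr)
    fix c y w' assume w': "w' \<in> W2"
    then show "c \<odot>\<^bsub>H2\<^esub> A2.basis (y, w') \<in> ?V"
    proof (cases rule: pieces_range_cases[of w' c y])
      case (1 b)
      have "sec UNIV (\<phi> b) \<in> carrier H1" using 1 by (simp add: secD)
      then show ?thesis
        unfolding 1(2) using 1(1) a v sec_\<phi>_acts[of "b \<otimes>\<^bsub>H1\<^esub> a" v] sec_\<phi>_acts[of "a \<otimes>\<^bsub>H1\<^esub> b" v]
          sec_\<phi>_acts[of b]
        by (simp add: \<phi>_simps \<pi>.smult_assoc \<pi>.smult_closed)
    next
      case 2
      have dis: "- range f \<inter> range f = {}" by blast
      show ?thesis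
        using sec_eq_zero[OF outside_mult(1)[OF a 2] dis] sec_eq_zero[OF outside_mult(2)[OF a 2] dis]
          sec_eq_zero[OF 2 dis] a v w' by simp
    qed
  qed
  then show "sec UNIV (z \<otimes>\<^bsub>H2\<^esub> \<phi> a) \<odot>\<^bsub>\<pi>\<^esub> v = (sec UNIV z \<otimes>\<^bsub>H1\<^esub> a) \<odot>\<^bsub>\<pi>\<^esub> v"
    "sec UNIV (\<phi> a \<otimes>\<^bsub>H2\<^esub> z) \<odot>\<^bsub>\<pi>\<^esub> v = (a \<otimes>\<^bsub>H1\<^esub> sec UNIV z) \<odot>\<^bsub>\<pi>\<^esub> v" by auto
qed

text \<open>Multiplying by \<theta>_(-g) moves the summand of g to the image of \<phi>, and
  \<open>sec UNIV\<close> extracts it. Its linearity from the right makes the prescription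
  balanced.\<close>

lemma component_exists:
  "\<exists>h. h \<in> carrier M \<rightarrow> carrier \<pi> \<and>
    (\<forall>C\<in>carrier M. \<forall>D\<in>carrier M. h (C \<oplus>\<^bsub>M\<^esub> D) = h C \<oplus>\<^bsub>\<pi>\<^esub> h D) \<and>
    (\<forall>b\<in>carrier H2. \<forall>v\<in>carrier \<pi>. h (tens b v) = sec UNIV (\<theta>2 (- g) \<otimes>\<^bsub>H2\<^esub> b) \<odot>\<^bsub>\<pi>\<^esub> v)"
proof -
  obtain h where "h \<in> carrier M \<rightarrow> carrier \<pi>"
    "\<And>C D. C \<in> carrier M \<Longrightarrow> D \<in> carrier M \<Longrightarrow> h (C \<oplus>\<^bsub>M\<^esub> D) = h C \<oplus>\<^bsub>\<pi>\<^esub> h D"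
    "\<And>b v. b \<in> carrier H2 \<Longrightarrow> v \<in> carrier \<pi> \<Longrightarrow> h (tens b v) = sec UNIV (\<theta>2 (- g) \<otimes>\<^bsub>H2\<^esub> b) \<odot>\<^bsub>\<pi>\<^esub> v"
  proof (rule ind.Ind_universal[of \<pi> "\<lambda>b v. sec UNIV (\<theta>2 (- g) \<otimes>\<^bsub>H2\<^esub> b) \<odot>\<^bsub>\<pi>\<^esub> v"])
    show "abelian_group \<pi>" by (rule \<pi>.M.abelian_group_axioms)
    fix a b v assume a: "a \<in> carrier H1" and b: "b \<in> carrier H2" and v: "v \<in> carrier \<pi>"
    have z: "\<theta>2 (- g) \<otimes>\<^bsub>H2\<^esub> b \<in> carrier H2" using b by simp
    have "\<theta>2 (- g) \<otimes>\<^bsub>H2\<^esub> (b \<otimes>\<^bsub>H2\<^esub> \<phi> a) = \<theta>2 (- g) \<otimes>\<^bsub>H2\<^esub> b \<otimes>\<^bsub>H2\<^esub> \<phi> a"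
      using a b by (simp add: A2.m_assoc)
    then show "sec UNIV (\<theta>2 (- g) \<otimes>\<^bsub>H2\<^esub> (b \<otimes>\<^bsub>H2\<^esub> \<phi> a)) \<odot>\<^bsub>\<pi>\<^esub> v =
        sec UNIV (\<theta>2 (- g) \<otimes>\<^bsub>H2\<^esub> b) \<odot>\<^bsub>\<pi>\<^esub> (a \<odot>\<^bsub>\<pi>\<^esub> v)"
      using sec_mult(1)[OF z a v] secD(1)[OF z] a v by (simp add: \<pi>.smult_assoc)
  qed (auto simp: secD \<pi>.smult_closed \<pi>.smult_l_distr \<pi>.smult_r_distr A2.r_distr)
  then show ?thesis by blast
qed

definition component :: "'x2 \<Rightarrow> ('h2 \<times> 'v \<Rightarrow>\<^sub>0 int) set \<Rightarrow> 'v" where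
  "component g = (SOME h. h \<in> carrier M \<rightarrow> carrier \<pi> \<and>
    (\<forall>C\<in>carrier M. \<forall>D\<in>carrier M. h (C \<oplus>\<^bsub>M\<^esub> D) = h C \<oplus>\<^bsub>\<pi>\<^esub> h D) \<and>
    (\<forall>b\<in>carrier H2. \<forall>v\<in>carrier \<pi>. h (tens b v) = sec UNIV (\<theta>2 (- g) \<otimes>\<^bsub>H2\<^esub> b) \<odot>\<^bsub>\<pi>\<^esub> v))"

lemma component:
  "component g \<in> carrier M \<rightarrow> carrier \<pi>"
  "C \<in> carrier M \<Longrightarrow> D \<in> carrier M \<Longrightarrow> component g (C \<oplus>\<^bsub>M\<^esub> D) = component g C \<oplus>\<^bsub>\<pi>\<^esub> component g D"
  "b \<in> carrier H2 \<Longrightarrow> v \<in> carrier \<pi> \<Longrightarrow>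
    component g (tens b v) = sec UNIV (\<theta>2 (- g) \<otimes>\<^bsub>H2\<^esub> b) \<odot>\<^bsub>\<pi>\<^esub> v"
  using someI_ex[OF component_exists[of g]] unfolding component_def[symmetric] by auto

lemma component_closed: "C \<in> carrier M \<Longrightarrow> component g C \<in> carrier \<pi>"
  using component(1) by blast

lemma component_zero: "component g \<zero>\<^bsub>M\<^esub> = \<zero>\<^bsub>\<pi>\<^esub>"
  using additive_map_zero[OF ind.abelian_group_Ind \<pi>.M.abelian_group_axioms component(1)] component(2) by blast

text \<open>Distinct representatives differ by an element outside \<open>range f\<close>, where
  \<open>sec UNIV\<close> vanishes. The components are thus dual to the generators.\<close>

lemma component_tens:
  assumes "g \<in> S" "g' \<in> S" "v \<in> carrier \<pi>"
  shows "component g (tens (\<theta>2 g') v) = (if g = g' then v else \<zero>\<^bsub>\<pi>\<^esub>)"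
proof -
  have eq: "component g (tens (\<theta>2 g') v) = sec UNIV (\<theta>2 (g' - g)) \<odot>\<^bsub>\<pi>\<^esub> v"
    using assms(3) by (simp add: component(3) A2.theta_mult)
  show ?thesis
  proof (cases "g = g'")
    case True
    have "sec UNIV (\<theta>2 (g' - g)) = sec UNIV (\<phi> \<one>\<^bsub>H1\<^esub>)" using True by (simp add: A2.theta_0 \<phi>_simps)
    then show ?thesis using True eq sec_\<phi>_acts[of "\<one>\<^bsub>H1\<^esub>" v] assms(3) by (simp add: \<pi>.smult_one)
  next
    case False
    then have "{g' - g} \<inter> range f = {}" using S_unique[OF assms(2,1)] by blast
    moreover have "\<theta>2 (g' - g) \<in> A2.pieces {g' - g}"
      unfolding A2.theta_basis using A2.weyl_id by (intro A2.basis_pieces) simp_all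
    ultimately have "sec UNIV (\<theta>2 (g' - g)) = \<zero>\<^bsub>H1\<^esub>" by (rule sec_eq_zero[rotated])
    then show ?thesis using False eq assms(3) by (simp add: \<pi>.smult_l_null)
  qed
qed

text \<open>Since \<theta>_(-g) \<open>\<phi> a\<close> equals the image of the lift of a times
  \<theta>_(-g), linearity of \<open>sec UNIV\<close> from the left turns the action into that of
  the twist.\<close>

lemma component_smult:
  assumes a: "a \<in> carrier H1" and "C \<in> carrier M"
  shows "component g (\<phi> a \<odot>\<^bsub>M\<^esub> C) = clift g a \<odot>\<^bsub>\<pi>\<^esub> component g C"
proof -
  have ca: "clift g a \<in> carrier H1" using a by (rule cliftD(1))
  show ?thesis
  proof (rule ind.Ind_ext[OF \<pi>.M.abelian_group_axioms _ _ _ _ _ assms(2)])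
    fix b v assume b: "b \<in> carrier H2" and v: "v \<in> carrier \<pi>"
    have z: "\<theta>2 (- g) \<otimes>\<^bsub>H2\<^esub> b \<in> carrier H2" using b by simp
    have pa: "\<phi> a \<in> carrier H2" using a by simp
    have "\<phi> (clift g a) \<otimes>\<^bsub>H2\<^esub> (\<theta>2 (- g) \<otimes>\<^bsub>H2\<^esub> b) =
        \<theta>2 (- g) \<otimes>\<^bsub>H2\<^esub> \<phi> a \<otimes>\<^bsub>H2\<^esub> (\<theta>2 g \<otimes>\<^bsub>H2\<^esub> \<theta>2 (- g)) \<otimes>\<^bsub>H2\<^esub> b"
      unfolding \<phi>_clift[OF a] using pa b
      by (simp only: A2.m_assoc A2.theta_closed A2.m_closed)
    also have "\<dots> = \<theta>2 (- g) \<otimes>\<^bsub>H2\<^esub> (\<phi> a \<otimes>\<^bsub>H2\<^esub> b)"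
      using pa b by (simp add: A2.theta_mult A2.theta_0 A2.m_assoc)
    finally have "sec UNIV (\<theta>2 (- g) \<otimes>\<^bsub>H2\<^esub> (\<phi> a \<otimes>\<^bsub>H2\<^esub> b)) \<odot>\<^bsub>\<pi>\<^esub> v =
        clift g a \<odot>\<^bsub>\<pi>\<^esub> (sec UNIV (\<theta>2 (- g) \<otimes>\<^bsub>H2\<^esub> b) \<odot>\<^bsub>\<pi>\<^esub> v)"
      using sec_mult(2)[OF z ca v] secD(1)[OF z] ca v by (simp add: \<pi>.smult_assoc)
    then show "component g (\<phi> a \<odot>\<^bsub>M\<^esub> tens b v) = clift g a \<odot>\<^bsub>\<pi>\<^esub> component g (tens b v)"
      using pa b v by (simp add: ind.smult_tens component(3))
  qed (use a ca in \<open>auto simp: M.smult_closed M.smult_r_distr component_closed component(2)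
      \<pi>.smult_closed \<pi>.smult_r_distr\<close>)
qed

abbreviation "DS \<equiv> direct_sum S tw"

lemma DS_simps:
  "carrier DS = {F \<in> S \<rightarrow>\<^sub>E carrier \<pi>. finite {g \<in> S. F g \<noteq> \<zero>\<^bsub>\<pi>\<^esub>}}"
  "F \<oplus>\<^bsub>DS\<^esub> G = (\<lambda>g\<in>S. F g \<oplus>\<^bsub>\<pi>\<^esub> G g)" "a \<odot>\<^bsub>DS\<^esub> F = (\<lambda>g\<in>S. a \<odot>\<^bsub>tw g\<^esub> F g)"
proof -
  have "Group.group (add_monoid (tw g))" for g
    using abelian_group.a_group left_module_tw unfolding left_module_def by blast
  then show "carrier DS = {F \<in> S \<rightarrow>\<^sub>E carrier \<pi>. finite {g \<in> S. F g \<noteq> \<zero>\<^bsub>\<pi>\<^esub>}}"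
    by (simp add: direct_sum_def carrier_sum_group tw_simps)
qed (simp_all add: direct_sum_def tw_simps)

definition components :: "('h2 \<times> 'v \<Rightarrow>\<^sub>0 int) set \<Rightarrow> 'x2 \<Rightarrow> 'v" where
  "components C = (\<lambda>g\<in>S. component g C)"

text \<open>\<open>gfinprod\<close> skips trivial factors, so the sum over a possibly infinite S is
  meaningful for families of finite support.\<close>

definition assemble :: "('x2 \<Rightarrow> 'v) \<Rightarrow> ('h2 \<times> 'v \<Rightarrow>\<^sub>0 int) set" where
  "assemble F = gfinprod (add_monoid M) (\<lambda>g. tens (\<theta>2 g) (F g)) S"

lemma assemble_hom:
  "F \<in> carrier DS \<Longrightarrow> assemble F \<in> carrier M"
  "F \<in> carrier DS \<Longrightarrow> G \<in> carrier DS \<Longrightarrow> assemble (F \<oplus>\<^bsub>DS\<^esub> G) = assemble F \<oplus>\<^bsub>M\<^esub> assemble G"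
proof -
  have grp: "Group.group (add_monoid (tw g))" for g
    using abelian_group.a_group left_module_tw unfolding left_module_def by blast
  have tens: "tens (\<theta>2 g) \<in> hom (add_monoid (tw g)) (add_monoid M)" for g
    by (rule homI) (simp_all add: tw_simps ind.tens_closed ind.tens_add_right)
  have hom: "assemble \<in> hom (sum_group S (\<lambda>g. add_monoid (tw g))) (add_monoid M)"
    unfolding assemble_def[abs_def]
    by (rule comm_group.hom_group_sum[OF ind.Ind.a_comm_group, where f = "\<lambda>g. tens (\<theta>2 g)"])
      (rule tens grp)+
  show "assemble F \<in> carrier M" if "F \<in> carrier DS"
    using hom_in_carrier[OF hom, of F] that by (simp add: direct_sum_def)
  show "assemble (F \<oplus>\<^bsub>DS\<^esub> G) = assemble F \<oplus>\<^bsub>M\<^esub> assemble G" if "F \<in> carrier DS" "G \<in> carrier DS"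
    using hom_mult[OF hom, of F G] that by (simp add: direct_sum_def)
qed

lemma components_add:
  "C \<in> carrier M \<Longrightarrow> D \<in> carrier M \<Longrightarrow> components (C \<oplus>\<^bsub>M\<^esub> D) = components C \<oplus>\<^bsub>DS\<^esub> components D"
  unfolding components_def DS_simps by (intro restrict_ext) (simp add: component(2))

lemma components_tens:
  assumes "g \<in> S" "v \<in> carrier \<pi>"
  shows "components (tens (\<theta>2 g) v) = (\<lambda>g'\<in>S. if g' = g then v else \<zero>\<^bsub>\<pi>\<^esub>)"
  unfolding components_def using assms by (intro restrict_ext) (simp add: component_tens)

text \<open>Finiteness of the support is inherited from the generators, each of which has at most
  one nonzero component.\<close>

lemma components_closed:
  assumes "C \<in> carrier M"
  shows "components C \<in> carrier DS"
proof -
  let ?U = "{C \<in> carrier M. finite {g \<in> S. component g C \<noteq> \<zero>\<^bsub>\<pi>\<^esub>}}"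
  have "carrier M \<subseteq> ?U"
  proof (rule M_generated)
    show "\<zero>\<^bsub>M\<^esub> \<in> ?U" by (simp add: component_zero)
    fix C assume C: "C \<in> ?U"
    have "component g (\<ominus>\<^bsub>M\<^esub> C) = \<ominus>\<^bsub>\<pi>\<^esub> component g C" for g
      using additive_map_minus[where u = "component g" and v = "\<zero>\<^bsub>M\<^esub>" and w = C,
          OF ind.abelian_group_Ind \<pi>.M.abelian_group_axioms component(1) component(2)] C
      by (simp add: component_zero ind.Ind.minus_eq \<pi>.M.minus_eq component_closed)
    moreover have "{g \<in> S. \<ominus>\<^bsub>\<pi>\<^esub> component g C \<noteq> \<zero>\<^bsub>\<pi>\<^esub>} \<subseteq> {g \<in> S. component g C \<noteq> \<zero>\<^bsub>\<pi>\<^esub>}" by auto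
    ultimately show "\<ominus>\<^bsub>M\<^esub> C \<in> ?U"
      using C finite_subset by auto
    fix D assume D: "D \<in> ?U"
    have "{g \<in> S. component g (C \<oplus>\<^bsub>M\<^esub> D) \<noteq> \<zero>\<^bsub>\<pi>\<^esub>} \<subseteq>
        {g \<in> S. component g C \<noteq> \<zero>\<^bsub>\<pi>\<^esub>} \<union> {g \<in> S. component g D \<noteq> \<zero>\<^bsub>\<pi>\<^esub>}"
      using C D by (auto simp: component(2))
    then show "C \<oplus>\<^bsub>M\<^esub> D \<in> ?U"
      using C D finite_subset[OF _ finite_UnI] by auto
  next
    fix g v assume gv: "g \<in> S" "v \<in> carrier \<pi>"
    have "{g' \<in> S. component g' (tens (\<theta>2 g) v) \<noteq> \<zero>\<^bsub>\<pi>\<^esub>} \<subseteq> {g}"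
      using gv by (auto simp: component_tens split: if_splits)
    then show "tens (\<theta>2 g) v \<in> ?U"
      using gv finite_subset by (auto simp: ind.tens_closed)
  qed
  then have "finite {g \<in> S. component g C \<noteq> \<zero>\<^bsub>\<pi>\<^esub>}" using assms by blast
  moreover have "{g \<in> S. components C g \<noteq> \<zero>\<^bsub>\<pi>\<^esub>} = {g \<in> S. component g C \<noteq> \<zero>\<^bsub>\<pi>\<^esub>}"
    by (auto simp: components_def)
  ultimately show ?thesis unfolding DS_simps(1) using assms by (auto simp: components_def component_closed)
qed

lemma assemble_finsum:
  assumes "F \<in> carrier DS"
  shows "assemble F = finsum M (\<lambda>g. tens (\<theta>2 g) (F g)) {g \<in> S. F g \<noteq> \<zero>\<^bsub>\<pi>\<^esub>}"
proof -
  have F: "\<And>g. g \<in> S \<Longrightarrow> F g \<in> carrier \<pi>" "finite {g \<in> S. F g \<noteq> \<zero>\<^bsub>\<pi>\<^esub>}" using assms by (auto simp: DS_simps)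
  have "assemble F = gfinprod (add_monoid M) (\<lambda>g. tens (\<theta>2 g) (F g)) {g \<in> S. F g \<noteq> \<zero>\<^bsub>\<pi>\<^esub>}"
    unfolding assemble_def using F(1)
    by (intro comm_monoid.gfinprod_mono_neutral_cong_right[OF ind.Ind.a_comm_monoid])
      (auto simp: tens_zero ind.tens_closed)
  also have "\<dots> = finsum M (\<lambda>g. tens (\<theta>2 g) (F g)) {g \<in> S. F g \<noteq> \<zero>\<^bsub>\<pi>\<^esub>}"
    unfolding finsum_def using F
    by (intro comm_monoid.gfinprod_eq_finprod[OF ind.Ind.a_comm_monoid]) (auto simp: ind.tens_closed)
  finally show ?thesis .
qed

lemma components_assemble:
  assumes "F \<in> carrier DS"
  shows "components (assemble F) = F"
proof
  fix g
  have F: "\<And>g. g \<in> S \<Longrightarrow> F g \<in> carrier \<pi>" "finite {g \<in> S. F g \<noteq> \<zero>\<^bsub>\<pi>\<^esub>}" "F \<in> extensional S"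
    using assms by (auto simp: DS_simps PiE_def)
  show "components (assemble F) g = F g"
  proof (cases "g \<in> S")
    case True
    let ?I = "{g \<in> S. F g \<noteq> \<zero>\<^bsub>\<pi>\<^esub>}"
    have "component g (assemble F) = finsum \<pi> (\<lambda>g'. component g (tens (\<theta>2 g') (F g'))) ?I"
      unfolding assemble_finsum[OF assms]
      by (rule additive_map_finsum[OF ind.abelian_group_Ind \<pi>.M.abelian_group_axioms component(1)])
        (use F in \<open>auto simp: component(2) ind.tens_closed\<close>)
    also have "\<dots> = finsum \<pi> (\<lambda>g'. if g' = g then F g else \<zero>\<^bsub>\<pi>\<^esub>) ?I"
      using True F(1) by (intro \<pi>.M.finsum_cong') (auto simp: component_tens)
    also have "\<dots> = F g"
    proof (cases "F g = \<zero>\<^bsub>\<pi>\<^esub>")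
      case True
      then show ?thesis by (simp add: \<pi>.M.add.finprod_one_eqI)
    next
      case False
      then have "finsum \<pi> (\<lambda>g'. if g' = g then F g else \<zero>\<^bsub>\<pi>\<^esub>) ?I = finsum \<pi> (\<lambda>g'. F g) {g}"
        using True F by (intro \<pi>.M.add.finprod_mono_neutral_cong_right) auto
      then show ?thesis using F(1)[OF True] by simp
    qed
    finally show ?thesis using True by (simp add: components_def)
  next
    case False
    then show ?thesis using F(3) by (simp add: components_def extensional_def)
  qed
qed

text \<open>The composite is additive, so it is enough to evaluate it on generators, whose
  components are concentrated at one index.\<close>

lemma assemble_components:
  assumes "C \<in> carrier M"
  shows "assemble (components C) = C"
proof -
  let ?U = "{C \<in> carrier M. assemble (components C) = C}"
  have delta: "assemble (components (tens (\<theta>2 g) v)) = tens (\<theta>2 g) v" if gv: "g \<in> S" "v \<in> carrier \<pi>" for g v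
  proof -
    have mem: "components (tens (\<theta>2 g) v) \<in> carrier DS" using gv by (intro components_closed ind.tens_closed) simp_all
    have "assemble (components (tens (\<theta>2 g) v)) = finsum M (\<lambda>g'. tens (\<theta>2 g') v) {g}"
      unfolding assemble_finsum[OF mem] unfolding components_tens[OF gv] using gv
      by (intro ind.Ind.add.finprod_mono_neutral_cong_left) (auto simp: ind.tens_closed tens_zero)
    then show ?thesis using gv by (simp add: ind.tens_closed)
  qed
  have zero: "components \<zero>\<^bsub>M\<^esub> \<oplus>\<^bsub>DS\<^esub> components \<zero>\<^bsub>M\<^esub> = components \<zero>\<^bsub>M\<^esub>"
    using components_add[of "\<zero>\<^bsub>M\<^esub>" "\<zero>\<^bsub>M\<^esub>"] by simp
  have add: "assemble (components (C \<oplus>\<^bsub>M\<^esub> D)) = assemble (components C) \<oplus>\<^bsub>M\<^esub> assemble (components D)"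
    if "C \<in> carrier M" "D \<in> carrier M" for C D
    using that by (simp add: components_add assemble_hom components_closed)
  have closed: "assemble (components C) \<in> carrier M" if "C \<in> carrier M" for C
    using that by (intro assemble_hom components_closed)
  have z: "assemble (components \<zero>\<^bsub>M\<^esub>) = \<zero>\<^bsub>M\<^esub>"
    using additive_map_zero[OF ind.abelian_group_Ind ind.abelian_group_Ind, of "\<lambda>C. assemble (components C)"]
      closed add by blast
  have "carrier M \<subseteq> ?U"
  proof (rule M_generated)
    fix C assume C: "C \<in> ?U"
    have "assemble (components (\<zero>\<^bsub>M\<^esub> \<ominus>\<^bsub>M\<^esub> C)) = assemble (components \<zero>\<^bsub>M\<^esub>) \<ominus>\<^bsub>M\<^esub> assemble (components C)"
      using additive_map_minus[OF ind.abelian_group_Ind ind.abelian_group_Ind,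
          of "\<lambda>C. assemble (components C)" "\<zero>\<^bsub>M\<^esub>" C] closed add C by auto
    then show "\<ominus>\<^bsub>M\<^esub> C \<in> ?U"
      using C z by (simp add: ind.Ind.minus_eq)
  qed (use z add delta in \<open>auto simp: ind.tens_closed\<close>)
  then show ?thesis using assms by blast
qed

lemma RM_isomorphic: "module_isomorphic H1 RM DS"
proof -
  have "components \<in> module_homs H1 RM DS"
    unfolding module_homs_def
  proof (intro CollectI conjI ballI)
    show "components \<in> carrier RM \<rightarrow> carrier DS" by (simp add: Res_simps components_closed)
    show "components (C \<oplus>\<^bsub>RM\<^esub> D) = components C \<oplus>\<^bsub>DS\<^esub> components D"
      if "C \<in> carrier RM" "D \<in> carrier RM" for C D
      using that by (simp add: Res_simps components_add)
    fix a C assume a: "a \<in> carrier H1" and C: "C \<in> carrier RM"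
    then have CM: "C \<in> carrier M" by (simp add: Res_simps)
    have "components (a \<odot>\<^bsub>RM\<^esub> C) = (\<lambda>g\<in>S. component g (\<phi> a \<odot>\<^bsub>M\<^esub> C))"
      using a CM by (simp add: components_def Res_simps)
    also have "\<dots> = (\<lambda>g\<in>S. a \<odot>\<^bsub>tw g\<^esub> components C g)"
      using a CM by (intro restrict_ext) (simp add: components_def component_smult tw_simps component_closed)
    finally show "components (a \<odot>\<^bsub>RM\<^esub> C) = a \<odot>\<^bsub>DS\<^esub> components C" unfolding DS_simps(3) .
  qed
  moreover have "bij_betw components (carrier RM) (carrier DS)"
    by (rule bij_betw_byWitness[where f' = assemble])
      (auto simp: Res_simps assemble_components components_assemble components_closed assemble_hom)
  ultimately show ?thesis unfolding module_isomorphic_def by blast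
qed

end

subsection \<open>Averaging over the cokernel\<close>

lemma theta_smult: "m \<in> carrier M \<Longrightarrow> \<theta>2 x \<odot>\<^bsub>M\<^esub> (\<theta>2 y \<odot>\<^bsub>M\<^esub> m) = \<theta>2 (x + y) \<odot>\<^bsub>M\<^esub> m"
  by (simp add: M.smult_assoc[symmetric] A2.theta_mult)

text \<open>Each conjugate P g of u by \<theta>_g still commutes with the image of H1, because the
  twists by the lift on its two sides cancel. It depends only on the class of g, so multiplication
  by \<theta>_y permutes the conjugates and their sum commutes with all of H2.\<close>

lemma averaged_projection:
  assumes fin: "finite S" and N: "submodule N H2 M"
    and u: "\<And>m. m \<in> carrier M \<Longrightarrow> u m \<in> N" "\<And>m. m \<in> N \<Longrightarrow> u m = m"
    and u_add: "\<And>m n. m \<in> carrier M \<Longrightarrow> n \<in> carrier M \<Longrightarrow> u (m \<oplus>\<^bsub>M\<^esub> n) = u m \<oplus>\<^bsub>M\<^esub> u n"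
    and u_smult: "\<And>a m. a \<in> carrier H1 \<Longrightarrow> m \<in> carrier M \<Longrightarrow> u (\<phi> a \<odot>\<^bsub>M\<^esub> m) = \<phi> a \<odot>\<^bsub>M\<^esub> u m"
  shows "\<exists>C. submodule C H2 M \<and> N \<inter> C = {\<zero>\<^bsub>M\<^esub>} \<and> M.submodule_sum N C = carrier M"
proof -
  note n = M.submoduleD[OF N]
  have uM: "u m \<in> carrier M" if "m \<in> carrier M" for m using u(1)[OF that] n(1) by blast
  define P where "P g m = \<theta>2 g \<odot>\<^bsub>M\<^esub> u (\<theta>2 (- g) \<odot>\<^bsub>M\<^esub> m)" for g m
  have PN: "P g m \<in> N" "P g m \<in> carrier M" if "m \<in> carrier M" for g m
  proof -
    have "\<theta>2 (- g) \<odot>\<^bsub>M\<^esub> m \<in> carrier M" using that by (simp add: M.smult_closed)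
    then show "P g m \<in> N" unfolding P_def by (intro n(4) u(1) A2.theta_closed)
    then show "P g m \<in> carrier M" using n(1) by blast
  qed
  have P_add: "P g (m \<oplus>\<^bsub>M\<^esub> m') = P g m \<oplus>\<^bsub>M\<^esub> P g m'" if "m \<in> carrier M" "m' \<in> carrier M" for g m m'
    unfolding P_def using that by (simp add: M.smult_r_distr M.smult_closed u_add uM)
  have P_id: "P g m = m" if "m \<in> N" for g m
  proof -
    have "u (\<theta>2 (- g) \<odot>\<^bsub>M\<^esub> m) = \<theta>2 (- g) \<odot>\<^bsub>M\<^esub> m" using that by (intro u(2) n(4)) simp_all
    then show ?thesis
      unfolding P_def using that n(1) by (auto simp: theta_smult A2.theta_0 M.smult_one)
  qed
  \<comment> \<open>The factor \<theta>_(f x) is the image of a lattice element of H1, which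
    commutes with u and cancels.\<close>
  have P_coset: "P (g + f x) m = P g m" if m: "m \<in> carrier M" for g x m
  proof -
    let ?m = "\<theta>2 (- g) \<odot>\<^bsub>M\<^esub> m"
    have mm: "?m \<in> carrier M" using m by (simp add: M.smult_closed)
    have e: "- (g + f x) = f (- x) + - g" by (simp add: f_simps)
    have "\<theta>2 (- (g + f x)) \<odot>\<^bsub>M\<^esub> m = \<phi> (\<theta>1 (- x)) \<odot>\<^bsub>M\<^esub> ?m"
      unfolding e \<phi>_theta theta_smult[OF m] ..
    then have "u (\<theta>2 (- (g + f x)) \<odot>\<^bsub>M\<^esub> m) = \<theta>2 (- f x) \<odot>\<^bsub>M\<^esub> u ?m"
      using u_smult[OF A1.theta_closed[of "- x"] mm] by (simp add: \<phi>_theta f_simps)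
    then show ?thesis unfolding P_def using uM[OF mm] by (simp add: theta_smult)
  qed
  have P_\<phi>: "P g (\<phi> a \<odot>\<^bsub>M\<^esub> m) = \<phi> a \<odot>\<^bsub>M\<^esub> P g m" if a: "a \<in> carrier H1" and m: "m \<in> carrier M" for g a m
  proof -
    let ?m = "\<theta>2 (- g) \<odot>\<^bsub>M\<^esub> m"
    have mm: "?m \<in> carrier M" using m by (simp add: M.smult_closed)
    have ca: "clift g a \<in> carrier H1" using a by (rule cliftD(1))
    have pa: "\<phi> a \<in> carrier H2" "\<phi> (clift g a) \<in> carrier H2" using a ca by auto
    have "\<phi> (clift g a) \<otimes>\<^bsub>H2\<^esub> \<theta>2 (- g) = \<theta>2 (- g) \<otimes>\<^bsub>H2\<^esub> \<phi> a"
      unfolding \<phi>_clift[OF a] using pa by (simp add: A2.m_assoc A2.theta_mult A2.theta_0)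
    then have "\<theta>2 (- g) \<odot>\<^bsub>M\<^esub> (\<phi> a \<odot>\<^bsub>M\<^esub> m) = \<phi> (clift g a) \<odot>\<^bsub>M\<^esub> ?m"
      using pa m by (simp add: M.smult_assoc[symmetric])
    then have "P g (\<phi> a \<odot>\<^bsub>M\<^esub> m) = (\<theta>2 g \<otimes>\<^bsub>H2\<^esub> \<phi> (clift g a)) \<odot>\<^bsub>M\<^esub> u ?m"
      unfolding P_def using u_smult[OF ca mm] pa uM[OF mm] by (simp add: M.smult_assoc)
    then show ?thesis
      unfolding theta_\<phi>_clift[OF a] P_def using pa uM[OF mm] by (simp add: M.smult_assoc)
  qed
  have P_theta: "P g (\<theta>2 y \<odot>\<^bsub>M\<^esub> m) = \<theta>2 y \<odot>\<^bsub>M\<^esub> P (g - y) m" if m: "m \<in> carrier M" for g y m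
    unfolding P_def using m by (simp add: theta_smult uM M.smult_closed)
  define Q where "Q m = finsum M (\<lambda>g. P g m) S" for m
  have QN: "Q m \<in> N" "Q m \<in> carrier M" if "m \<in> carrier M" for m
    unfolding Q_def by (rule M.submodule_finsum[OF N], use PN(1)[OF that] in blast)
      (rule ind.Ind.finsum_closed, use PN(2)[OF that] in blast)
  have Q_add: "Q (m \<oplus>\<^bsub>M\<^esub> m') = Q m \<oplus>\<^bsub>M\<^esub> Q m'" if "m \<in> carrier M" "m' \<in> carrier M" for m m'
  proof -
    have "Q (m \<oplus>\<^bsub>M\<^esub> m') = finsum M (\<lambda>g. P g m \<oplus>\<^bsub>M\<^esub> P g m') S"
      unfolding Q_def using that PN(2) by (intro ind.Ind.finsum_cong') (auto simp: P_add)
    then show ?thesis unfolding Q_def using that PN(2) by (simp add: ind.Ind.finsum_addf)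
  qed
  have Q_\<phi>: "Q (\<phi> a \<odot>\<^bsub>M\<^esub> m) = \<phi> a \<odot>\<^bsub>M\<^esub> Q m" if "a \<in> carrier H1" "m \<in> carrier M" for a m
  proof -
    have "Q (\<phi> a \<odot>\<^bsub>M\<^esub> m) = finsum M (\<lambda>g. \<phi> a \<odot>\<^bsub>M\<^esub> P g m) S"
      unfolding Q_def using that PN(2) by (intro ind.Ind.finsum_cong') (auto simp: P_\<phi> M.smult_closed)
    then show ?thesis unfolding Q_def using that PN(2) fin by (simp add: M.finsum_smult Pi_def)
  qed
  have Q_theta: "Q (\<theta>2 y \<odot>\<^bsub>M\<^esub> m) = \<theta>2 y \<odot>\<^bsub>M\<^esub> Q m" if m: "m \<in> carrier M" for y m
  proof -
    \<comment> \<open>The representative of the class of g - y is an injective function of g in S,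
      hence a permutation of the finite set S.\<close>
    have "\<exists>g'. g' \<in> S \<and> (\<exists>x. g - y = g' + f x)" for g using S_decomp[of "g - y"] by metis
    then obtain r where r: "\<And>g. r g \<in> S" "\<And>g. \<exists>x. g - y = r g + f x" by metis
    have inj: "inj_on r S"
    proof (rule inj_onI)
      fix g g' assume g: "g \<in> S" "g' \<in> S" "r g = r g'"
      obtain x x' where "g - y = r g + f x" "g' - y = r g' + f x'" using r(2) by meson
      then have "g - g' = f (x - x')" using g(3) by (simp add: f_simps algebra_simps)
      then show "g = g'" using S_unique[OF g(1,2)] by blast
    qed
    have surj: "r ` S = S" using fin inj r(1) by (intro endo_inj_surj) auto
    have "P (g - y) m = P (r g) m" for g using r(2)[of g] P_coset[OF m] by metis
    then have "Q (\<theta>2 y \<odot>\<^bsub>M\<^esub> m) = finsum M (\<lambda>g. \<theta>2 y \<odot>\<^bsub>M\<^esub> P (r g) m) S"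
      unfolding Q_def using m PN(2) by (intro ind.Ind.finsum_cong') (auto simp: P_theta M.smult_closed)
    also have "\<dots> = \<theta>2 y \<odot>\<^bsub>M\<^esub> finsum M (\<lambda>g. P (r g) m) S"
      using fin m PN(2) by (intro M.finsum_smult[symmetric]) auto
    also have "finsum M (\<lambda>g. P (r g) m) S = finsum M (\<lambda>g. P g m) (r ` S)"
      using inj m PN(2) by (intro ind.Ind.finsum_reindex[symmetric]) auto
    finally show ?thesis unfolding surj Q_def .
  qed
  have Q_smult: "Q (b \<odot>\<^bsub>M\<^esub> m) = b \<odot>\<^bsub>M\<^esub> Q m" if b: "b \<in> carrier H2" and m: "m \<in> carrier M" for b m
  proof -
    let ?U = "{b \<in> carrier H2. \<forall>m\<in>carrier M. Q (b \<odot>\<^bsub>M\<^esub> m) = b \<odot>\<^bsub>M\<^esub> Q m}"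
    have "b \<in> ?U"
      using b
    proof (rule H2_induct)
      have "Q \<zero>\<^bsub>M\<^esub> = \<zero>\<^bsub>M\<^esub>"
        using additive_map_zero[OF ind.abelian_group_Ind ind.abelian_group_Ind, of Q] Q_add QN(2) by blast
      then show "\<zero>\<^bsub>H2\<^esub> \<in> ?U"
        using QN(2) by (simp add: M.smult_l_null)
      show "a \<oplus>\<^bsub>H2\<^esub> b \<in> ?U"
        if "a \<in> ?U"
          "b \<in> ?U" for a b
        using that QN(2) by (auto simp: M.smult_l_distr Q_add M.smult_closed)
      fix g a assume "a \<in> carrier H1"
      then show "\<theta>2 g \<otimes>\<^bsub>H2\<^esub> \<phi> a \<in> ?U"
        using QN(2) by (simp add: M.smult_assoc M.smult_closed Q_theta Q_\<phi>)
    qed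
    then show ?thesis using m by blast
  qed
  have const: "finsum M (\<lambda>_. m) F = (of_nat (card F) \<odot>\<^bsub>H2\<^esub> \<one>\<^bsub>H2\<^esub>) \<odot>\<^bsub>M\<^esub> m"
    if "finite F" "m \<in> carrier M" for F :: "'x2 set" and m
    using that(1)
  proof (induction F)
    case empty
    then show ?case using that(2) by (simp add: M.smult_l_null)
  next
    case (insert x F)
    have "of_nat (card (insert x F)) \<odot>\<^bsub>H2\<^esub> \<one>\<^bsub>H2\<^esub> = \<one>\<^bsub>H2\<^esub> \<oplus>\<^bsub>H2\<^esub> of_nat (card F) \<odot>\<^bsub>H2\<^esub> \<one>\<^bsub>H2\<^esub>"
      using A2.V.smult_l_distr[of 1 "of_nat (card F)" "\<one>\<^bsub>H2\<^esub>"] insert(1,2) by simp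
    then show ?case using insert that(2) by (simp add: M.smult_l_distr M.smult_one)
  qed
  have "S \<noteq> {}" using S_decomp[of 0] by blast
  then have card: "of_nat (card S) \<noteq> (0::complex)" using fin by simp
  \<comment> \<open>The scalar 1 / |S| is realised as a central element of H2, because M is only
    given as a module over H2.\<close>
  define e where "e = (1 / of_nat (card S)) \<odot>\<^bsub>H2\<^esub> \<one>\<^bsub>H2\<^esub>"
  have e: "e \<in> carrier H2" by (simp add: e_def)
  have e_inv: "e \<otimes>\<^bsub>H2\<^esub> (of_nat (card S) \<odot>\<^bsub>H2\<^esub> \<one>\<^bsub>H2\<^esub>) = \<one>\<^bsub>H2\<^esub>"
  proof -
    have "e \<otimes>\<^bsub>H2\<^esub> (of_nat (card S) \<odot>\<^bsub>H2\<^esub> \<one>\<^bsub>H2\<^esub>) =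
        (1 / of_nat (card S)) \<odot>\<^bsub>H2\<^esub> (of_nat (card S) \<odot>\<^bsub>H2\<^esub> \<one>\<^bsub>H2\<^esub>)"
      unfolding e_def by (subst A2.smult_mult(1)) simp_all
    also have "\<dots> = (1 / of_nat (card S) * of_nat (card S)) \<odot>\<^bsub>H2\<^esub> \<one>\<^bsub>H2\<^esub>"
      using A2.V.smult_assoc[of "1 / of_nat (card S)" "of_nat (card S)" "\<one>\<^bsub>H2\<^esub>"] by simp
    finally show ?thesis using card by simp
  qed
  have e_comm: "e \<otimes>\<^bsub>H2\<^esub> b = b \<otimes>\<^bsub>H2\<^esub> e" if "b \<in> carrier H2" for b
    using that by (simp add: e_def A2.smult_mult)
  show ?thesis
  proof (rule M.complement_of_projection[OF N, of "\<lambda>m. e \<odot>\<^bsub>M\<^esub> Q m"])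
    show "e \<odot>\<^bsub>M\<^esub> Q m \<in> N" if "m \<in> carrier M" for m using n(4)[OF e QN(1)[OF that]] .
    show "e \<odot>\<^bsub>M\<^esub> Q m = m" if m: "m \<in> N" for m
    proof -
      have mM: "m \<in> carrier M" using m n(1) by blast
      have "Q m = (of_nat (card S) \<odot>\<^bsub>H2\<^esub> \<one>\<^bsub>H2\<^esub>) \<odot>\<^bsub>M\<^esub> m"
        unfolding Q_def P_id[OF m] using fin mM by (rule const)
      then show ?thesis using mM e by (simp add: M.smult_assoc[symmetric] e_inv M.smult_one)
    qed
    show "e \<odot>\<^bsub>M\<^esub> Q (m \<oplus>\<^bsub>M\<^esub> m') = e \<odot>\<^bsub>M\<^esub> Q m \<oplus>\<^bsub>M\<^esub> e \<odot>\<^bsub>M\<^esub> Q m'" if "m \<in> carrier M" "m' \<in> carrier M" for m m'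
      using that e QN(2) by (simp add: Q_add M.smult_r_distr)
    show "e \<odot>\<^bsub>M\<^esub> Q (b \<odot>\<^bsub>M\<^esub> m) = b \<odot>\<^bsub>M\<^esub> (e \<odot>\<^bsub>M\<^esub> Q m)" if "b \<in> carrier H2" "m \<in> carrier M" for b m
      using that e QN(2) by (simp add: Q_smult M.smult_assoc[symmetric] e_comm)
  qed
qed

lemma submodule_RM:
  assumes "submodule N H2 M"
  shows "submodule N H1 RM"
proof -
  interpret RM: left_module H1 RM by (rule left_module_RM)
  note n = M.submoduleD[OF assms]
  show ?thesis
  proof (rule RM.submoduleI, unfold Res_simps(1-3))
    fix a m assume a: "a \<in> carrier H1" and m: "m \<in> N"
    then show "a \<odot>\<^bsub>RM\<^esub> m \<in> N" using n(1) n(4)[OF \<phi>_closed[OF a] m] by (auto simp: Res_simps)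
  qed (use n in auto)
qed

text \<open>Simple submodules of the restriction need not be stable under H2, so the criterion by
  complements is applied here.\<close>

lemma simply_generated_M:
  assumes "finite S" "simply_generated H1 \<pi>"
  shows "simply_generated H2 M"
proof (rule M.simply_generated_if_complements)
  interpret RM: left_module H1 RM by (rule left_module_RM)
  fix N assume N: "submodule N H2 M"
  obtain C where C: "submodule C H1 RM" "N \<inter> C = {\<zero>\<^bsub>RM\<^esub>}" "RM.submodule_sum N C = carrier RM"
    using RM.exists_complement[OF simply_generated_RM[OF assms(2)] submodule_RM[OF N]] by blast
  obtain u where u: "\<And>v. v \<in> carrier RM \<Longrightarrow> u v \<in> N" "\<And>v. v \<in> N \<Longrightarrow> u v = v"
    "\<And>v w. v \<in> carrier RM \<Longrightarrow> w \<in> carrier RM \<Longrightarrow> u (v \<oplus>\<^bsub>RM\<^esub> w) = u v \<oplus>\<^bsub>RM\<^esub> u w"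
    "\<And>a v. a \<in> carrier H1 \<Longrightarrow> v \<in> carrier RM \<Longrightarrow> u (a \<odot>\<^bsub>RM\<^esub> v) = a \<odot>\<^bsub>RM\<^esub> u v"
    by (rule RM.exists_projection[OF submodule_RM[OF N] C]) (rule that)
  note u' = u[unfolded Res_simps(1-3)]
  have uM: "u m \<in> carrier M" if "m \<in> carrier M" for m
    using u'(1)[OF that] M.submoduleD(1)[OF N] by blast
  show "\<exists>C. submodule C H2 M \<and> N \<inter> C = {\<zero>\<^bsub>M\<^esub>} \<and> M.submodule_sum N C = carrier M"
  proof (rule averaged_projection[OF assms(1) N, of u])
    show "u (\<phi> a \<odot>\<^bsub>M\<^esub> m) = \<phi> a \<odot>\<^bsub>M\<^esub> u m" if "a \<in> carrier H1" "m \<in> carrier M" for a m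
      using u'(4)[OF that] that uM[OF that(2)] by (simp add: Res_simps)
  qed (use u' in auto)
qed

lemma finite_S:
  assumes "finite (UNIV // {(x, y). x - y \<in> range f})"
  shows "finite S"
proof (rule inj_on_finite[OF _ _ assms])
  let ?r = "{(x, y). x - y \<in> range f}"
  show "(\<lambda>g. ?r `` {g}) ` S \<subseteq> UNIV // ?r" by (auto simp: quotient_def)
  show "inj_on (\<lambda>g. ?r `` {g}) S"
  proof (rule inj_onI)
    fix g g' assume g: "g \<in> S" "g' \<in> S" "?r `` {g} = ?r `` {g'}"
    have "g' - g' \<in> range f" using f_simps(4) by (metis cancel_comm_monoid_add_class.diff_cancel rangeI)
    then have "g' \<in> ?r `` {g}" using g(3) by blast
    then show "g = g'" using S_unique[OF g(1,2)] by simp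
  qed
qed

end

text \<open>The first conjunct certifies that the definite description \<open>conj_lift\<close>
  denotes an actual lift, so that the statements about \<open>twist\<close> have their intended
  content. The isomorphism carries a condition on the kernel of f because \<theta>_k with f k = 0
  acts as 1 on modules restricted from H2, but on a twist it acts as it does on \<pi>.\<close>

theorem theorem4p6:
  fixes \<H>1 :: "('x1::ab_group_add, 'y1::ab_group_add, 'h1) hecke"
    and \<H>2 :: "('x2::ab_group_add, 'y2::ab_group_add, 'h2) hecke"
    and f :: "'x1 \<Rightarrow> 'x2" and \<phi> :: "'h1 \<Rightarrow> 'h2"
    and \<pi> :: "('h1, 'v) module" and S :: "'x2 set"
  assumes "central_morphism \<H>1 \<H>2 f \<phi>"
    and "left_module (alg \<H>1) \<pi>"
    and "cokernel_reps f S"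
  shows
    "(\<forall>g\<in>S. is_conj_lift \<H>1 \<H>2 \<phi> (theta \<H>2 g) (conj_lift \<H>1 \<H>2 \<phi> (theta \<H>2 g)) \<and>
        left_module (alg \<H>1) (twist \<H>1 \<H>2 \<phi> \<pi> (theta \<H>2 g))) \<and>
     (kernel_acts_trivially \<H>1 f \<pi> \<longrightarrow>
        module_isomorphic (alg \<H>1)
          (Res (alg \<H>1) \<phi> (Ind (alg \<H>1) (alg \<H>2) \<phi> \<pi>))
          (direct_sum S (\<lambda>g. twist \<H>1 \<H>2 \<phi> \<pi> (theta \<H>2 g)))) \<and>
     (\<forall>g\<in>S. Res ((alg \<H>1)\<lparr>carrier := lattice_algebra \<H>1\<rparr>) id (twist \<H>1 \<H>2 \<phi> \<pi> (theta \<H>2 g)) =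
        Res ((alg \<H>1)\<lparr>carrier := lattice_algebra \<H>1\<rparr>) id \<pi>) \<and>
     (irreducible_module (alg \<H>1) \<pi> \<longrightarrow>
        (\<forall>g\<in>S. irreducible_module (alg \<H>1) (twist \<H>1 \<H>2 \<phi> \<pi> (theta \<H>2 g)))) \<and>
     (semisimple_module (alg \<H>1) \<pi> \<longrightarrow>
        semisimple_module (alg \<H>1) (Res (alg \<H>1) \<phi> (Ind (alg \<H>1) (alg \<H>2) \<phi> \<pi>))) \<and>
     (isogeny \<H>1 \<H>2 f \<phi> \<and> semisimple_module (alg \<H>1) \<pi> \<longrightarrow>
        semisimple_module (alg \<H>2) (Ind (alg \<H>1) (alg \<H>2) \<phi> \<pi>))"
proof -
  interpret hecke_induction \<H>1 \<H>2 f \<phi> \<pi> S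
    using assms by (simp add: hecke_induction_def hecke_morphism_def hecke_induction_axioms_def)
  show ?thesis
  proof (intro conjI ballI impI)
    fix g
    show "is_conj_lift \<H>1 \<H>2 \<phi> (theta \<H>2 g) (conj_lift \<H>1 \<H>2 \<phi> (theta \<H>2 g))"
      by (rule is_conj_lift_clift)
    show "left_module (alg \<H>1) (twist \<H>1 \<H>2 \<phi> \<pi> (theta \<H>2 g))" by (rule left_module_tw)
    show "Res ((alg \<H>1)\<lparr>carrier := lattice_algebra \<H>1\<rparr>) id (twist \<H>1 \<H>2 \<phi> \<pi> (theta \<H>2 g)) =
        Res ((alg \<H>1)\<lparr>carrier := lattice_algebra \<H>1\<rparr>) id \<pi>" by (rule Res_lattice_tw)
    show "irreducible_module (alg \<H>1) (twist \<H>1 \<H>2 \<phi> \<pi> (theta \<H>2 g))"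
      if "irreducible_module (alg \<H>1) \<pi>" using that by (rule irreducible_tw)
  next
    show "module_isomorphic (alg \<H>1) (Res (alg \<H>1) \<phi> (Ind (alg \<H>1) (alg \<H>2) \<phi> \<pi>))
        (direct_sum S (\<lambda>g. twist \<H>1 \<H>2 \<phi> \<pi> (theta \<H>2 g)))"
      if "kernel_acts_trivially \<H>1 f \<pi>" using that by (rule RM_isomorphic)
    assume ss: "semisimple_module (alg \<H>1) \<pi>"
    then show "semisimple_module (alg \<H>1) (Res (alg \<H>1) \<phi> (Ind (alg \<H>1) (alg \<H>2) \<phi> \<pi>))"
      unfolding semisimple_module_iff using left_module_RM simply_generated_RM by blast
  next
    assume "isogeny \<H>1 \<H>2 f \<phi> \<and> semisimple_module (alg \<H>1) \<pi>"
    then have "finite S" "simply_generated (alg \<H>1) \<pi>"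
      using finite_S by (simp_all add: isogeny_def semisimple_module_iff)
    then show "semisimple_module (alg \<H>2) (Ind (alg \<H>1) (alg \<H>2) \<phi> \<pi>)"
      unfolding semisimple_module_iff using ind.left_module_Ind simply_generated_M by blast
  qed
qed

end
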